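(* Let $\mathbf{x}=x_1,\ldots,x_n$ and $\mathbf{u}=u_1,\ldots,u_m$ be differential indeterminates over $\mathbb{C}$, and let $\mathbf{f}=f_1,\ldots,f_n$ and $\mathbf{g}=g_1,\ldots,g_s$ be polynomials in $\mathbb{C}[\mathbf{x},\mathbf{u}]$. Let $V\subset\mathbb{C}^{n+m}$ be the (nonempty) variety of common zeros of the ideal $(\mathbf{g})$, let $r:=\dim(V)\ge 0$, $\nu:=\max\{1,r\}$, and let $D$ be an upper bound for the degrees of $\mathbf{f}$, of $\mathbf{g}$ and of $V$. Then $$1\in[\dot{\mathbf{x}}-\mathbf{f},\mathbf{g}]\quad\Longleftrightarrow\quad 1\in(\dot{\mathbf{x}}-\mathbf{f},\ldots,\mathbf{x}^{(L+1)}-\mathbf{f}^{(L)},\mathbf{g},\ldots,\mathbf{g}^{(L)}),$$ where $L\le((n+m)D)^{2^{c\nu^2(n+m)}}$ for a universal constant $c>0$.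
   Context: $\mathbb{C}\{\mathbf{x},\mathbf{u}\}$ is the differential polynomial ring $\mathbb{C}[x_j^{(p)},u_k^{(p)}: p\in\mathbb{N}_0]$ with derivation $x_j^{(p)}\mapsto x_j^{(p+1)}$, $u_k^{(p)}\mapsto u_k^{(p+1)}$ and $\mathbb{C}$ as constants; $\dot z=z^{(1)}$, $h^{(p)}$ is the $p$-th total derivative of $h$, and for a family $\mathbf{h}$, $\mathbf{h}^{(p)}$ is the family of $p$-th derivatives. $[\cdot]$ denotes the differential ideal generated, and $(\cdot)$ the ordinary polynomial ideal in the polynomial ring in the finitely many variables involved. The degree of an irreducible affine variety is the number of points of its intersection with a generic affine linear subspace of complementary dimension; the degree of an arbitrary variety is the sum of the degrees of its irreducible components. *)

theory Defs
  imports Complex_Main "HOL-Library.Poly_Mapping"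
begin

type_synonym 'v mpoly = "('v \<Rightarrow>\<^sub>0 nat) \<Rightarrow>\<^sub>0 complex"

definition Var :: "'v \<Rightarrow> 'v mpoly" where
  "Var v = Poly_Mapping.single (Poly_Mapping.single v 1) 1"

definition Const :: "complex \<Rightarrow> 'v mpoly" where
  "Const c = Poly_Mapping.single 0 c"

definition mvars :: "'v mpoly \<Rightarrow> 'v set" where
  "mvars p = \<Union> (Poly_Mapping.keys ` Poly_Mapping.keys p)"

definition total_degree :: "'v mpoly \<Rightarrow> nat" where
  "total_degree p = Max (insert 0 ((\<lambda>\<alpha>. \<Sum>v\<in>Poly_Mapping.keys \<alpha>. Poly_Mapping.lookup \<alpha> v) ` Poly_Mapping.keys p))"

definition eval_mpoly :: "'v mpoly \<Rightarrow> ('v \<Rightarrow> complex) \<Rightarrow> complex" where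
  "eval_mpoly p a = (\<Sum>\<alpha>\<in>Poly_Mapping.keys p. Poly_Mapping.lookup p \<alpha> * (\<Prod>v\<in>Poly_Mapping.keys \<alpha>. a v ^ Poly_Mapping.lookup \<alpha> v))"

definition in_poly_ideal :: "'v set \<Rightarrow> 'v mpoly set \<Rightarrow> 'v mpoly \<Rightarrow> bool" where
  "in_poly_ideal A S p \<longleftrightarrow>
     (\<exists>F q. finite F \<and> F \<subseteq> S \<and> (\<forall>s\<in>F. mvars (q s) \<subseteq> A) \<and> p = (\<Sum>s\<in>F. q s * s))"

datatype dindet = DX nat | DU nat

text \<open>(DX j, p) stands for x_j^(p) and (DU k, p) for u_k^(p) (indices 0-based).\<close>

type_synonym dvar = "dindet \<times> nat"

definition shift_var :: "dvar \<Rightarrow> dvar" where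
  "shift_var w = (fst w, Suc (snd w))"

text \<open>The derivation, extended from the variables by linearity and the Leibniz rule.\<close>

definition dderiv :: "dvar mpoly \<Rightarrow> dvar mpoly" where
  "dderiv p = (\<Sum>\<alpha>\<in>Poly_Mapping.keys p. \<Sum>w\<in>Poly_Mapping.keys \<alpha>.
      Const (Poly_Mapping.lookup p \<alpha> * of_nat (Poly_Mapping.lookup \<alpha> w)) * Var (shift_var w) * Var w ^ (Poly_Mapping.lookup \<alpha> w - 1)
      * (\<Prod>w'\<in>Poly_Mapping.keys \<alpha> - {w}. Var w' ^ Poly_Mapping.lookup \<alpha> w'))"

definition dvars :: "nat \<Rightarrow> nat \<Rightarrow> dvar set" where
  "dvars n m = {(DX j, p) | j p. j < n} \<union> {(DU k, p) | k p. k < m}"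

definition dring :: "nat \<Rightarrow> nat \<Rightarrow> dvar mpoly set" where
  "dring n m = {p. mvars p \<subseteq> dvars n m}"

definition is_diff_ideal :: "nat \<Rightarrow> nat \<Rightarrow> dvar mpoly set \<Rightarrow> bool" where
  "is_diff_ideal n m I \<longleftrightarrow> I \<subseteq> dring n m \<and> 0 \<in> I \<and>
     (\<forall>a\<in>I. \<forall>b\<in>I. a + b \<in> I) \<and> (\<forall>r\<in>dring n m. \<forall>a\<in>I. r * a \<in> I) \<and>
     (\<forall>a\<in>I. dderiv a \<in> I)"

definition diff_ideal_gen :: "nat \<Rightarrow> nat \<Rightarrow> dvar mpoly set \<Rightarrow> dvar mpoly set" where
  "diff_ideal_gen n m S = \<Inter> {I. is_diff_ideal n m I \<and> S \<subseteq> I}"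

text \<open>C^N is represented by functions nat => complex vanishing outside {..<N};
polynomials on C^N have variables in {..<N}.\<close>

definition pts :: "nat \<Rightarrow> (nat \<Rightarrow> complex) set" where
  "pts N = {z. \<forall>i\<ge>N. z i = 0}"

definition zariski_closed :: "nat \<Rightarrow> (nat \<Rightarrow> complex) set \<Rightarrow> bool" where
  "zariski_closed N W \<longleftrightarrow> (\<exists>P. (\<forall>p\<in>P. mvars p \<subseteq> {..<N}) \<and>
      W = {z\<in>pts N. \<forall>p\<in>P. eval_mpoly p z = 0})"

definition zariski_open :: "nat \<Rightarrow> (nat \<Rightarrow> complex) set \<Rightarrow> bool" where
  "zariski_open N U \<longleftrightarrow> U \<subseteq> pts N \<and> zariski_closed N (pts N - U)"

definition irreducible_var :: "nat \<Rightarrow> (nat \<Rightarrow> complex) set \<Rightarrow> bool" where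
  "irreducible_var N W \<longleftrightarrow> zariski_closed N W \<and> W \<noteq> {} \<and>
     (\<forall>A B. zariski_closed N A \<and> zariski_closed N B \<and> W = A \<union> B \<longrightarrow> W = A \<or> W = B)"

definition var_dim :: "nat \<Rightarrow> (nat \<Rightarrow> complex) set \<Rightarrow> nat" where
  "var_dim N W = (GREATEST d. \<exists>Z :: nat \<Rightarrow> (nat \<Rightarrow> complex) set.
      (\<forall>i\<le>d. irreducible_var N (Z i) \<and> Z i \<subseteq> W) \<and> (\<forall>i<d. Z i \<subset> Z (Suc i)))"

definition irreducible_components :: "nat \<Rightarrow> (nat \<Rightarrow> complex) set \<Rightarrow> (nat \<Rightarrow> complex) set set" where
  "irreducible_components N W = {C. irreducible_var N C \<and> C \<subseteq> W \<and>
      (\<forall>C'. irreducible_var N C' \<and> C \<subseteq> C' \<and> C' \<subseteq> W \<longrightarrow> C' = C)}"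

text \<open>Affine linear subspace of C^N cut out by d linear equations whose coefficients are
read off a parameter point y in C^(d*(N+1)):
  sum_{j<N} y(i*(N+1)+j) * z_j = y(i*(N+1)+N),  i < d.\<close>

definition lin_subspace :: "nat \<Rightarrow> nat \<Rightarrow> (nat \<Rightarrow> complex) \<Rightarrow> (nat \<Rightarrow> complex) set" where
  "lin_subspace N d y = {z\<in>pts N. \<forall>i<d.
      (\<Sum>j<N. y (i * (N + 1) + j) * z j) = y (i * (N + 1) + N)}"

text \<open>Degree of an irreducible variety W of dimension d: the number of points of W \<inter> L
for L a generic affine subspace of dimension N - d (i.e. for all parameters in a nonempty
Zariski open subset of the parameter space).\<close>

definition irr_degree :: "nat \<Rightarrow> (nat \<Rightarrow> complex) set \<Rightarrow> nat" where
  "irr_degree N W = (let d = var_dim N W in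
     THE k. \<exists>U. zariski_open (d * (N + 1)) U \<and> U \<noteq> {} \<and>
        (\<forall>y\<in>U. finite (W \<inter> lin_subspace N d y) \<and> card (W \<inter> lin_subspace N d y) = k))"

definition var_degree :: "nat \<Rightarrow> (nat \<Rightarrow> complex) set \<Rightarrow> nat" where
  "var_degree N W = (\<Sum>C\<in>irreducible_components N W. irr_degree N C)"

definition coord_assign :: "nat \<Rightarrow> (nat \<Rightarrow> complex) \<Rightarrow> dvar \<Rightarrow> complex" where
  "coord_assign n z w = (case w of (DX j, _) \<Rightarrow> z j | (DU k, _) \<Rightarrow> z (n + k))"

definition base_vars :: "nat \<Rightarrow> nat \<Rightarrow> dvar set" where
  "base_vars n m = {(DX j, 0) | j. j < n} \<union> {(DU k, 0) | k. k < m}"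

definition variety :: "nat \<Rightarrow> nat \<Rightarrow> dvar mpoly list \<Rightarrow> (nat \<Rightarrow> complex) set" where
  "variety n m gs = {z\<in>pts (n + m). \<forall>g\<in>set gs. eval_mpoly g (coord_assign n z) = 0}"

definition ode_gens :: "nat \<Rightarrow> dvar mpoly list \<Rightarrow> dvar mpoly list \<Rightarrow> dvar mpoly set" where
  "ode_gens n fs gs = {Var (DX j, 1) - fs ! j | j. j < n} \<union> set gs"

definition ode_gens_trunc :: "nat \<Rightarrow> dvar mpoly list \<Rightarrow> dvar mpoly list \<Rightarrow> nat \<Rightarrow> dvar mpoly set" where
  "ode_gens_trunc n fs gs L =
     {(dderiv ^^ k) (Var (DX j, 1) - fs ! j) | j k. j < n \<and> k \<le> L} \<union>
     {(dderiv ^^ k) g | g k. g \<in> set gs \<and> k \<le> L}"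

definition trunc_vars :: "nat \<Rightarrow> nat \<Rightarrow> nat \<Rightarrow> dvar set" where
  "trunc_vars n m L = {(DX j, p) | j p. j < n \<and> p \<le> L + 1} \<union> {(DU k, p) | k p. k < m \<and> p \<le> L}"

end

theory Submission
  imports Defs "HOL-Library.FuncSet" "HOL-Computational_Algebra.Polynomial"
    "HOL-Computational_Algebra.Fraction_Field"
begin

text \<open>The polynomials of order at least \<open>L\<close> do not form a prime ideal: factors of
  low order may have a product of high order, the more easily the more factors there are. What saves
  the argument is that over the free coordinates the algebra defined by the monic equations is free
  of finite rank M, so a product that vanishes there has a vanishing subproduct of at most M
  factors. Hence the order threshold has to grow by about a rank bound for each coordinate counted
  as free, while a Siegel-type count gives the relevant relations a degree of about M^3, so that the
  next rank is about M^4. For the tangency a derivation only has to respect one separable equation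
  for each coordinate that is not free. Its x-components are forced to be q times f, its
  u-components solve a linear system modulo P. If there were no solution, elimination would yield a
  certificate of low degree outside P; along the trajectory this certificate is a sum of terms of
  high order, so it would lie in P. Elements of P are kept one order above the threshold because
  differentiation loses one order.\<close>

text \<open>
  Suppose that \<open>1\<close> is not in the truncated ideal and choose a prime \<open>Q\<close> above it. Taylor coefficients
  modulo \<open>Q\<close> give an order function \<open>v\<close> on polynomials in \<open>(x, u)\<close> for which \<open>g\<close> and
  \<open>x' - f\<close> have order at least \<open>L\<close>: an approximate trajectory. A Noether normalisation adapted to
  \<open>v\<close> produces coordinates \<open>y\<^sub>0, \<dots>\<close>, polynomials of low degree and high order that are successively monic
  in the last coordinates, and first \<open>k\<close> coordinates without a nonzero relation of low degree and high
  order. At most as many elimination steps as variables occur, each raising the degree to a fixed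
  power, which is where the doubly exponential bound comes from. Some prime \<open>P\<close> over these equations contains, in low degree,
  precisely the polynomials of high order; the approximate tangency of the trajectory then becomes, by
  Cramer's rule, an exact tangency. Hence the function field of \<open>P\<close> carries a derivation with
  \<open>x' = f\<close>, and it contains a solution of the system, so \<open>1\<close> is not in the differential ideal either.
\<close>

abbreviation "lookup \<equiv> Poly_Mapping.lookup"
abbreviation "keys \<equiv> Poly_Mapping.keys"
abbreviation "single \<equiv> Poly_Mapping.single"

section \<open>Homomorphisms and derivations of multivariate polynomials\<close>

definition is_hom :: "('a::comm_ring_1 \<Rightarrow> 'b::comm_ring_1) \<Rightarrow> bool" where
  "is_hom h \<longleftrightarrow> h 1 = 1 \<and> (\<forall>x y. h (x + y) = h x + h y) \<and> (\<forall>x y. h (x * y) = h x * h y)"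

lemma is_homI:
  "h 1 = 1 \<Longrightarrow> (\<And>x y. h (x + y) = h x + h y) \<Longrightarrow> (\<And>x y. h (x * y) = h x * h y) \<Longrightarrow> is_hom h"
  by (simp add: is_hom_def)

lemma is_hom_simps:
  assumes "is_hom h"
  shows "h 1 = 1" "h 0 = 0" "h (x + y) = h x + h y" "h (x * y) = h x * h y"
    "h (- x) = - h x" "h (x - y) = h x - h y" "h (x ^ n) = h x ^ n"
    "h (sum f F) = (\<Sum>i\<in>F. h (f i))" "h (prod f F) = (\<Prod>i\<in>F. h (f i))"
proof -
  have a: "h (x + y) = h x + h y" and m: "h (x * y) = h x * h y" and o: "h 1 = 1" for x y
    using assms by (auto simp: is_hom_def)
  show z: "h 0 = 0" using a[of 0 0] by simp
  have u: "h (- x) = - h x" for x using a[of x "- x"] z by (simp add: eq_neg_iff_add_eq_0 add.commute)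
  show "h (x + y) = h x + h y" "h (x * y) = h x * h y" "h 1 = 1" "h (- x) = - h x"
    by (rule a m o u)+
  show "h (x - y) = h x - h y" using a[of x "- y"] u[of y] by simp
  show "h (x ^ n) = h x ^ n" by (induction n) (auto simp: o m)
  show "h (sum f F) = (\<Sum>i\<in>F. h (f i))" by (induction F rule: infinite_finite_induct) (auto simp: z a)
  show "h (prod f F) = (\<Prod>i\<in>F. h (f i))" by (induction F rule: infinite_finite_induct) (auto simp: o m)
qed

lemma is_hom_comp: "is_hom g \<Longrightarrow> is_hom h \<Longrightarrow> is_hom (\<lambda>x. g (h x))"
  by (simp add: is_hom_def)

definition is_deriv :: "('a::comm_ring_1 \<Rightarrow> 'a) \<Rightarrow> bool" where
  "is_deriv d \<longleftrightarrow> (\<forall>x y. d (x + y) = d x + d y) \<and> (\<forall>x y. d (x * y) = d x * y + x * d y)"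

lemma is_derivI:
  "(\<And>x y. d (x + y) = d x + d y) \<Longrightarrow> (\<And>x y. d (x * y) = d x * y + x * d y) \<Longrightarrow> is_deriv d"
  by (simp add: is_deriv_def)

lemma is_deriv_simps:
  assumes "is_deriv d"
  shows "d 1 = 0" "d 0 = 0" "d (x + y) = d x + d y" "d (x * y) = d x * y + x * d y"
    "d (- x) = - d x" "d (x - y) = d x - d y" "d (sum f F) = (\<Sum>i\<in>F. d (f i))"
proof -
  have a: "d (x + y) = d x + d y" and m: "d (x * y) = d x * y + x * d y" for x y
    using assms by (auto simp: is_deriv_def)
  show z: "d 0 = 0" using a[of 0 0] by simp
  show "d 1 = 0" using m[of 1 1] by simp
  have u: "d (- x) = - d x" for x using a[of x "- x"] z by (simp add: eq_neg_iff_add_eq_0 add.commute)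
  show "d (x + y) = d x + d y" "d (x * y) = d x * y + x * d y" "d (- x) = - d x"
    by (rule a m u)+
  show "d (x - y) = d x - d y" using a[of x "- y"] u[of y] by simp
  show "d (sum f F) = (\<Sum>i\<in>F. d (f i))" by (induction F rule: infinite_finite_induct) (auto simp: z a)
qed

lemma is_deriv_funpow_add:
  assumes "is_deriv d"
  shows "(d ^^ k) (x + y) = (d ^^ k) x + (d ^^ k) y"
  by (induction k) (auto simp: is_deriv_simps[OF assms])

lemma is_deriv_Leibniz:
  assumes "is_deriv d"
  shows "(d ^^ k) (x * y) = (\<Sum>i\<le>k. of_nat (k choose i) * (d ^^ i) x * (d ^^ (k - i)) y)"
proof (induction k)
  case 0
  show ?case by simp
next
  case (Suc k)
  note D = is_deriv_simps[OF assms]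
  have dn: "d (of_nat n) = 0" for n by (induction n) (auto simp: D)
  have dmul: "d (of_nat n * a * b) = of_nat n * d a * b + of_nat n * a * d b" for n a b
    by (simp add: D dn algebra_simps)
  have dmul': "d (of_nat n * (a * b)) = of_nat n * (d a * b) + of_nat n * (a * d b)" for n a b
    using dmul[of n a b] by (simp add: mult.assoc)
  let ?t = "\<lambda>i j. (d ^^ i) x * (d ^^ j) y"
  have "(d ^^ Suc k) (x * y) = (\<Sum>i\<le>k. of_nat (k choose i) * ?t (Suc i) (k - i)) +
      (\<Sum>i\<le>k. of_nat (k choose i) * ?t i (Suc (k - i)))"
    by (simp add: Suc D(7) dmul' sum.distrib mult.assoc)
  also have "(\<Sum>i\<le>k. of_nat (k choose i) * ?t i (Suc (k - i))) =
      (\<Sum>i\<le>Suc k. of_nat (k choose i) * ?t i (Suc k - i))"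
    by (simp add: Suc_diff_le binomial_eq_0)
  also have "\<dots> = ?t 0 (Suc k) + (\<Sum>i\<le>k. of_nat (k choose Suc i) * ?t (Suc i) (k - i))"
    by (subst sum.atMost_Suc_shift) simp
  also have "(\<Sum>i\<le>k. of_nat (k choose i) * ?t (Suc i) (k - i)) + \<dots> =
      (\<Sum>i\<le>Suc k. of_nat (Suc k choose i) * ?t i (Suc k - i))"
    by (simp add: sum.atMost_Suc_shift sum.distrib[symmetric] algebra_simps del: sum.atMost_Suc)
  finally show ?case by (simp only: mult.assoc)
qed

section \<open>Polynomials as a free algebra: monomials, evaluation homomorphisms, induction\<close>

lemma Const_simps:
  "Const 0 = 0" "Const 1 = 1" "Const (a + b) = Const a + Const b" "Const (a * b) = Const a * Const b"
  by (simp_all add: Const_def single_add mult_single)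

lemma is_hom_Const: "is_hom Const"
  by (simp add: is_hom_def Const_simps)

lemma of_nat_eq_Const: "of_nat k = (Const (of_nat k) :: 'v mpoly)"
  by (simp add: Const_def)

lemma lookup_Const_mult: "lookup (Const c * p) \<alpha> = c * lookup p \<alpha>"
proof -
  have "Const c * p = Poly_Mapping.map ((*) c) p"
    by (simp add: Const_def mult_map_scale_conv_mult)
  then show ?thesis by (simp add: map.rep_eq when_def)
qed

definition pmon :: "('v \<Rightarrow>\<^sub>0 nat) \<Rightarrow> 'v mpoly" where
  "pmon \<alpha> = single \<alpha> 1"

lemma pmon_0: "pmon 0 = 1" by (simp add: pmon_def)

lemma pmon_add: "pmon (\<alpha> + \<beta>) = pmon \<alpha> * pmon \<beta>"
  by (simp add: pmon_def mult_single)

lemma single_eq_pmon: "single \<alpha> c = Const c * pmon \<alpha>"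
  by (simp add: pmon_def Const_def mult_single)

lemma sum_keys_pmon: "(\<Sum>\<alpha>\<in>keys p. Const (lookup p \<alpha>) * pmon \<alpha>) = p"
proof (rule poly_mapping_eqI)
  fix \<beta>
  show "lookup (\<Sum>\<alpha>\<in>keys p. Const (lookup p \<alpha>) * pmon \<alpha>) \<beta> = lookup p \<beta>"
    by (simp add: lookup_sum single_eq_pmon[symmetric] lookup_single when_def sum.delta in_keys_iff)
qed

definition mev :: "('v \<Rightarrow> 'b::comm_ring_1) \<Rightarrow> ('v \<Rightarrow>\<^sub>0 nat) \<Rightarrow> 'b" where
  "mev s \<alpha> = (\<Prod>v\<in>keys \<alpha>. s v ^ lookup \<alpha> v)"

lemma mev_superset:
  assumes "finite F" "keys \<alpha> \<subseteq> F"
  shows "mev s \<alpha> = (\<Prod>v\<in>F. s v ^ lookup \<alpha> v)"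
  unfolding mev_def using assms
  by (intro prod.mono_neutral_left) (auto simp: in_keys_iff)

lemma keys_add_nat: "keys (\<alpha> + \<beta> :: 'v \<Rightarrow>\<^sub>0 nat) = keys \<alpha> \<union> keys \<beta>"
  by (auto simp: in_keys_iff lookup_add)

lemma mev_add: "mev s (\<alpha> + \<beta>) = mev s \<alpha> * mev s \<beta>"
proof -
  let ?F = "keys \<alpha> \<union> keys \<beta>"
  have "mev s (\<alpha> + \<beta>) = (\<Prod>v\<in>?F. s v ^ lookup (\<alpha> + \<beta>) v)"
    by (rule mev_superset) (auto simp: keys_add_nat)
  also have "\<dots> = (\<Prod>v\<in>?F. s v ^ lookup \<alpha> v) * (\<Prod>v\<in>?F. s v ^ lookup \<beta> v)"
    by (simp add: lookup_add power_add prod.distrib)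
  also have "\<dots> = mev s \<alpha> * mev s \<beta>" by (simp add: mev_superset[of ?F])
  finally show ?thesis .
qed

lemma mev_0: "mev s 0 = 1" by (simp add: mev_def)

lemma mev_single: "mev s (single v k) = s v ^ k"
  by (cases "k = 0") (auto simp: mev_def)

lemma pmon_single: "pmon (single v k) = Var v ^ k"
proof (induction k)
  case (Suc k)
  have "single v (Suc k) = single v 1 + single v k"
    by (simp flip: single_add)
  then have "pmon (single v (Suc k)) = Var v * pmon (single v k)"
    by (simp only: pmon_add) (simp add: Var_def pmon_def)
  then show ?case by (simp add: Suc)
qed (simp add: pmon_0)

lemma sum_single_keys: "(\<Sum>v\<in>keys \<alpha>. single v (lookup \<alpha> v)) = (\<alpha> :: 'v \<Rightarrow>\<^sub>0 nat)"
  by (rule poly_mapping_eqI) (simp add: lookup_sum lookup_single when_def sum.delta in_keys_iff)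

lemma pmon_sum: "pmon (sum f F) = (\<Prod>i\<in>F. pmon (f i))"
  by (induction F rule: infinite_finite_induct) (auto simp: pmon_0 pmon_add)

lemma mev_Var: "mev Var \<alpha> = pmon \<alpha>"
proof -
  have "pmon \<alpha> = pmon (\<Sum>v\<in>keys \<alpha>. single v (lookup \<alpha> v))"
    by (simp only: sum_single_keys)
  then show ?thesis by (simp add: pmon_sum pmon_single mev_def)
qed

text \<open>The coefficient map \<open>\<kappa>\<close> is left free, so that evaluation at a point,
  substitution, passage to univariate polynomials and the map into a fraction field are all
  instances.\<close>

definition mhom :: "(complex \<Rightarrow> 'b::comm_ring_1) \<Rightarrow> ('v \<Rightarrow> 'b) \<Rightarrow> 'v mpoly \<Rightarrow> 'b" where
  "mhom \<kappa> s p = (\<Sum>\<alpha>\<in>keys p. \<kappa> (lookup p \<alpha>) * mev s \<alpha>)"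

context
  fixes \<kappa> :: "complex \<Rightarrow> 'b::comm_ring_1"
  assumes \<kappa>: "is_hom \<kappa>"
begin

lemma mhom_add: "mhom \<kappa> s (p + q) = mhom \<kappa> s p + mhom \<kappa> s q"
  unfolding mhom_def
  by (rule setsum_keys_plus_distrib) (auto simp: is_hom_simps[OF \<kappa>] algebra_simps)

lemma mhom_single: "mhom \<kappa> s (single \<alpha> c) = \<kappa> c * mev s \<alpha>"
  by (cases "c = 0") (auto simp: mhom_def is_hom_simps[OF \<kappa>])

lemma mhom_sum: "mhom \<kappa> s (sum f F) = (\<Sum>i\<in>F. mhom \<kappa> s (f i))"
  by (induction F rule: infinite_finite_induct) (auto simp: mhom_add, auto simp: mhom_def)

lemma mhom_mult: "mhom \<kappa> s (p * q) = mhom \<kappa> s p * mhom \<kappa> s q"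
proof -
  let ?t = "\<lambda>p \<alpha>. single \<alpha> (lookup p \<alpha>) :: 'v mpoly"
  have e: "(\<Sum>\<alpha>\<in>keys p. ?t p \<alpha>) = p" for p
    using sum_keys_pmon[of p] by (simp add: single_eq_pmon)
  have tt: "mhom \<kappa> s (?t p \<alpha> * ?t q \<beta>) = mhom \<kappa> s (?t p \<alpha>) * mhom \<kappa> s (?t q \<beta>)" for \<alpha> \<beta>
    by (simp add: mult_single mhom_single is_hom_simps[OF \<kappa>] mev_add algebra_simps)
  have "mhom \<kappa> s (p * q) = mhom \<kappa> s ((\<Sum>\<alpha>\<in>keys p. ?t p \<alpha>) * (\<Sum>\<beta>\<in>keys q. ?t q \<beta>))"
    by (simp only: e)
  also have "\<dots> = mhom \<kappa> s (\<Sum>\<alpha>\<in>keys p. ?t p \<alpha>) * mhom \<kappa> s (\<Sum>\<beta>\<in>keys q. ?t q \<beta>)"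
    by (simp only: sum_product mhom_sum tt)
  finally show ?thesis by (simp only: e)
qed

lemma mhom_Const [simp]: "mhom \<kappa> s (Const c) = \<kappa> c"
  by (simp add: Const_def mhom_single mev_0)

lemma mhom_Var [simp]: "mhom \<kappa> s (Var v) = s v"
  by (simp add: Var_def mhom_single mev_single is_hom_simps[OF \<kappa>])

lemma is_hom_mhom: "is_hom (mhom \<kappa> s)"
  using mhom_Const[of s 1] by (intro is_homI mhom_add mhom_mult) (simp add: Const_simps is_hom_simps[OF \<kappa>])

end

lemma mvars_mult: "mvars (p * q) \<subseteq> mvars p \<union> mvars q"
proof
  fix v assume "v \<in> mvars (p * q)"
  then obtain \<gamma> where \<gamma>: "\<gamma> \<in> keys (p * q)" "v \<in> keys \<gamma>" by (auto simp: mvars_def)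
  then obtain \<alpha> \<beta> where "\<alpha> \<in> keys p" "\<beta> \<in> keys q" "\<gamma> = \<alpha> + \<beta>"
    using keys_mult[of p q] by blast
  with \<gamma> show "v \<in> mvars p \<union> mvars q" by (auto simp: mvars_def keys_add_nat)
qed

text \<open>Reduces facts about homomorphisms and derivations to constants and variables. The last
  two cases keep the variable bounds, which the Leibniz rule uses in
  \<open>deriv_in_subring\<close>.\<close>

lemma mpoly_induct [consumes 1, case_names Const Var add mult]:
  assumes "mvars p \<subseteq> X"
    and C: "\<And>c. P (Const c)" and V: "\<And>v. v \<in> X \<Longrightarrow> P (Var v)"
    and A: "\<And>p q. mvars p \<subseteq> X \<Longrightarrow> mvars q \<subseteq> X \<Longrightarrow> P p \<Longrightarrow> P q \<Longrightarrow> P (p + q)"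
    and M: "\<And>p q. mvars p \<subseteq> X \<Longrightarrow> mvars q \<subseteq> X \<Longrightarrow> P p \<Longrightarrow> P q \<Longrightarrow> P (p * q)"
  shows "P p"
proof -
  have mc: "mvars (Const c) \<subseteq> X" for c
    by (cases "c = 0") (auto simp: mvars_def Const_def)
  have mv: "v \<in> X \<Longrightarrow> mvars (Var v) \<subseteq> X" for v by (simp add: mvars_def Var_def)
  have ma: "mvars p \<subseteq> X \<Longrightarrow> mvars q \<subseteq> X \<Longrightarrow> mvars (p + q) \<subseteq> X" for p q :: "'a mpoly"
    unfolding mvars_def using Poly_Mapping.keys_add[of p q] by blast
  have mm: "mvars p \<subseteq> X \<Longrightarrow> mvars q \<subseteq> X \<Longrightarrow> mvars (p * q) \<subseteq> X" for p q :: "'a mpoly"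
    using mvars_mult[of p q] by blast
  define Q where "Q = (\<lambda>p. mvars p \<subseteq> X \<and> P p)"
  have QC: "Q (Const c)" for c by (simp add: Q_def mc C)
  have QV: "v \<in> X \<Longrightarrow> Q (Var v)" for v by (simp add: Q_def mv V)
  have QA: "Q p \<Longrightarrow> Q q \<Longrightarrow> Q (p + q)" for p q by (simp add: Q_def ma A)
  have QM: "Q p \<Longrightarrow> Q q \<Longrightarrow> Q (p * q)" for p q by (simp add: Q_def mm M)
  have Q1: "Q 1" and Q0: "Q 0" using QC[of 1] QC[of 0] by (simp_all add: Const_simps)
  have Qp: "Q p \<Longrightarrow> Q (p ^ n)" for p n by (induction n) (auto simp: Q1 QM)
  have Qpmon: "Q (pmon \<alpha>)" if "keys \<alpha> \<subseteq> X" for \<alpha>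
  proof -
    have "Q (\<Prod>v\<in>F. Var v ^ lookup \<alpha> v)" if "F \<subseteq> X" for F
      using that by (induction F rule: infinite_finite_induct) (auto simp: Q1 QM Qp QV)
    then show ?thesis using that unfolding mev_Var[symmetric] mev_def by blast
  qed
  have "Q (\<Sum>\<alpha>\<in>F. Const (lookup p \<alpha>) * pmon \<alpha>)" if "F \<subseteq> keys p" for F
    using that
  proof (induction F rule: infinite_finite_induct)
    case (insert \<alpha> F)
    then have "keys \<alpha> \<subseteq> X" using assms(1) by (auto simp: mvars_def)
    then show ?case using insert by (auto intro!: QA QM QC Qpmon)
  qed (auto simp: Q0)
  then have "Q p" using sum_keys_pmon[of p] by (metis order_refl)
  then show ?thesis by (simp add: Q_def)
qed

lemma mvars_Const: "mvars (Const c) = {}"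
  by (cases "c = 0") (auto simp: mvars_def Const_def)

lemma mvars_Var: "mvars (Var v) = {v}"
  by (simp add: mvars_def Var_def)

lemma mvars_add: "mvars (p + q) \<subseteq> mvars p \<union> mvars q"
  unfolding mvars_def using Poly_Mapping.keys_add[of p q] by blast

lemma mvars_pmon: "mvars (pmon \<alpha>) = keys \<alpha>"
  by (simp add: mvars_def pmon_def)

definition polys_in :: "'v set \<Rightarrow> 'v mpoly set" where
  "polys_in X = {p. mvars p \<subseteq> X}"

definition is_subring :: "'a::comm_ring_1 set \<Rightarrow> bool" where
  "is_subring S \<longleftrightarrow> 1 \<in> S \<and> (\<forall>x\<in>S. \<forall>y\<in>S. x + y \<in> S \<and> x * y \<in> S) \<and> (\<forall>x\<in>S. - x \<in> S)"

lemma is_subring_simps: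
  assumes "is_subring S"
  shows "1 \<in> S" "0 \<in> S" "x \<in> S \<Longrightarrow> y \<in> S \<Longrightarrow> x + y \<in> S" "x \<in> S \<Longrightarrow> y \<in> S \<Longrightarrow> x * y \<in> S"
    "x \<in> S \<Longrightarrow> - x \<in> S" "x \<in> S \<Longrightarrow> y \<in> S \<Longrightarrow> x - y \<in> S" "x \<in> S \<Longrightarrow> x ^ n \<in> S"
    "(\<And>i. i \<in> F \<Longrightarrow> f i \<in> S) \<Longrightarrow> sum f F \<in> S" "(\<And>i. i \<in> F \<Longrightarrow> f i \<in> S) \<Longrightarrow> prod f F \<in> S"
    "of_nat n \<in> S"
proof -
  show o: "1 \<in> S" and a: "x \<in> S \<Longrightarrow> y \<in> S \<Longrightarrow> x + y \<in> S" and m: "x \<in> S \<Longrightarrow> y \<in> S \<Longrightarrow> x * y \<in> S"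
    and u: "x \<in> S \<Longrightarrow> - x \<in> S" for x y
    using assms by (auto simp: is_subring_def)
  show z: "0 \<in> S" using a[OF o u[OF o]] by simp
  show "x \<in> S \<Longrightarrow> y \<in> S \<Longrightarrow> x - y \<in> S" using a[of x "- y"] u by simp
  show "x \<in> S \<Longrightarrow> x ^ n \<in> S" by (induction n) (auto intro: o m)
  show "(\<And>i. i \<in> F \<Longrightarrow> f i \<in> S) \<Longrightarrow> sum f F \<in> S"
    by (induction F rule: infinite_finite_induct) (auto intro: z a)
  show "(\<And>i. i \<in> F \<Longrightarrow> f i \<in> S) \<Longrightarrow> prod f F \<in> S"
    by (induction F rule: infinite_finite_induct) (auto intro: o m)
  show "of_nat n \<in> S" by (induction n) (auto intro: z o a)
qed

lemma Const_in_polys_in: "Const c \<in> polys_in X"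
  by (simp add: polys_in_def mvars_Const)

lemma Var_in_polys_in: "v \<in> X \<Longrightarrow> Var v \<in> polys_in X"
  by (simp add: polys_in_def mvars_Var)

lemma is_subring_polys_in: "is_subring (polys_in X)"
proof -
  have "- p \<in> polys_in X" if "p \<in> polys_in X" for p
    using that by (simp add: polys_in_def mvars_def)
  moreover have "1 \<in> polys_in X" using Const_in_polys_in[of 1] by (simp add: Const_simps)
  ultimately show ?thesis
    unfolding is_subring_def polys_in_def using mvars_add mvars_mult by (metis (mono_tags, lifting) Un_least mem_Collect_eq subset_trans)
qed

lemmas polys_in_simps = is_subring_simps[OF is_subring_polys_in]

lemma mhom_in_subring:
  assumes "p \<in> polys_in X" "is_hom \<kappa>" "is_subring S" "\<And>c. \<kappa> c \<in> S" "\<And>v. v \<in> X \<Longrightarrow> s v \<in> S"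
  shows "mhom \<kappa> s p \<in> S"
  using assms(1) unfolding polys_in_def mem_Collect_eq
  by (induction p rule: mpoly_induct)
    (auto simp: assms mhom_add mhom_mult is_subring_simps[OF assms(3)])

lemma hom_eq_on_polys_in:
  assumes "p \<in> polys_in X" "is_hom g" "is_hom h" "\<And>c. g (Const c) = h (Const c)"
    "\<And>v. v \<in> X \<Longrightarrow> g (Var v) = h (Var v)"
  shows "g p = h p"
  using assms(1) unfolding polys_in_def mem_Collect_eq
  by (induction p rule: mpoly_induct) (auto simp: assms is_hom_simps[OF assms(2)] is_hom_simps[OF assms(3)])

lemma polys_in_UNIV: "p \<in> polys_in UNIV" by (simp add: polys_in_def)

lemma eval_mpoly_eq_mhom: "eval_mpoly p a = mhom (\<lambda>c. c) a p"
  by (simp add: eval_mpoly_def mhom_def mev_def)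

lemma is_hom_id: "is_hom (\<lambda>c. c)" by (simp add: is_hom_def)

text \<open>The formula of \<open>dderiv\<close> with arbitrary values \<open>s\<close> on the
  variables: the total derivative, the partial derivatives \<open>pdv\<close> and the vector field
  of the final construction are instances.\<close>

definition dext :: "('v \<Rightarrow> 'v mpoly) \<Rightarrow> 'v mpoly \<Rightarrow> 'v mpoly" where
  "dext s p = (\<Sum>\<alpha>\<in>keys p. \<Sum>w\<in>keys \<alpha>.
      Const (lookup p \<alpha> * of_nat (lookup \<alpha> w)) * s w * Var w ^ (lookup \<alpha> w - 1)
      * (\<Prod>w'\<in>keys \<alpha> - {w}. Var w' ^ lookup \<alpha> w'))"

lemma dderiv_eq_dext: "dderiv = dext (\<lambda>w. Var (shift_var w))"
  by (rule ext) (simp add: dderiv_def dext_def)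

definition dmon :: "('v \<Rightarrow> 'v mpoly) \<Rightarrow> ('v \<Rightarrow>\<^sub>0 nat) \<Rightarrow> 'v mpoly" where
  "dmon s \<alpha> = (\<Sum>w\<in>keys \<alpha>. of_nat (lookup \<alpha> w) * s w * Var w ^ (lookup \<alpha> w - 1)
      * (\<Prod>w'\<in>keys \<alpha> - {w}. Var w' ^ lookup \<alpha> w'))"

lemma dext_eq_dmon: "dext s p = (\<Sum>\<alpha>\<in>keys p. Const (lookup p \<alpha>) * dmon s \<alpha>)"
  by (simp add: dext_def dmon_def sum_distrib_left Const_simps of_nat_eq_Const mult.assoc)

lemma dmon_superset:
  assumes "finite F" "keys \<alpha> \<subseteq> F"
  shows "dmon s \<alpha> = (\<Sum>w\<in>F. of_nat (lookup \<alpha> w) * s w * Var w ^ (lookup \<alpha> w - 1)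
      * (\<Prod>w'\<in>F - {w}. Var w' ^ lookup \<alpha> w'))"
proof -
  have "(\<Prod>w'\<in>keys \<alpha> - {w}. Var w' ^ lookup \<alpha> w') =
      (\<Prod>w'\<in>F - {w}. Var w' ^ lookup \<alpha> w' :: 'a mpoly)" for w
    using assms by (intro prod.mono_neutral_left) (auto simp: in_keys_iff intro!: Nat.gr0I)
  then show ?thesis unfolding dmon_def using assms
    by (simp, intro sum.mono_neutral_left) (auto simp: in_keys_iff)
qed

lemma dmon_add: "dmon s (\<alpha> + \<beta>) = dmon s \<alpha> * pmon \<beta> + pmon \<alpha> * dmon s \<beta>"
proof -
  let ?F = "keys \<alpha> \<union> keys \<beta>"
  let ?P = "\<lambda>\<alpha> w. \<Prod>w'\<in>?F - {w}. Var w' ^ lookup \<alpha> w' :: 'a mpoly"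
  let ?a = "lookup \<alpha>" and ?b = "lookup \<beta>"
  have m: "pmon \<gamma> = Var w ^ lookup \<gamma> w * ?P \<gamma> w"
    if "w \<in> ?F" "keys \<gamma> \<subseteq> ?F" for w \<gamma>
    using that by (simp add: mev_Var[symmetric] mev_superset[of ?F] prod.remove[of ?F w])
  \<comment> \<open>Truncated subtraction is harmless: an exponent \<open>0 - 1\<close> always comes
    with the factor \<open>of_nat 0\<close>.\<close>
  have pw: "of_nat (a + b) * X ^ (a + b - 1) = of_nat a * X ^ (a - 1) * X ^ b + X ^ a * (of_nat b * X ^ (b - 1))"
    for a b and X :: "'a mpoly"
    by (cases a; cases b) (auto simp: algebra_simps power_add)
  have "dmon s (\<alpha> + \<beta>) = (\<Sum>w\<in>?F. (of_nat (?a w + ?b w) * Var w ^ (?a w + ?b w - 1)) * s w * (?P \<alpha> w * ?P \<beta> w))"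
    by (subst dmon_superset[of ?F])
      (auto simp: keys_add_nat lookup_add power_add prod.distrib algebra_simps intro!: sum.cong)
  also have "\<dots> = (\<Sum>w\<in>?F. (of_nat (?a w) * s w * Var w ^ (?a w - 1) * ?P \<alpha> w) * (Var w ^ ?b w * ?P \<beta> w) +
     (Var w ^ ?a w * ?P \<alpha> w) * (of_nat (?b w) * s w * Var w ^ (?b w - 1) * ?P \<beta> w))"
    by (rule sum.cong[OF refl], subst pw) (simp add: algebra_simps)
  also have "\<dots> = (\<Sum>w\<in>?F. (of_nat (?a w) * s w * Var w ^ (?a w - 1) * ?P \<alpha> w) * pmon \<beta> +
     pmon \<alpha> * (of_nat (?b w) * s w * Var w ^ (?b w - 1) * ?P \<beta> w))"
    by (rule sum.cong[OF refl]) (simp only: m[where \<gamma>=\<alpha>, symmetric] m[where \<gamma>=\<beta>, symmetric] Un_upper1 Un_upper2)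
  also have "\<dots> = dmon s \<alpha> * pmon \<beta> + pmon \<alpha> * dmon s \<beta>"
    by (simp add: sum.distrib sum_distrib_left sum_distrib_right dmon_superset[of ?F])
  finally show ?thesis .
qed

lemma dext_add: "dext s (p + q) = dext s p + dext s q"
  unfolding dext_eq_dmon
  by (rule setsum_keys_plus_distrib) (auto simp: Const_simps algebra_simps)

lemma dext_sum: "dext s (sum f F) = (\<Sum>i\<in>F. dext s (f i))"
  by (induction F rule: infinite_finite_induct) (auto simp: dext_add, auto simp: dext_def)

lemma dext_single: "dext s (Const c * pmon \<alpha>) = Const c * dmon s \<alpha>"
  unfolding single_eq_pmon[symmetric] by (cases "c = 0") (auto simp: dext_eq_dmon Const_simps)

lemma dext_mult: "dext s (p * q) = dext s p * q + p * dext s q"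
proof -
  let ?t = "\<lambda>p \<alpha>. Const (lookup p \<alpha>) * pmon \<alpha> :: 'a mpoly"
  have tt: "dext s (?t p \<alpha> * ?t q \<beta>) = dext s (?t p \<alpha>) * ?t q \<beta> + ?t p \<alpha> * dext s (?t q \<beta>)" for \<alpha> \<beta>
  proof -
    have "?t p \<alpha> * ?t q \<beta> = Const (lookup p \<alpha> * lookup q \<beta>) * pmon (\<alpha> + \<beta>)"
      by (simp add: Const_simps pmon_add algebra_simps)
    then show ?thesis by (simp only: dext_single dmon_add) (simp add: Const_simps algebra_simps)
  qed
  let ?p = "\<Sum>\<alpha>\<in>keys p. ?t p \<alpha>" and ?q = "\<Sum>\<beta>\<in>keys q. ?t q \<beta>"
  have "dext s (?p * ?q) = dext s ?p * ?q + ?p * dext s ?q"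
    by (simp only: sum_product dext_sum tt sum.distrib)
  then show ?thesis by (simp only: sum_keys_pmon)
qed

lemma is_deriv_dext: "is_deriv (dext s)"
  by (intro is_derivI dext_add dext_mult)

lemma dext_Const [simp]: "dext s (Const c) = 0"
  using dext_single[of s c 0] by (simp add: pmon_0 dmon_def)

lemma dext_Var [simp]: "dext s (Var v) = s v"
  using dext_single[of s 1 "single v 1"] pmon_single[of v 1]
  by (simp add: Const_simps dmon_def)

lemma is_deriv_dderiv: "is_deriv dderiv"
  by (simp add: dderiv_eq_dext is_deriv_dext)

lemma deriv_in_subring:
  assumes "p \<in> polys_in X" "is_deriv d" "is_subring S" "polys_in X \<subseteq> S" "\<And>c. d (Const c) \<in> S"
    "\<And>v. v \<in> X \<Longrightarrow> d (Var v) \<in> S"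
  shows "d p \<in> S"
  using assms(1) unfolding polys_in_def mem_Collect_eq
proof (induction p rule: mpoly_induct)
  case (mult p q)
  then have "p \<in> S" "q \<in> S" using assms(4) by (auto simp: polys_in_def)
  with mult show ?case by (auto simp: is_deriv_simps[OF assms(2)] intro!: is_subring_simps[OF assms(3)])
qed (auto simp: is_deriv_simps[OF assms(2)] assms(5,6) intro!: is_subring_simps[OF assms(3)])

definition pdv :: "'v \<Rightarrow> 'v mpoly \<Rightarrow> 'v mpoly" where
  "pdv l = dext (\<lambda>v. if v = l then 1 else 0)"

lemma pdv_in_polys_in: "p \<in> polys_in X \<Longrightarrow> pdv l p \<in> polys_in X"
  unfolding pdv_def
  by (rule deriv_in_subring[of _ X]) (auto intro: is_deriv_dext is_subring_polys_in polys_in_simps)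

text \<open>Used with \<open>h\<close> the identity or the inclusion of the coordinates into the
  differential variables; it expresses a vector field, or the total derivative, through the Jacobian
  of the equations.\<close>

lemma deriv_chain:
  assumes "p \<in> polys_in X" "finite X" "is_hom h" "is_deriv d" "\<And>c. d (h (Const c)) = 0"
  shows "d (h p) = (\<Sum>l\<in>X. h (pdv l p) * d (h (Var l)))"
  using assms(1) unfolding polys_in_def mem_Collect_eq
proof (induction p rule: mpoly_induct)
  case (Var v)
  have "(\<Sum>l\<in>X. h (pdv l (Var v)) * d (h (Var l))) = (\<Sum>l\<in>X. if l = v then d (h (Var v)) else 0)"
    by (rule sum.cong) (auto simp: pdv_def is_hom_simps[OF assms(3)])
  with Var show ?case using assms(2) by simp
qed (auto simp: assms pdv_def is_deriv_simps[OF is_deriv_dext] is_deriv_simps[OF assms(4)]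
    is_hom_simps[OF assms(3)] sum.distrib algebra_simps sum_distrib_left sum_distrib_right)

section \<open>Total degree\<close>

definition tdeg :: "('v \<Rightarrow>\<^sub>0 nat) \<Rightarrow> nat" where
  "tdeg \<alpha> = (\<Sum>v\<in>keys \<alpha>. lookup \<alpha> v)"

lemma tdeg_superset:
  assumes "finite F" "keys \<alpha> \<subseteq> F"
  shows "tdeg \<alpha> = (\<Sum>v\<in>F. lookup \<alpha> v)"
  unfolding tdeg_def using assms by (intro sum.mono_neutral_left) (auto simp: in_keys_iff)

lemma tdeg_add: "tdeg (\<alpha> + \<beta>) = tdeg \<alpha> + tdeg \<beta>"
  by (simp add: tdeg_superset[of "keys \<alpha> \<union> keys \<beta>"] keys_add_nat lookup_add sum.distrib)

lemma tdeg_0 [simp]: "tdeg 0 = 0" by (simp add: tdeg_def)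

lemma tdeg_single [simp]: "tdeg (single v k) = k"
  by (cases "k = 0") (auto simp: tdeg_def)

lemma lookup_le_tdeg: "lookup \<alpha> v \<le> tdeg \<alpha>"
proof (cases "v \<in> keys \<alpha>")
  case True then show ?thesis unfolding tdeg_def by (intro member_le_sum) auto
qed (simp add: in_keys_iff)

text \<open>A bound instead of a degree: cancellation and the zero polynomial need no special
  treatment.\<close>

definition tot_le :: "'v mpoly \<Rightarrow> nat \<Rightarrow> bool" where
  "tot_le p t \<longleftrightarrow> (\<forall>\<alpha>\<in>keys p. tdeg \<alpha> \<le> t)"

lemma tot_le_total_degree: "total_degree p \<le> t \<longleftrightarrow> tot_le p t"
  by (auto simp: total_degree_def tot_le_def tdeg_def[symmetric])

lemma tot_le_weaken: "tot_le p s \<Longrightarrow> s \<le> t \<Longrightarrow> tot_le p t"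
  by (fastforce simp: tot_le_def)

lemma tot_le_Const: "tot_le (Const c) t"
  by (cases "c = 0") (auto simp: tot_le_def Const_def)

lemma tot_le_0: "tot_le 0 t" and tot_le_1: "tot_le 1 t"
  by (auto simp: tot_le_def)

lemma tot_le_Var: "tot_le (Var v) (Suc 0)"
  by (simp add: tot_le_def Var_def)

lemma tot_le_pmon: "tdeg \<alpha> \<le> t \<Longrightarrow> tot_le (pmon \<alpha>) t"
  by (simp add: tot_le_def pmon_def)

lemma tot_le_add: "tot_le p t \<Longrightarrow> tot_le q t \<Longrightarrow> tot_le (p + q) t"
  unfolding tot_le_def using Poly_Mapping.keys_add[of p q] by blast

lemma tot_le_minus: "tot_le p t \<Longrightarrow> tot_le (- p) t"
  by (simp add: tot_le_def)

lemma tot_le_diff: "tot_le p t \<Longrightarrow> tot_le q t \<Longrightarrow> tot_le (p - q) t"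
  using tot_le_add[of p t "- q"] tot_le_minus[of q t] by simp

lemma tot_le_mult: "tot_le p s \<Longrightarrow> tot_le q t \<Longrightarrow> tot_le (p * q) (s + t)"
proof -
  assume "tot_le p s" "tot_le q t"
  then have "tdeg (\<alpha> + \<beta>) \<le> s + t" if "\<alpha> \<in> keys p" "\<beta> \<in> keys q" for \<alpha> \<beta>
    using that by (auto simp: tot_le_def tdeg_add intro: add_mono)
  then show ?thesis unfolding tot_le_def using keys_mult[of p q] by blast
qed

lemma tot_le_power: "tot_le p s \<Longrightarrow> tot_le (p ^ n) (n * s)"
  by (induction n) (auto simp: tot_le_1 intro: tot_le_mult)

lemma tot_le_sum: "(\<And>i. i \<in> F \<Longrightarrow> tot_le (f i) t) \<Longrightarrow> tot_le (sum f F) t"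
  by (induction F rule: infinite_finite_induct) (auto simp: tot_le_0 intro: tot_le_add)

lemma tot_le_prod: "(\<And>i. i \<in> F \<Longrightarrow> tot_le (f i) (t i)) \<Longrightarrow> tot_le (prod f F) (sum t F)"
  by (induction F rule: infinite_finite_induct) (auto simp: tot_le_1 intro: tot_le_mult)

lemma tot_le_mhom:
  assumes "tot_le p t" "\<And>v. tot_le (s v) 1"
  shows "tot_le (mhom Const s p) t"
  unfolding mhom_def
proof (rule tot_le_sum)
  fix \<alpha> assume \<alpha>: "\<alpha> \<in> keys p"
  have "tot_le (mev s \<alpha>) (tdeg \<alpha>)"
    unfolding mev_def tdeg_def using tot_le_power[OF assms(2)] by (intro tot_le_prod) simp
  then have "tot_le (Const (lookup p \<alpha>) * mev s \<alpha>) (0 + tdeg \<alpha>)"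
    by (intro tot_le_mult tot_le_Const)
  then show "tot_le (Const (lookup p \<alpha>) * mev s \<alpha>) t"
    using \<alpha> assms(1) by (auto simp: tot_le_def[of p] intro: tot_le_weaken)
qed

lemma tot_le_pdv:
  assumes "tot_le p t"
  shows "tot_le (pdv l p) t"
  unfolding pdv_def dext_eq_dmon
proof (rule tot_le_sum)
  fix \<alpha> assume \<alpha>: "\<alpha> \<in> keys p"
  let ?s = "\<lambda>v. if v = l then 1 else 0 :: 'a mpoly"
  have "tot_le (of_nat (lookup \<alpha> w) * ?s w * Var w ^ (lookup \<alpha> w - 1)
      * (\<Prod>w'\<in>keys \<alpha> - {w}. Var w' ^ lookup \<alpha> w')) (tdeg \<alpha>)"
    if w: "w \<in> keys \<alpha>" for w
  proof -
    have "tot_le (of_nat (lookup \<alpha> w) * ?s w * Var w ^ (lookup \<alpha> w - 1)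
      * (\<Prod>w'\<in>keys \<alpha> - {w}. Var w' ^ lookup \<alpha> w'))
      (0 + 0 + (lookup \<alpha> w - 1) * 1 + (\<Sum>w'\<in>keys \<alpha> - {w}. lookup \<alpha> w' * 1))"
      unfolding of_nat_eq_Const
      by (intro tot_le_mult tot_le_prod tot_le_power tot_le_Const)
        (auto simp: tot_le_Var tot_le_1 tot_le_0)
    moreover have "tdeg \<alpha> = lookup \<alpha> w + (\<Sum>w'\<in>keys \<alpha> - {w}. lookup \<alpha> w')"
      unfolding tdeg_def using w by (simp add: sum.remove)
    ultimately show ?thesis by (auto elim!: tot_le_weaken)
  qed
  then have "tot_le (dmon ?s \<alpha>) (tdeg \<alpha>)" unfolding dmon_def by (rule tot_le_sum)
  then have "tot_le (Const (lookup p \<alpha>) * dmon ?s \<alpha>) (0 + tdeg \<alpha>)"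
    by (intro tot_le_mult tot_le_Const)
  then show "tot_le (Const (lookup p \<alpha>) * dmon ?s \<alpha>) t"
    using \<alpha> assms by (auto simp: tot_le_def[of p] intro: tot_le_weaken)
qed

section \<open>Prime ideals, linear systems and derivations modulo a prime\<close>

definition is_ideal :: "'a::comm_ring_1 set \<Rightarrow> bool" where
  "is_ideal I \<longleftrightarrow> 0 \<in> I \<and> (\<forall>a\<in>I. \<forall>b\<in>I. a + b \<in> I) \<and> (\<forall>r. \<forall>a\<in>I. r * a \<in> I)"

lemma is_ideal_simps:
  assumes "is_ideal I"
  shows "0 \<in> I" "a \<in> I \<Longrightarrow> b \<in> I \<Longrightarrow> a + b \<in> I" "a \<in> I \<Longrightarrow> r * a \<in> I" "a \<in> I \<Longrightarrow> a * r \<in> I"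
    "a \<in> I \<Longrightarrow> - a \<in> I" "a \<in> I \<Longrightarrow> b \<in> I \<Longrightarrow> a - b \<in> I" "(\<And>i. i \<in> F \<Longrightarrow> f i \<in> I) \<Longrightarrow> sum f F \<in> I"
proof -
  show z: "0 \<in> I" and a: "a \<in> I \<Longrightarrow> b \<in> I \<Longrightarrow> a + b \<in> I" and m: "a \<in> I \<Longrightarrow> r * a \<in> I" for a b r
    using assms by (auto simp: is_ideal_def)
  show "a \<in> I \<Longrightarrow> a * r \<in> I" using m[of a r] by (simp add: mult.commute)
  show u: "a \<in> I \<Longrightarrow> - a \<in> I" for a using m[of a "- 1"] by simp
  show "a \<in> I \<Longrightarrow> b \<in> I \<Longrightarrow> a - b \<in> I" using a[of a "- b"] u[of b] by simp
  show "(\<And>i. i \<in> F \<Longrightarrow> f i \<in> I) \<Longrightarrow> sum f F \<in> I"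
    by (induction F rule: infinite_finite_induct) (auto intro: z a)
qed

definition is_prime :: "'a::comm_ring_1 set \<Rightarrow> bool" where
  "is_prime P \<longleftrightarrow> is_ideal P \<and> 1 \<notin> P \<and> (\<forall>a b. a * b \<in> P \<longrightarrow> a \<in> P \<or> b \<in> P)"

lemma is_prime_simps:
  assumes "is_prime P"
  shows "is_ideal P" "1 \<notin> P" "a * b \<in> P \<longleftrightarrow> a \<in> P \<or> b \<in> P" "a ^ n \<in> P \<Longrightarrow> a \<in> P"
proof -
  show i: "is_ideal P" and o: "1 \<notin> P" and m: "a * b \<in> P \<longleftrightarrow> a \<in> P \<or> b \<in> P" for a b
    using assms by (auto simp: is_prime_def is_ideal_simps)
  show "a ^ n \<in> P \<Longrightarrow> a \<in> P" by (induction n) (auto simp: o m)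
qed

text \<open>Krull's argument: an ideal maximal among those above \<open>I\<close> and disjoint from
  the multiplicative set \<open>S\<close> is prime, because adjoining any further element makes it
  meet \<open>S\<close>.\<close>

lemma prime_avoiding:
  assumes I: "is_ideal I" and S: "1 \<in> S" "\<And>a b. a \<in> S \<Longrightarrow> b \<in> S \<Longrightarrow> a * b \<in> S" and dis: "I \<inter> S = {}"
  obtains P where "is_prime P" "I \<subseteq> P" "P \<inter> S = {}"
proof -
  define \<A> where "\<A> = {J. is_ideal J \<and> I \<subseteq> J \<and> J \<inter> S = {}}"
  have "\<exists>M\<in>\<A>. \<forall>X\<in>\<A>. M \<subseteq> X \<longrightarrow> X = M"
  proof (rule subset_Zorn_nonempty)
    show "\<A> \<noteq> {}" using I dis by (auto simp: \<A>_def)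
    fix C assume C: "C \<noteq> {}" "subset.chain \<A> C"
    have sub: "J \<in> C \<Longrightarrow> is_ideal J \<and> I \<subseteq> J \<and> J \<inter> S = {}" for J
      using C(2) by (auto simp: subset.chain_def \<A>_def)
    have "is_ideal (\<Union>C)"
      unfolding is_ideal_def
    proof (intro conjI ballI allI)
      show "0 \<in> \<Union>C" using C(1) sub is_ideal_simps(1) by fastforce
      fix a b assume "a \<in> \<Union>C" "b \<in> \<Union>C"
      then obtain J K where JK: "J \<in> C" "K \<in> C" "a \<in> J" "b \<in> K" by blast
      then have "J \<subseteq> K \<or> K \<subseteq> J" using C(2) by (auto simp: subset.chain_def)
      then show "a + b \<in> \<Union>C" using JK sub is_ideal_simps(2) by (metis UnionI subsetD)
    next
      fix r a assume "a \<in> \<Union>C"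
      then show "r * a \<in> \<Union>C" using sub is_ideal_simps(3) by (metis UnionE UnionI)
    qed
    then show "\<Union>C \<in> \<A>" using sub C(1) by (auto simp: \<A>_def)
  qed
  then obtain P where P: "P \<in> \<A>" and max: "\<And>X. X \<in> \<A> \<Longrightarrow> P \<subseteq> X \<Longrightarrow> X = P" by blast
  have iP: "is_ideal P" and IP: "I \<subseteq> P" and dP: "P \<inter> S = {}" using P by (auto simp: \<A>_def)
  note Ps = is_ideal_simps[OF iP]
  have ext: "\<exists>p\<in>P. \<exists>r. p + r * a \<in> S" if "a \<notin> P" for a
  proof (rule ccontr)
    assume *: "\<not> ?thesis"
    let ?J = "{p + r * a | p r. p \<in> P}"
    have "is_ideal ?J"
      unfolding is_ideal_def
    proof (intro conjI ballI allI)
      show "0 \<in> ?J" using Ps(1) by (intro CollectI exI[of _ 0]) auto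
      fix x y assume "x \<in> ?J" "y \<in> ?J"
      then obtain p r p' r' where "p \<in> P" "p' \<in> P" "x = p + r * a" "y = p' + r' * a" by blast
      then show "x + y \<in> ?J" by (intro CollectI exI[of _ "p + p'"] exI[of _ "r + r'"]) (auto simp: Ps algebra_simps)
    next
      fix t x assume "x \<in> ?J"
      then obtain p r where "p \<in> P" "x = p + r * a" by blast
      then show "t * x \<in> ?J" by (intro CollectI exI[of _ "t * p"] exI[of _ "t * r"]) (auto simp: Ps algebra_simps)
    qed
    moreover have PJ: "P \<subseteq> ?J"
    proof
      fix p assume "p \<in> P" then show "p \<in> ?J" by (intro CollectI exI[of _ p] exI[of _ 0]) auto
    qed
    ultimately have "?J \<in> \<A>" using * IP by (auto simp: \<A>_def)
    then have "?J = P" using max PJ by blast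
    moreover have "a \<in> ?J" using Ps(1) by (intro CollectI exI[of _ 0] exI[of _ 1]) auto
    ultimately show False using that by blast
  qed
  have "a \<in> P \<or> b \<in> P" if ab: "a * b \<in> P" for a b
  proof (rule ccontr)
    assume "\<not> ?thesis"
    then obtain p r p' r' where *: "p \<in> P" "p' \<in> P" "p + r * a \<in> S" "p' + r' * b \<in> S" using ext by metis
    have "(p + r * a) * (p' + r' * b) = p * (p' + r' * b) + (r * a) * p' + r * r' * (a * b)"
      by (simp add: algebra_simps)
    also have "\<dots> \<in> P" using * ab by (intro Ps(2) Ps(4)[OF *(1)] Ps(3)[OF *(2)] Ps(3)[OF ab])
    finally show False using S(2)[OF *(3,4)] dP by blast
  qed
  then have "is_prime P" using iP dP S(1) by (auto simp: is_prime_def)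
  then show thesis using that IP dP by blast
qed

section \<open>Linear systems over a field and modulo a prime\<close>

lemma homogeneous_system:
  fixes a :: "'j \<Rightarrow> 'i \<Rightarrow> 'f::field"
  assumes "finite J" "finite I" "card J < card I"
  shows "\<exists>\<xi>. (\<exists>i\<in>I. \<xi> i \<noteq> 0) \<and> (\<forall>j\<in>J. (\<Sum>i\<in>I. a j i * \<xi> i) = 0)"
  using assms
proof (induction J arbitrary: I a rule: finite_induct)
  case empty
  then have "I \<noteq> {}" by auto
  then show ?case by (intro exI[of _ "\<lambda>_. 1"]) auto
next
  case (insert j0 J)
  show ?case
  proof (cases "\<forall>i\<in>I. a j0 i = 0")
    case True
    then show ?thesis using insert.IH[of I a] insert.prems insert.hyps by auto
  next
    case False
    then obtain i0 where i0: "i0 \<in> I" "a j0 i0 \<noteq> 0" by blast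
    define I' where "I' = I - {i0}"
    have I: "finite I'" "i0 \<notin> I'" "I = insert i0 I'" "card J < card I'"
      using insert.prems insert.hyps i0 by (auto simp: I'_def)
    define a' where "a' = (\<lambda>j i. a j i - a j i0 * a j0 i / a j0 i0)"
    obtain \<xi> where \<xi>: "\<exists>i\<in>I'. \<xi> i \<noteq> 0" "\<forall>j\<in>J. (\<Sum>i\<in>I'. a' j i * \<xi> i) = 0"
      using insert.IH[OF I(1,4), of a'] by blast
    define z where "z = - (\<Sum>i\<in>I'. a j0 i * \<xi> i) / a j0 i0"
    define \<xi>' where "\<xi>' = \<xi>(i0 := z)"
    have s: "(\<Sum>i\<in>I. a j i * \<xi>' i) = a j i0 * z + (\<Sum>i\<in>I'. a j i * \<xi> i)" for j
      using I by (auto simp: \<xi>'_def intro!: sum.cong)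
    have "(\<Sum>i\<in>I. a j i * \<xi>' i) = 0" if "j \<in> J" for j
    proof -
      have "0 = (\<Sum>i\<in>I'. a j i * \<xi> i - a j i0 / a j0 i0 * (a j0 i * \<xi> i))"
        using \<xi>(2) that by (simp add: a'_def left_diff_distrib mult.assoc)
      also have "\<dots> = (\<Sum>i\<in>I'. a j i * \<xi> i) - a j i0 / a j0 i0 * (\<Sum>i\<in>I'. a j0 i * \<xi> i)"
        by (simp add: sum_subtractf sum_distrib_left)
      finally show ?thesis using i0 by (simp add: s z_def)
    qed
    moreover have "(\<Sum>i\<in>I. a j0 i * \<xi>' i) = 0" using i0 by (simp add: s z_def)
    moreover have "\<exists>i\<in>I. \<xi>' i \<noteq> 0" using \<xi>(1) I by (auto simp: \<xi>'_def)
    ultimately show ?thesis by blast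
  qed
qed

text \<open>Abstracts a degree bound; \<open>is_filtration_tot_le\<close> supplies the instance by
  total degree.\<close>

definition is_filtration :: "(nat \<Rightarrow> 'a::comm_ring_1 set) \<Rightarrow> bool" where
  "is_filtration G \<longleftrightarrow> 1 \<in> G 0 \<and> (\<forall>s t. s \<le> t \<longrightarrow> G s \<subseteq> G t) \<and>
     (\<forall>t. \<forall>a\<in>G t. \<forall>b\<in>G t. a - b \<in> G t) \<and> (\<forall>s t. \<forall>a\<in>G s. \<forall>b\<in>G t. a * b \<in> G (s + t))"

lemma is_filtration_simps:
  assumes "is_filtration G"
  shows "1 \<in> G t" "0 \<in> G t" "s \<le> t \<Longrightarrow> a \<in> G s \<Longrightarrow> a \<in> G t" "a \<in> G t \<Longrightarrow> b \<in> G t \<Longrightarrow> a - b \<in> G t"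
    "a \<in> G t \<Longrightarrow> b \<in> G t \<Longrightarrow> a + b \<in> G t"
    "a \<in> G s \<Longrightarrow> b \<in> G t \<Longrightarrow> a * b \<in> G (s + t)" "(\<And>i. i \<in> F \<Longrightarrow> f i \<in> G t) \<Longrightarrow> sum f F \<in> G t"
    "is_subring (\<Union>t. G t)"
proof -
  show d: "a \<in> G t \<Longrightarrow> b \<in> G t \<Longrightarrow> a - b \<in> G t" and w: "s \<le> t \<Longrightarrow> a \<in> G s \<Longrightarrow> a \<in> G t"
    and m: "a \<in> G s \<Longrightarrow> b \<in> G t \<Longrightarrow> a * b \<in> G (s + t)" for a b s t
    using assms unfolding is_filtration_def by blast+
  show o: "1 \<in> G t" for t using assms w[of 0 t] by (auto simp: is_filtration_def)
  show z: "0 \<in> G t" for t using d[OF o o] by simp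
  have u: "a \<in> G t \<Longrightarrow> - a \<in> G t" for a t using d[OF z, of a t] by simp
  show a: "a \<in> G t \<Longrightarrow> b \<in> G t \<Longrightarrow> a + b \<in> G t" for a b t using d[of a t "- b"] u by simp
  show "(\<And>i. i \<in> F \<Longrightarrow> f i \<in> G t) \<Longrightarrow> sum f F \<in> G t"
    by (induction F rule: infinite_finite_induct) (auto intro: z a)
  show "is_subring (\<Union>t. G t)"
    unfolding is_subring_def
  proof (intro conjI ballI)
    fix x y assume "x \<in> (\<Union>t. G t)" "y \<in> (\<Union>t. G t)"
    then obtain s t where st: "x \<in> G s" "y \<in> G t" by blast
    then have "x + y \<in> G (s + t)" by (intro a) (auto intro: w[of s] w[of t])
    then show "x + y \<in> (\<Union>t. G t)" by blast
    show "x * y \<in> (\<Union>t. G t)" using m[OF st] by blast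
  qed (use o u in auto)
qed

text \<open>Gaussian elimination over the quotient field modulo \<open>P\<close>, carried out
  without division. Either there is a solution with common denominator \<open>q\<close> (up to
  sign), or a combination \<open>y\<close> of the rows kills all columns but not the right-hand
  side. Each elimination doubles the degree of the entries, whence the factor
  \<open>2 ^ card U - 1\<close>.\<close>

lemma fredholm_alternative:
  fixes c :: "'j \<Rightarrow> 'u \<Rightarrow> 'a::comm_ring_1"
  assumes "finite U" and J: "finite J" and G: "is_filtration G" and P: "is_prime P"
    and "\<And>j. j \<in> J \<Longrightarrow> b j \<in> G t" "\<And>j u. j \<in> J \<Longrightarrow> u \<in> U \<Longrightarrow> c j u \<in> G t"
  shows "(\<exists>q a. q \<notin> P \<and> q \<in> (\<Union>t. G t) \<and> (\<forall>u\<in>U. a u \<in> (\<Union>t. G t)) \<and>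
            (\<forall>j\<in>J. (\<Sum>u\<in>U. c j u * a u) + q * b j \<in> P)) \<or>
         (\<exists>y. (\<forall>j\<in>J. y j \<in> G ((2 ^ card U - 1) * t)) \<and> (\<forall>u\<in>U. (\<Sum>j\<in>J. y j * c j u) \<in> P) \<and>
            (\<Sum>j\<in>J. y j * b j) \<notin> P)"
  using assms(1,5,6)
proof (induction U arbitrary: c b t rule: finite_induct)
  case empty
  note Pi = is_ideal_simps[OF is_prime_simps(1)[OF P]]
  show ?case
  proof (cases "\<forall>j\<in>J. b j \<in> P")
    case True
    then show ?thesis using is_prime_simps(2)[OF P] is_filtration_simps(1)[OF G, of 0]
      by (intro disjI1 exI[of _ 1]) auto
  next
    case False
    then obtain j0 where j0: "j0 \<in> J" "b j0 \<notin> P" by blast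
    have "(\<Sum>j\<in>J. (if j = j0 then 1 else 0) * b j) = (\<Sum>j\<in>J. if j = j0 then b j0 else 0)"
      by (rule sum.cong) auto
    then have "(\<Sum>j\<in>J. (if j = j0 then 1 else 0) * b j) = b j0" using J j0 by simp
    then show ?thesis using j0
      by (intro disjI2 exI[of _ "\<lambda>j. if j = j0 then 1 else 0"])
        (auto simp: is_filtration_simps(1,2)[OF G])
  qed
next
  case (insert u0 U)
  note Pi = is_ideal_simps[OF is_prime_simps(1)[OF P]] and Gs = is_filtration_simps[OF G]
  note GS = is_subring_simps[OF Gs(8)]
  have le: "(2 ^ card U - 1) * t \<le> (2 ^ card (insert u0 U) - 1) * t"
    using insert.hyps by (intro mult_right_mono diff_le_mono) auto
  show ?case
  proof (cases "\<forall>j\<in>J. c j u0 \<in> P")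
    case True
    have "(\<exists>q a. q \<notin> P \<and> q \<in> (\<Union>t. G t) \<and> (\<forall>u\<in>U. a u \<in> (\<Union>t. G t)) \<and>
            (\<forall>j\<in>J. (\<Sum>u\<in>U. c j u * a u) + q * b j \<in> P)) \<or>
         (\<exists>y. (\<forall>j\<in>J. y j \<in> G ((2 ^ card U - 1) * t)) \<and> (\<forall>u\<in>U. (\<Sum>j\<in>J. y j * c j u) \<in> P) \<and>
            (\<Sum>j\<in>J. y j * b j) \<notin> P)"
      by (rule insert.IH) (auto intro: insert.prems)
    then show ?thesis
    proof (elim disjE exE conjE)
      fix q a assume *: "q \<notin> P" "q \<in> (\<Union>t. G t)" "\<forall>u\<in>U. a u \<in> (\<Union>t. G t)"
        "\<forall>j\<in>J. (\<Sum>u\<in>U. c j u * a u) + q * b j \<in> P"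
      have "(\<Sum>u\<in>insert u0 U. c j u * (a(u0 := 0)) u) = (\<Sum>u\<in>U. c j u * a u)" for j
        using insert.hyps by (auto intro!: sum.cong)
      then show ?thesis using * GS(2) by (intro disjI1 exI[of _ q] exI[of _ "a(u0 := 0)"]) auto
    next
      fix y assume *: "\<forall>j\<in>J. y j \<in> G ((2 ^ card U - 1) * t)" "\<forall>u\<in>U. (\<Sum>j\<in>J. y j * c j u) \<in> P"
            "(\<Sum>j\<in>J. y j * b j) \<notin> P"
      moreover have "(\<Sum>j\<in>J. y j * c j u0) \<in> P" using True by (intro Pi(7) Pi(3)) auto
      ultimately show ?thesis using Gs(3)[OF le] by (intro disjI2 exI[of _ y]) auto
    qed
  next
    case False
    then obtain j0 where j0: "j0 \<in> J" "c j0 u0 \<notin> P" by blast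
    \<comment> \<open>The pivot lies outside \<open>P\<close>. The new entries are 2 by 2 minors, of
      degree at most \<open>t + t\<close>, and row \<open>j0\<close> becomes zero.\<close>
    define \<pi> where "\<pi> = c j0 u0"
    define c' where "c' = (\<lambda>j u. \<pi> * c j u - c j u0 * c j0 u)"
    define b' where "b' = (\<lambda>j. \<pi> * b j - c j u0 * b j0)"
    have \<pi>: "\<pi> \<in> G t" "\<pi> \<notin> P" using j0 insert.prems by (auto simp: \<pi>_def)
    have "(\<exists>q a. q \<notin> P \<and> q \<in> (\<Union>t. G t) \<and> (\<forall>u\<in>U. a u \<in> (\<Union>t. G t)) \<and>
            (\<forall>j\<in>J. (\<Sum>u\<in>U. c' j u * a u) + q * b' j \<in> P)) \<or>
         (\<exists>y. (\<forall>j\<in>J. y j \<in> G ((2 ^ card U - 1) * (t + t))) \<and> (\<forall>u\<in>U. (\<Sum>j\<in>J. y j * c' j u) \<in> P) \<and>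
            (\<Sum>j\<in>J. y j * b' j) \<notin> P)"
      by (rule insert.IH) (auto simp: c'_def b'_def intro!: Gs(4) Gs(6) \<pi> insert.prems j0)
    then show ?thesis
    proof (elim disjE exE conjE)
      fix q a assume *: "q \<notin> P" "q \<in> (\<Union>t. G t)" "\<forall>u\<in>U. a u \<in> (\<Union>t. G t)"
        "\<forall>j\<in>J. (\<Sum>u\<in>U. c' j u * a u) + q * b' j \<in> P"
      \<comment> \<open>Back substitution: the pivot row determines the unknown \<open>u0\<close>
        over the common denominator \<open>\<pi> * q\<close>.\<close>
      define z where "z = - ((\<Sum>u\<in>U. c j0 u * a u) + q * b j0)"
      define a' where "a' = (\<lambda>u. if u = u0 then z else \<pi> * a u)"
      have inU: "x \<in> G t \<Longrightarrow> x \<in> (\<Union>t. G t)" for x by blast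
      have "c j0 u \<in> (\<Union>t. G t)" if "u \<in> U" for u using insert.prems(2)[OF j0(1)] that by blast
      moreover have "b j0 \<in> (\<Union>t. G t)" using insert.prems(1)[OF j0(1)] by blast
      ultimately have "z \<in> (\<Union>t. G t)" unfolding z_def using *
        by (intro GS(5) GS(3) GS(4) GS(8)) auto
      then have a': "\<forall>u\<in>insert u0 U. a' u \<in> (\<Union>t. G t)"
        using * GS(4)[OF inU[OF \<pi>(1)]] by (auto simp: a'_def)
      have "(\<Sum>u\<in>insert u0 U. c j u * a' u) + (\<pi> * q) * b j = (\<Sum>u\<in>U. c' j u * a u) + q * b' j" for j
      proof -
        have "(\<Sum>u\<in>insert u0 U. c j u * a' u) = c j u0 * z + (\<Sum>u\<in>U. c j u * (\<pi> * a u))"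
          using insert.hyps by (auto simp: a'_def intro!: sum.cong)
        moreover have "(\<Sum>u\<in>U. c' j u * a u) = (\<Sum>u\<in>U. c j u * (\<pi> * a u)) - c j u0 * (\<Sum>u\<in>U. c j0 u * a u)"
          by (simp add: c'_def algebra_simps sum_subtractf sum_distrib_left)
        ultimately show ?thesis by (simp only: z_def b'_def) (simp add: algebra_simps)
      qed
      moreover have "\<pi> * q \<notin> P" using * \<pi> by (simp add: is_prime_simps(3)[OF P])
      moreover have "\<pi> * q \<in> (\<Union>t. G t)" using * inU[OF \<pi>(1)] by (intro GS(4))
      ultimately show ?thesis using * a' by (intro disjI1 exI[of _ "\<pi> * q"] exI[of _ a']) auto
    next
      fix y assume *: "\<forall>j\<in>J. y j \<in> G ((2 ^ card U - 1) * (t + t))" "\<forall>u\<in>U. (\<Sum>j\<in>J. y j * c' j u) \<in> P"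
            "(\<Sum>j\<in>J. y j * b' j) \<notin> P"
      define z where "z = (\<Sum>j\<in>J. y j * c j u0)"
      \<comment> \<open>A certificate for the minors becomes one for the original rows: multiply by
        the pivot and correct the entry at the pivot row, so that the column of \<open>u0\<close>
        cancels exactly.\<close>
      define y' where "y' = (\<lambda>j. \<pi> * y j - (if j = j0 then z else 0))"
      have tr: "(\<Sum>j\<in>J. y' j * f j) = (\<Sum>j\<in>J. y j * (\<pi> * f j - c j u0 * f j0))" for f
      proof -
        have "(\<Sum>j\<in>J. y' j * f j) = (\<Sum>j\<in>J. \<pi> * y j * f j - (if j = j0 then z * f j0 else 0))"
          by (intro sum.cong) (auto simp: y'_def algebra_simps)
        also have "\<dots> = (\<Sum>j\<in>J. \<pi> * y j * f j) - z * f j0"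
          using J j0 by (simp add: sum_subtractf)
        also have "\<dots> = (\<Sum>j\<in>J. y j * (\<pi> * f j - c j u0 * f j0))"
          by (simp add: z_def sum_subtractf algebra_simps sum_distrib_left)
        finally show ?thesis .
      qed
      have e: "t + (2 ^ card U - 1) * (t + t) = (2 ^ card (insert u0 U) - 1) * t"
      proof -
        have "(1::nat) \<le> 2 ^ card U" by simp
        then obtain k where "2 ^ card U = Suc k" by (metis Suc_le_D One_nat_def)
        then show ?thesis using insert.hyps by (simp add: algebra_simps)
      qed
      have zG: "z \<in> G (t + (2 ^ card U - 1) * (t + t))"
        unfolding z_def using * insert.prems by (intro Gs(7)) (subst add.commute, auto intro!: Gs(6))
      have "\<forall>j\<in>J. y' j \<in> G (t + (2 ^ card U - 1) * (t + t))"
        unfolding y'_def using *(1) zG Gs(2) by (intro ballI Gs(4) Gs(6)[OF \<pi>(1)]) (blast, presburger)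
      moreover have "(\<Sum>j\<in>J. y' j * c j u) \<in> P" if "u \<in> insert u0 U" for u
      proof (cases "u = u0")
        case True
        have "(\<Sum>j\<in>J. y' j * c j u0) = 0" unfolding tr by (simp add: \<pi>_def mult.commute)
        then show ?thesis using True Pi(1) by simp
      next
        case False
        then show ?thesis using that * by (simp add: tr c'_def)
      qed
      moreover have "(\<Sum>j\<in>J. y' j * b j) \<notin> P" using * by (simp add: tr b'_def)
      ultimately show ?thesis unfolding e by (intro disjI2 exI[of _ y']) auto
    qed
  qed
qed

section \<open>Extension of derivations by one algebraic element modulo a prime\<close>

definition polys_over :: "'a::comm_ring_1 set \<Rightarrow> 'a poly set" where
  "polys_over C = {p. \<forall>i. coeff p i \<in> C}"

lemma is_subring_polys_over: "is_subring C \<Longrightarrow> is_subring (polys_over C)"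
proof -
  assume C: "is_subring C"
  note Cs = is_subring_simps[OF C]
  have "x * y \<in> polys_over C" if "x \<in> polys_over C" "y \<in> polys_over C" for x y
    using that by (auto simp: polys_over_def coeff_mult intro!: Cs(8) Cs(4))
  then show ?thesis unfolding is_subring_def by (auto simp: polys_over_def coeff_1 Cs)
qed

lemma monom_in_polys_over: "is_subring C \<Longrightarrow> a \<in> C \<Longrightarrow> monom a n \<in> polys_over C"
  by (auto simp: polys_over_def coeff_monom is_subring_simps)

text \<open>Multiplying by the leading coefficient replaces division, so quotient and remainder stay
  over \<open>C\<close>.\<close>

lemma pseudo_division_in_subring:
  fixes \<mu> Q :: "'a::idom poly"
  assumes C: "is_subring C" and \<mu>: "\<mu> \<in> polys_over C" "degree \<mu> > 0" and Q: "Q \<in> polys_over C"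
  shows "\<exists>n h r. h \<in> polys_over C \<and> r \<in> polys_over C \<and> smult (lead_coeff \<mu> ^ n) Q = h * \<mu> + r \<and> degree r < degree \<mu>"
  using Q
proof (induction "degree Q" arbitrary: Q rule: less_induct)
  case less
  note PC = is_subring_simps[OF is_subring_polys_over[OF C]]
  show ?case
  proof (cases "degree Q < degree \<mu>")
    case True
    then show ?thesis using less.prems PC(2) by (intro exI[of _ 0] exI[of _ 0] exI[of _ Q]) auto
  next
    case False
    define T where "T = monom (lead_coeff Q) (degree Q - degree \<mu>)"
    define Q' where "Q' = smult (lead_coeff \<mu>) Q - T * \<mu>"
    have TC: "T \<in> polys_over C" using less.prems unfolding T_def
      by (intro monom_in_polys_over[OF C]) (auto simp: polys_over_def)
    have sm: "smult a p \<in> polys_over C" if "a \<in> C" "p \<in> polys_over C" for a p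
      using that C by (auto simp: polys_over_def is_subring_simps)
    have lc: "lead_coeff \<mu> \<in> C" using \<mu>(1) by (auto simp: polys_over_def)
    have Q'C: "Q' \<in> polys_over C" unfolding Q'_def using less.prems \<mu>(1) TC lc
      by (intro PC(6) PC(4) sm)
    have "degree (T * \<mu>) \<le> degree Q"
      using degree_mult_le[of T \<mu>] False unfolding T_def
      by (metis (no_types, lifting) add_le_mono1 degree_monom_le le_add_diff_inverse2 linorder_not_less order_trans)
    then have "degree Q' \<le> degree Q" unfolding Q'_def
      by (intro degree_diff_le) (auto intro: degree_smult_le order_trans)
    moreover have "coeff Q' (degree Q) = 0"
      using False coeff_monom_mult[of "lead_coeff Q" "degree Q - degree \<mu>" \<mu> "degree Q"]
      by (simp add: Q'_def T_def)
    moreover have "degree Q > 0" using False \<mu>(2) by simp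
    ultimately have "degree Q' < degree Q"
      by (metis degree_0 leading_coeff_0_iff le_neq_implies_less)
    from less.hyps[OF this Q'C] obtain n h r where *: "h \<in> polys_over C" "r \<in> polys_over C"
      "smult (lead_coeff \<mu> ^ n) Q' = h * \<mu> + r" "degree r < degree \<mu>" by blast
    have "smult (lead_coeff \<mu> ^ Suc n) Q = smult (lead_coeff \<mu> ^ n) Q' + smult (lead_coeff \<mu> ^ n) T * \<mu>"
      by (simp add: Q'_def smult_diff_right mult.commute)
    also have "\<dots> = (h + smult (lead_coeff \<mu> ^ n) T) * \<mu> + r" using *(3) by (simp add: algebra_simps)
    finally show ?thesis using * TC lc
      by (intro exI[of _ "Suc n"] exI[of _ "h + smult (lead_coeff \<mu> ^ n) T"] exI[of _ r])
        (auto intro!: PC(3) sm is_subring_simps[OF C])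
  qed
qed

lemma deriv_poly:
  fixes d :: "'a::idom \<Rightarrow> 'a"
  assumes "is_deriv d"
  shows "d (poly p y) = poly (map_poly d p) y + poly (pderiv p) y * d y"
proof (induction p)
  case (pCons a p)
  have "map_poly d (pCons a p) = pCons (d a) (map_poly d p)"
    by (intro map_poly_pCons) (simp add: is_deriv_simps[OF assms])
  then show ?case using pCons by (simp add: is_deriv_simps[OF assms] pderiv_pCons algebra_simps)
qed (simp add: is_deriv_simps[OF assms])

lemma poly_in_ideal: "is_ideal I \<Longrightarrow> (\<And>i. coeff p i \<in> I) \<Longrightarrow> poly p y \<in> I"
  unfolding poly_altdef by (intro is_ideal_simps(7) is_ideal_simps(4))

text \<open>A leading term with coefficient in \<open>P\<close> changes the value at
  \<open>y\<close> only by an element of \<open>P\<close> and may be dropped; the coefficient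
  outside \<open>P\<close> stops this before nothing is left.\<close>

lemma strip_leading_terms:
  fixes R :: "'a::idom poly"
  assumes P: "is_ideal P" and C: "is_subring C" and "R \<in> polys_over C" "poly R y \<in> P" "coeff R i \<notin> P"
  shows "\<exists>R'\<in>polys_over C. degree R' \<le> degree R \<and> poly R' y \<in> P \<and> lead_coeff R' \<notin> P"
  using assms(3-5)
proof (induction "degree R" arbitrary: R rule: less_induct)
  case less
  note Pi = is_ideal_simps[OF P]
  show ?case
  proof (cases "lead_coeff R \<in> P")
    case False
    then show ?thesis using less.prems by blast
  next
    case True
    define R' where "R' = R - monom (lead_coeff R) (degree R)"
    have i: "i \<noteq> degree R" using True less.prems by auto
    then have d0: "degree R > 0" using less.prems Pi(1) by (metis coeff_eq_0 gr0I linorder_neqE_nat)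
    have "degree R' \<le> degree R" unfolding R'_def
      by (intro degree_diff_le) (auto intro: degree_monom_le)
    moreover have "coeff R' (degree R) = 0" by (simp add: R'_def)
    ultimately have dl: "degree R' < degree R" using d0
      by (metis degree_0 leading_coeff_0_iff le_neq_implies_less)
    have "R' \<in> polys_over C" unfolding R'_def using less.prems
      by (intro is_subring_simps(6)[OF is_subring_polys_over[OF C]] monom_in_polys_over[OF C]) (auto simp: polys_over_def)
    moreover have "poly R' y \<in> P" using less.prems True by (auto simp: R'_def poly_monom intro!: Pi(6) Pi(4))
    moreover have "coeff R' i \<notin> P" using i less.prems by (simp add: R'_def)
    ultimately show ?thesis using less.hyps[OF dl] dl by (meson less_imp_le order_trans)
  qed
qed

text \<open>A derivation that maps a prime \<open>P\<close> into itself over a subring \<open>C\<close> does so over \<open>C[y]\<close> as soon as it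
  respects one separable equation \<open>m(y) = 0\<close>: compare \<open>m\<close> with a minimal polynomial of \<open>y\<close> modulo \<open>P\<close>.\<close>

lemma deriv_extends_mod_prime:
  fixes P :: "'a::idom set"
  assumes P: "is_prime P" and d: "is_deriv d" and C: "is_subring C" and base: "\<And>a. a \<in> C \<Longrightarrow> a \<in> P \<Longrightarrow> d a \<in> P"
    and m: "m \<in> polys_over C" "poly m y \<in> P" "poly (pderiv m) y \<notin> P" "d (poly m y) \<in> P"
    and Q: "Q \<in> polys_over C" "poly Q y \<in> P"
  shows "d (poly Q y) \<in> P"
proof -
  note Pi = is_ideal_simps[OF is_prime_simps(1)[OF P]] and Pm = is_prime_simps(3)[OF P]
    and D = is_deriv_simps[OF d]
  define \<M> where "\<M> = (\<lambda>\<mu>. \<mu> \<in> polys_over C \<and> poly \<mu> y \<in> P \<and> lead_coeff \<mu> \<notin> P)"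
  have "\<exists>i. coeff m i \<notin> P"
  proof (rule ccontr)
    assume "\<not> ?thesis"
    then have "poly (pderiv m) y \<in> P"
      by (intro poly_in_ideal is_prime_simps(1)[OF P]) (auto simp: coeff_pderiv simp del: of_nat_Suc intro!: Pi(3))
    then show False using m by simp
  qed
  then obtain \<mu>0 where "\<M> \<mu>0"
    using strip_leading_terms[OF is_prime_simps(1)[OF P] C m(1,2)] by (auto simp: \<M>_def)
  then obtain \<mu> where \<mu>: "\<M> \<mu>" and min: "\<And>\<mu>'. \<M> \<mu>' \<Longrightarrow> degree \<mu> \<le> degree \<mu>'"
    using ex_has_least_nat[of \<M> \<mu>0 degree] by blast
  \<comment> \<open>Otherwise stripping leading terms would give a member of \<open>\<M>\<close> of
    smaller degree than the minimal \<open>\<mu>\<close>.\<close>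
  have small: "coeff r i \<in> P" if "r \<in> polys_over C" "poly r y \<in> P" "degree r < degree \<mu>" for r i
    using strip_leading_terms[OF is_prime_simps(1)[OF P] C that(1,2)] that(3) min
    by (metis \<M>_def linorder_not_less order.strict_trans1)
  have dpos: "degree \<mu> > 0"
  proof (rule ccontr)
    assume "\<not> ?thesis"
    then obtain a where "\<mu> = [:a:]" by (metis degree_eq_zeroE gr0I)
    then show False using \<mu> by (simp add: \<M>_def)
  qed
  define l where "l = lead_coeff \<mu>"
  \<comment> \<open>Divide \<open>Q\<close> by \<open>\<mu>\<close>: the remainder has all its
    coefficients in \<open>P\<close>, and \<open>base\<close> puts their images under
    \<open>d\<close> there too. Differentiating the division identity in both ways gives two
    congruences with the same multiplier \<open>h\<close>.\<close>
  have red: "\<exists>n h. l ^ n * d (poly Q y) - poly h y * d (poly \<mu> y) \<in> P \<and>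
      l ^ n * poly (pderiv Q) y - poly h y * poly (pderiv \<mu>) y \<in> P"
    if Q: "Q \<in> polys_over C" "poly Q y \<in> P" for Q
  proof -
    obtain n h r where *: "h \<in> polys_over C" "r \<in> polys_over C" "smult (l ^ n) Q = h * \<mu> + r" "degree r < degree \<mu>"
      using pseudo_division_in_subring[OF C _ dpos Q(1)] \<mu> by (auto simp: \<M>_def l_def)
    have e: "l ^ n * poly Q y = poly h y * poly \<mu> y + poly r y"
      using arg_cong[OF *(3), of "\<lambda>p. poly p y"] by simp
    have "poly r y = l ^ n * poly Q y - poly h y * poly \<mu> y" using e by simp
    also have "\<dots> \<in> P" using Q \<mu> by (auto simp: \<M>_def intro!: Pi(6) Pi(3))
    finally have r: "coeff r i \<in> P" for i using small * by blast
    have rd: "poly (pderiv r) y \<in> P"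
      by (intro poly_in_ideal is_prime_simps(1)[OF P]) (auto simp: coeff_pderiv r simp del: of_nat_Suc intro!: Pi(3))
    have "coeff (map_poly d r) i \<in> P" for i
      using r[of i] *(2) base by (auto simp: coeff_map_poly D polys_over_def)
    then have "d (poly r y) \<in> P" unfolding deriv_poly[OF d]
      by (auto intro!: Pi(2) Pi(4) rd poly_in_ideal is_prime_simps(1)[OF P])
    have "d (l ^ n * poly Q y) = d (poly h y * poly \<mu> y + poly r y)" by (simp only: e)
    then have "l ^ n * d (poly Q y) - poly h y * d (poly \<mu> y) = d (poly h y) * poly \<mu> y + d (poly r y) - d (l ^ n) * poly Q y"
      by (simp add: D algebra_simps)
    also have "\<dots> \<in> P" using Q \<mu> \<open>d (poly r y) \<in> P\<close> by (auto simp: \<M>_def intro!: Pi(6) Pi(2) Pi(3))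
    finally have 1: "l ^ n * d (poly Q y) - poly h y * d (poly \<mu> y) \<in> P" .
    have "poly (pderiv (smult (l ^ n) Q)) y = poly (pderiv (h * \<mu> + r)) y" by (simp only: *(3))
    then have "l ^ n * poly (pderiv Q) y - poly h y * poly (pderiv \<mu>) y = poly (pderiv h) y * poly \<mu> y + poly (pderiv r) y"
      by (simp add: pderiv_smult pderiv_mult pderiv_add algebra_simps)
    also have "\<dots> \<in> P" using \<mu> rd by (auto simp: \<M>_def intro!: Pi(2) Pi(3))
    finally show ?thesis using 1 by blast
  qed
  have ln: "l ^ n * x \<in> P \<Longrightarrow> x \<in> P" for n x
    using \<mu> is_prime_simps(4)[OF P, of l n] by (auto simp: Pm \<M>_def l_def)
  \<comment> \<open>Apply \<open>red\<close> to \<open>m\<close> itself: separability and the second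
    congruence keep the value of \<open>h\<close> at \<open>y\<close> outside \<open>P\<close>; the
    first congruence then forces \<open>d (poly \<mu> y)\<close> into \<open>P\<close>.\<close>
  have "d (poly \<mu> y) \<in> P"
  proof -
    obtain n h where *: "l ^ n * d (poly m y) - poly h y * d (poly \<mu> y) \<in> P"
      "l ^ n * poly (pderiv m) y - poly h y * poly (pderiv \<mu>) y \<in> P"
      using red[OF m(1,2)] by blast
    have "poly h y \<notin> P"
    proof
      assume "poly h y \<in> P"
      then have "poly h y * poly (pderiv \<mu>) y \<in> P" by (rule Pi)
      then have "l ^ n * poly (pderiv m) y \<in> P" using Pi(2)[OF *(2)] by (metis diff_add_cancel)
      then show False using ln m(3) by blast
    qed
    moreover have "poly h y * d (poly \<mu> y) \<in> P"
      using Pi(6)[OF Pi(3)[OF m(4), of "l ^ n"] *(1)] by simp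
    ultimately show ?thesis by (simp add: Pm)
  qed
  moreover obtain n h where "l ^ n * d (poly Q y) - poly h y * d (poly \<mu> y) \<in> P" using red[OF Q] by blast
  ultimately have "l ^ n * d (poly Q y) \<in> P"
    using Pi(2)[OF _ Pi(3)] by (metis diff_add_cancel)
  then show ?thesis by (rule ln)
qed

section \<open>Order functions and reduction modulo monic triangular systems\<close>

text \<open>\<open>V a t\<close> is to be read as \<open>v(a) \<ge> t\<close> for a valuation \<open>v\<close> with values in the natural numbers and infinity.\<close>

definition is_val :: "('a::comm_ring_1 \<Rightarrow> nat \<Rightarrow> bool) \<Rightarrow> bool" where
  "is_val V \<longleftrightarrow> (\<forall>a b t. V a t \<longrightarrow> V b t \<longrightarrow> V (a + b) t) \<and> (\<forall>a b t. V a t \<longrightarrow> V (b * a) t) \<and>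
     (\<forall>a b s t. \<not> V a s \<longrightarrow> \<not> V b t \<longrightarrow> \<not> V (a * b) (s + t)) \<and> (\<forall>a s t. V a t \<longrightarrow> s \<le> t \<longrightarrow> V a s) \<and>
     \<not> V 1 1 \<and> (\<forall>t. V 0 t)"

lemma is_val_simps:
  assumes "is_val V"
  shows "V a t \<Longrightarrow> V b t \<Longrightarrow> V (a + b) t" "V a t \<Longrightarrow> V (b * a) t" "V a t \<Longrightarrow> V (a * b) t"
    "\<not> V a s \<Longrightarrow> \<not> V b t \<Longrightarrow> \<not> V (a * b) (s + t)" "V a t \<Longrightarrow> s \<le> t \<Longrightarrow> V a s" "\<not> V 1 1" "V 0 t"
    "V a t \<Longrightarrow> V b t \<Longrightarrow> V (a - b) t" "(\<And>i. i \<in> F \<Longrightarrow> V (f i) t) \<Longrightarrow> V (sum f F) t"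
proof -
  show a: "V a t \<Longrightarrow> V b t \<Longrightarrow> V (a + b) t" and m: "V a t \<Longrightarrow> V (b * a) t"
    and "\<not> V a s \<Longrightarrow> \<not> V b t \<Longrightarrow> \<not> V (a * b) (s + t)" "V a t \<Longrightarrow> s \<le> t \<Longrightarrow> V a s" "\<not> V 1 1"
    and z: "V 0 t" for a b s t
    using assms unfolding is_val_def by meson+
  show "V a t \<Longrightarrow> V (a * b) t" using m[of a t b] by (simp add: mult.commute)
  show "V a t \<Longrightarrow> V b t \<Longrightarrow> V (a - b) t" using a[of a t "- b"] m[of b t "- 1"] by simp
  show "(\<And>i. i \<in> F \<Longrightarrow> V (f i) t) \<Longrightarrow> V (sum f F) t"
    by (induction F rule: infinite_finite_induct) (auto intro: z a)
qed

lemma is_val_hom: "is_val V \<Longrightarrow> is_hom h \<Longrightarrow> is_val (\<lambda>a. V (h a))"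
  by (simp add: is_val_def is_hom_simps)

text \<open>The final \<open>+ 1\<close> accounts for the empty product, for which only
  \<open>\<not> V 1 1\<close> is available.\<close>

lemma not_V_prod_list:
  assumes "is_val V" "\<And>a. a \<in> set as \<Longrightarrow> \<not> V a s"
  shows "\<not> V (prod_list as) (length as * s + 1)"
  using assms(2)
proof (induction as)
  case Nil
  then show ?case using is_val_simps(6)[OF assms(1)] by simp
next
  case (Cons a as)
  then show ?case using is_val_simps(4)[OF assms(1), of a s "prod_list as" "length as * s + 1"]
    by (simp add: algebra_simps)
qed

lemma not_V_Const:
  assumes "is_val V" "c \<noteq> 0"
  shows "\<not> V (Const c) 1"
proof
  assume "V (Const c) 1"
  then have "V (Const (1 / c) * Const c) 1" by (rule is_val_simps(2)[OF assms(1)])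
  then show False using is_val_simps(6)[OF assms(1)] assms(2) by (simp only: Const_simps(4)[symmetric]) (simp add: Const_simps)
qed

section \<open>Division by polynomials that are monic in their last variable\<close>

definition lin_ideal :: "'j set \<Rightarrow> ('j \<Rightarrow> 'a::comm_ring_1) \<Rightarrow> 'a set" where
  "lin_ideal J p = {(\<Sum>j\<in>J. h j * p j) | h. True}"

lemma is_ideal_lin_ideal: "is_ideal (lin_ideal J p)"
  unfolding is_ideal_def
proof (intro conjI ballI allI)
  show "0 \<in> lin_ideal J p" unfolding lin_ideal_def by (intro CollectI exI[of _ "\<lambda>_. 0"]) auto
  fix a b assume "a \<in> lin_ideal J p" "b \<in> lin_ideal J p"
  then obtain h h' where "a = (\<Sum>j\<in>J. h j * p j)" "b = (\<Sum>j\<in>J. h' j * p j)" by (auto simp: lin_ideal_def)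
  then show "a + b \<in> lin_ideal J p" unfolding lin_ideal_def
    by (intro CollectI exI[of _ "\<lambda>j. h j + h' j"]) (auto simp: sum.distrib algebra_simps)
next
  fix r a assume "a \<in> lin_ideal J p"
  then obtain h where "a = (\<Sum>j\<in>J. h j * p j)" by (auto simp: lin_ideal_def)
  then show "r * a \<in> lin_ideal J p" unfolding lin_ideal_def
    by (intro CollectI exI[of _ "\<lambda>j. r * h j"]) (auto simp: sum_distrib_left algebra_simps)
qed

lemma gen_in_lin_ideal:
  assumes "finite J" "j \<in> J"
  shows "p j \<in> lin_ideal J p"
proof -
  have "(\<Sum>i\<in>J. (if i = j then 1 else 0) * p i) = (\<Sum>i\<in>J. if i = j then p j else 0)"
    by (rule sum.cong) auto
  then show ?thesis using assms unfolding lin_ideal_def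
    by (intro CollectI exI[of _ "\<lambda>i. if i = j then 1 else 0"]) auto
qed

text \<open>With the total degree bounded by \<open>e\<close>, every other monomial has a smaller
  exponent at \<open>j\<close>, and division by \<open>p\<close> never raises total degrees. No
  variable after \<open>j\<close> occurs, so such equations can be stacked triangularly.\<close>

definition monic_in :: "nat \<Rightarrow> nat \<Rightarrow> nat mpoly \<Rightarrow> bool" where
  "monic_in j e p \<longleftrightarrow> p \<in> polys_in {..j} \<and> tot_le p e \<and> lookup p (single j e) = 1"

lemma monic_in_lower_terms:
  assumes "monic_in j e p"
  obtains p0 where "p = Var j ^ e + p0"
    "\<And>\<alpha>. \<alpha> \<in> keys p0 \<Longrightarrow> lookup \<alpha> j < e \<and> tdeg \<alpha> \<le> e \<and> keys \<alpha> \<subseteq> {..j}"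
proof
  define p0 where "p0 = p - pmon (single j e)"
  show "p = Var j ^ e + p0" by (simp add: p0_def pmon_single)
  fix \<alpha> assume \<alpha>: "\<alpha> \<in> keys p0"
  have "lookup p0 (single j e) = 0"
    using assms by (simp add: p0_def lookup_minus pmon_def monic_in_def)
  then have ne: "\<alpha> \<noteq> single j e" using \<alpha> by (auto simp: in_keys_iff)
  have "lookup p \<alpha> = lookup p0 \<alpha>"
    using ne by (simp add: p0_def lookup_minus pmon_def lookup_single)
  then have k: "\<alpha> \<in> keys p" using \<alpha> by (simp add: in_keys_iff)
  then have t: "tdeg \<alpha> \<le> e" "keys \<alpha> \<subseteq> {..j}"
    using assms by (auto simp: monic_in_def tot_le_def polys_in_def mvars_def)
  have "lookup \<alpha> j < e"
  proof (rule ccontr)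
    assume "\<not> ?thesis"
    then have ge: "e \<le> lookup \<alpha> j" by simp
    have le: "lookup \<alpha> j + lookup \<alpha> i \<le> e" if "i \<noteq> j" for i
    proof -
      have "(\<Sum>v\<in>{i, j}. lookup \<alpha> v) \<le> (\<Sum>v\<in>{i, j} \<union> keys \<alpha>. lookup \<alpha> v)"
        by (intro sum_mono2) auto
      also have "\<dots> = tdeg \<alpha>" by (rule tdeg_superset[symmetric]) auto
      finally show ?thesis using that t by simp
    qed
    have "\<alpha> = single j e"
    proof (rule poly_mapping_eqI)
      fix i show "lookup \<alpha> i = lookup (single j e) i"
        using le[of i] ge lookup_le_tdeg[of \<alpha> j] t by (cases "i = j") (auto simp: lookup_single)
    qed
    then show False using ne by simp
  qed
  then show "lookup \<alpha> j < e \<and> tdeg \<alpha> \<le> e \<and> keys \<alpha> \<subseteq> {..j}" using t by simp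
qed

text \<open>Division is linear, so it suffices to divide monomials; \<open>R\<close> carries what is
  known about the monomials of the remainders.\<close>

lemma poly_lincomb:
  fixes a :: "'v mpoly"
  assumes "\<And>\<beta>. \<beta> \<in> keys a \<Longrightarrow> \<exists>h r. pmon \<beta> = h * p + r \<and> (\<forall>\<gamma>\<in>keys r. R \<beta> \<gamma>)"
  shows "\<exists>h r. a = h * p + r \<and> (\<forall>\<gamma>\<in>keys r. \<exists>\<beta>\<in>keys a. R \<beta> \<gamma>)"
proof -
  obtain h r where hr: "\<And>\<beta>. \<beta> \<in> keys a \<Longrightarrow> pmon \<beta> = h \<beta> * p + r \<beta>"
      "\<And>\<beta> \<gamma>. \<beta> \<in> keys a \<Longrightarrow> \<gamma> \<in> keys (r \<beta>) \<Longrightarrow> R \<beta> \<gamma>"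
    using assms by metis
  let ?c = "\<lambda>\<beta>. Const (lookup a \<beta>)"
  let ?r = "\<Sum>\<beta>\<in>keys a. ?c \<beta> * r \<beta>"
  have "a = (\<Sum>\<beta>\<in>keys a. ?c \<beta> * pmon \<beta>)" by (simp add: sum_keys_pmon)
  also have "\<dots> = (\<Sum>\<beta>\<in>keys a. ?c \<beta> * h \<beta>) * p + ?r"
    by (simp add: hr sum.distrib sum_distrib_right distrib_left mult.assoc)
  finally have 1: "a = (\<Sum>\<beta>\<in>keys a. ?c \<beta> * h \<beta>) * p + ?r" .
  have "\<exists>\<beta>\<in>keys a. R \<beta> \<gamma>" if g: "\<gamma> \<in> keys ?r" for \<gamma>
  proof -
    obtain \<beta> where \<beta>: "\<beta> \<in> keys a" "\<gamma> \<in> keys (?c \<beta> * r \<beta>)"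
      using g Poly_Mapping.keys_sum[of "\<lambda>\<beta>. ?c \<beta> * r \<beta>" "keys a"] by blast
    then have "\<gamma> \<in> keys (r \<beta>)" by (auto simp: in_keys_iff lookup_Const_mult)
    then show ?thesis using hr(2) \<beta>(1) by blast
  qed
  then show ?thesis using 1 by blast
qed

text \<open>Trading the power \<open>Var j ^ e\<close> for the lower terms of \<open>p\<close>
  decreases the exponent at \<open>j\<close>, on which the induction runs. Exponents of later
  variables are untouched, so that divisions by several equations can follow one another.\<close>

lemma divide_by_monic:
  assumes p: "monic_in j e p"
  shows "\<exists>h r. a = h * p + r \<and> (\<forall>\<gamma>\<in>keys r. \<exists>\<beta>\<in>keys a.
    lookup \<gamma> j < e \<and> tdeg \<gamma> \<le> tdeg \<beta> \<and> (\<forall>i>j. lookup \<gamma> i = lookup \<beta> i))"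
proof (rule poly_lincomb)
  fix \<beta> :: "nat \<Rightarrow>\<^sub>0 nat"
  obtain p0 where p0: "p = Var j ^ e + p0"
    "\<And>\<alpha>. \<alpha> \<in> keys p0 \<Longrightarrow> lookup \<alpha> j < e \<and> tdeg \<alpha> \<le> e \<and> keys \<alpha> \<subseteq> {..j}"
    using monic_in_lower_terms[OF p] by blast
  show "\<exists>h r. pmon \<beta> = h * p + r \<and> (\<forall>\<gamma>\<in>keys r.
    lookup \<gamma> j < e \<and> tdeg \<gamma> \<le> tdeg \<beta> \<and> (\<forall>i>j. lookup \<gamma> i = lookup \<beta> i))"
  proof (induction "lookup \<beta> j" arbitrary: \<beta> rule: less_induct)
    case less
    show ?case
    proof (cases "lookup \<beta> j < e")
      case True
      then show ?thesis by (intro exI[of _ 0] exI[of _ "pmon \<beta>"]) (auto simp: pmon_def)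
    next
      case False
      define \<beta>' where "\<beta>' = \<beta> - single j e"
      have \<beta>: "\<beta> = \<beta>' + single j e"
        using False by (intro poly_mapping_eqI) (auto simp: \<beta>'_def lookup_add lookup_minus lookup_single when_def)
      have "\<exists>h r. pmon \<beta>' * p0 = h * p + r \<and> (\<forall>\<gamma>\<in>keys r. \<exists>\<delta>\<in>keys (pmon \<beta>' * p0).
         lookup \<gamma> j < e \<and> tdeg \<gamma> \<le> tdeg \<delta> \<and> (\<forall>i>j. lookup \<gamma> i = lookup \<delta> i))"
      proof (rule poly_lincomb)
        fix \<delta> assume "\<delta> \<in> keys (pmon \<beta>' * p0)"
        then obtain \<alpha> where "\<alpha> \<in> keys p0" "\<delta> = \<beta>' + \<alpha>"
          using keys_mult[of "pmon \<beta>'" p0] by (auto simp: pmon_def)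
        then have "lookup \<delta> j < lookup \<beta> j" using p0(2) by (simp add: \<beta> lookup_add)
        then show "\<exists>h r. pmon \<delta> = h * p + r \<and> (\<forall>\<gamma>\<in>keys r.
           lookup \<gamma> j < e \<and> tdeg \<gamma> \<le> tdeg \<delta> \<and> (\<forall>i>j. lookup \<gamma> i = lookup \<delta> i))"
          by (rule less.hyps)
      qed
      then obtain h r where hr: "pmon \<beta>' * p0 = h * p + r"
        "\<And>\<gamma>. \<gamma> \<in> keys r \<Longrightarrow> \<exists>\<delta>\<in>keys (pmon \<beta>' * p0).
         lookup \<gamma> j < e \<and> tdeg \<gamma> \<le> tdeg \<delta> \<and> (\<forall>i>j. lookup \<gamma> i = lookup \<delta> i)"
        by blast
      have "pmon \<beta> = pmon \<beta>' * (p - p0)" using p0(1) by (simp add: \<beta> pmon_add pmon_single)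
      also have "\<dots> = (pmon \<beta>' - h) * p + (- r)" using hr(1) by (simp add: algebra_simps)
      finally have e: "pmon \<beta> = (pmon \<beta>' - h) * p + (- r)" .
      have "lookup \<gamma> j < e \<and> tdeg \<gamma> \<le> tdeg \<beta> \<and> (\<forall>i>j. lookup \<gamma> i = lookup \<beta> i)"
        if "\<gamma> \<in> keys (- r)" for \<gamma>
      proof -
        obtain \<delta> where \<delta>: "\<delta> \<in> keys (pmon \<beta>' * p0)" "lookup \<gamma> j < e" "tdeg \<gamma> \<le> tdeg \<delta>"
          "\<forall>i>j. lookup \<gamma> i = lookup \<delta> i"
          using hr(2) \<open>\<gamma> \<in> _\<close> by auto
        then obtain \<alpha> where \<alpha>: "\<alpha> \<in> keys p0" "\<delta> = \<beta>' + \<alpha>"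
          using keys_mult[of "pmon \<beta>'" p0] by (auto simp: pmon_def)
        have "tdeg \<delta> \<le> tdeg \<beta>" using p0(2)[OF \<alpha>(1)] by (simp add: \<alpha>(2) \<beta> tdeg_add)
        moreover have "lookup \<delta> i = lookup \<beta> i" if "i > j" for i
        proof -
          have "i \<notin> keys \<alpha>" using that p0(2)[OF \<alpha>(1)] by auto
          then show ?thesis using that by (simp add: \<alpha>(2) \<beta> lookup_add lookup_single in_keys_iff)
        qed
        ultimately show ?thesis using \<delta> by auto
      qed
      then show ?thesis using e by blast
    qed
  qed
qed

lemma lookup_times_pmon: "lookup (H * pmon \<beta>) (\<alpha> + \<beta>) = lookup H \<alpha>"
proof -
  have "H * pmon \<beta> = (\<Sum>\<gamma>\<in>keys H. Const (lookup H \<gamma>) * pmon (\<gamma> + \<beta>))"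
    by (subst sum_keys_pmon[of H, symmetric]) (simp add: sum_distrib_right pmon_add mult.assoc)
  then show ?thesis
    by (simp add: lookup_sum single_eq_pmon[symmetric] lookup_single when_def sum.delta in_keys_iff)
qed

text \<open>A term of \<open>H\<close> of highest exponent at \<open>j\<close>, multiplied by
  \<open>Var j ^ e\<close>, cannot be cancelled by the lower terms of \<open>p\<close>.\<close>

lemma monic_multiple_not_reduced:
  assumes p: "monic_in j e p" and red: "\<And>\<alpha>. \<alpha> \<in> keys (H * p) \<Longrightarrow> lookup \<alpha> j < e"
  shows "H = 0"
proof (rule ccontr)
  assume "H \<noteq> 0"
  obtain p0 where p0: "p = Var j ^ e + p0"
    "\<And>\<alpha>. \<alpha> \<in> keys p0 \<Longrightarrow> lookup \<alpha> j < e \<and> tdeg \<alpha> \<le> e \<and> keys \<alpha> \<subseteq> {..j}"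
    using monic_in_lower_terms[OF p] by blast
  let ?f = "\<lambda>\<alpha>. lookup \<alpha> j"
  have ne: "finite (?f ` keys H)" "?f ` keys H \<noteq> {}" using \<open>H \<noteq> 0\<close> by auto
  obtain \<alpha> where \<alpha>: "\<alpha> \<in> keys H" "?f \<alpha> = Max (?f ` keys H)"
    using Max_in[OF ne] by auto
  let ?\<gamma> = "\<alpha> + single j e"
  have "?\<gamma> \<notin> keys (H * p0)"
  proof
    assume "?\<gamma> \<in> keys (H * p0)"
    then obtain \<delta> \<epsilon> where d: "\<delta> \<in> keys H" "\<epsilon> \<in> keys p0" "?\<gamma> = \<delta> + \<epsilon>"
      using keys_mult[of H p0] by blast
    have "?f \<delta> \<le> ?f \<alpha>" using d(1) ne(1) by (simp add: \<alpha>(2))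
    moreover have "?f \<alpha> + e = ?f \<delta> + ?f \<epsilon>" using arg_cong[OF d(3), of ?f] by (simp add: lookup_add)
    ultimately show False using p0(2)[OF d(2)] by simp
  qed
  then have "lookup (H * p) ?\<gamma> = lookup H \<alpha>"
    using lookup_times_pmon[of H "single j e" \<alpha>]
    by (simp add: p0(1) distrib_left lookup_add pmon_single in_keys_iff)
  then have "?\<gamma> \<in> keys (H * p)" using \<alpha>(1) by (simp add: in_keys_iff)
  then show False using red by (fastforce simp: lookup_add)
qed

definition reduced :: "nat set \<Rightarrow> (nat \<Rightarrow> nat) \<Rightarrow> nat mpoly \<Rightarrow> bool" where
  "reduced J e r \<longleftrightarrow> (\<forall>\<alpha>\<in>keys r. \<forall>j\<in>J. lookup \<alpha> j < e j)"

lemma lookup_eq_0_polys_in: "p \<in> polys_in X \<Longrightarrow> \<alpha> \<in> keys p \<Longrightarrow> i \<notin> X \<Longrightarrow> lookup \<alpha> i = 0"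
  unfolding polys_in_def mvars_def by (auto simp flip: not_in_keys_iff_lookup_eq_zero)

lemma polys_inI: "(\<And>\<alpha> i. \<alpha> \<in> keys p \<Longrightarrow> i \<notin> X \<Longrightarrow> lookup \<alpha> i = 0) \<Longrightarrow> p \<in> polys_in X"
  by (auto simp: polys_in_def mvars_def in_keys_iff)

text \<open>The first \<open>k\<close> variables are free. Modulo \<open>I0\<close> the polynomials
  in the first \<open>N\<close> variables form a free module of rank \<open>M\<close> over those in
  the first \<open>k\<close>: the monomials in the remaining variables with exponents below
  \<open>e j\<close> are a basis, by \<open>normal_form\<close> and
  \<open>reduced_in_ideal_eq_0\<close>.\<close>

locale monic_system =
  fixes k N :: nat and e :: "nat \<Rightarrow> nat" and p :: "nat \<Rightarrow> nat mpoly"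
  assumes kN: "k \<le> N" and monic: "\<And>j. k \<le> j \<Longrightarrow> j < N \<Longrightarrow> monic_in j (e j) (p j)"
    and epos: "\<And>j. k \<le> j \<Longrightarrow> j < N \<Longrightarrow> 1 \<le> e j"
begin

definition I0 :: "nat mpoly set" where "I0 = lin_ideal {k..<N} p"

definition M :: nat where "M = (\<Prod>j\<in>{k..<N}. e j)"

lemmas I0_ideal = is_ideal_lin_ideal[of "{k..<N}" p, folded I0_def]
lemmas I0_simps = is_ideal_simps[OF I0_ideal]

lemma M_pos: "1 \<le> M" unfolding M_def using epos by (intro prod_ge_1) auto

lemma normal_form:
  assumes "a \<in> polys_in {..<N}" "tot_le a t"
  obtains r where "a - r \<in> I0" "reduced {k..<N} e r" "tot_le r t" "r \<in> polys_in {..<N}"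
proof -
  have "\<exists>r. a - r \<in> I0 \<and> reduced {l..<N} e r \<and> tot_le r t \<and> r \<in> polys_in {..<N}" if "k \<le> l" "l \<le> N" for l
    using that(2,1)
  \<comment> \<open>From the last variable downwards: dividing by \<open>p l\<close> does not
    disturb exponents already reduced.\<close>
  proof (induction rule: inc_induct)
    case base
    then show ?case using assms I0_simps(1) by (intro exI[of _ a]) (auto simp: reduced_def)
  next
    case (step l)
    then obtain r where r: "a - r \<in> I0" "reduced {Suc l..<N} e r" "tot_le r t" "r \<in> polys_in {..<N}" by auto
    have kl: "k \<le> l" "l < N" using step by auto
    obtain h r' where h: "r = h * p l + r'" and
      r': "\<forall>\<gamma>\<in>keys r'. \<exists>\<beta>\<in>keys r.
    lookup \<gamma> l < e l \<and> tdeg \<gamma> \<le> tdeg \<beta> \<and> (\<forall>i>l. lookup \<gamma> i = lookup \<beta> i)"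
      using divide_by_monic[OF monic[OF kl], of r] by blast
    have "p l \<in> I0" unfolding I0_def using kl by (intro gen_in_lin_ideal) auto
    then have "a - r' \<in> I0" using I0_simps(2)[OF r(1) I0_simps(3), of "p l" h] h by (simp add: algebra_simps)
    moreover have "reduced {l..<N} e r'"
      unfolding reduced_def
    proof (intro ballI)
      fix \<gamma> j assume g: "\<gamma> \<in> keys r'" "j \<in> {l..<N}"
      then obtain \<beta> where "\<beta> \<in> keys r" "lookup \<gamma> l < e l"
        "\<forall>i>l. lookup \<gamma> i = lookup \<beta> i" using r' by blast
      then show "lookup \<gamma> j < e j" using g(2) r(2) by (cases "j = l") (auto simp: reduced_def)
    qed
    moreover have "tot_le r' t" using r' r(3) by (fastforce simp: tot_le_def)
    moreover have "r' \<in> polys_in {..<N}"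
    proof (rule polys_inI)
      fix \<gamma> i assume g: "\<gamma> \<in> keys r'" "i \<notin> {..<N}"
      then obtain \<beta> where \<beta>: "\<beta> \<in> keys r" "\<forall>i>l. lookup \<gamma> i = lookup \<beta> i" using r' by blast
      then show "lookup \<gamma> i = 0" using lookup_eq_0_polys_in[OF r(4) \<beta>(1) g(2)] g(2) kl by simp
    qed
    ultimately show ?case by blast
  qed
  then show thesis using that kN by blast
qed

text \<open>Uniqueness of normal forms, by removing the equations one at a time, the last one
  first.\<close>

lemma reduced_in_ideal_eq_0:
  assumes "r \<in> I0" "reduced {k..<N} e r"
  shows "r = 0"
proof -
  have "r = 0" if "n \<le> N" "r \<in> lin_ideal {k..<n} p" "reduced {k..<n} e r" "k \<le> n" for n r
    using that(4,1-3)
  proof (induction n arbitrary: r rule: dec_induct)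
    case base
    then show ?case by (simp add: lin_ideal_def)
  next
    case (step n)
    have mn: "monic_in n (e n) (p n)" using step by (intro monic) auto
    obtain h where h: "r = (\<Sum>j\<in>{k..<Suc n}. h j * p j)" using step.prems by (auto simp: lin_ideal_def)
    have "\<exists>q h'. h j = q * p n + h' \<and> (\<forall>\<gamma>\<in>keys h'. lookup \<gamma> n < e n)" for j
      using divide_by_monic[OF mn, of "h j"] by metis
    then obtain q h' where qh: "\<And>j. h j = q j * p n + h' j"
      "\<And>j \<gamma>. \<gamma> \<in> keys (h' j) \<Longrightarrow> lookup \<gamma> n < e n" by metis
    \<comment> \<open>Divide every coefficient by \<open>p n\<close> and collect all multiples of
      \<open>p n\<close> in \<open>H\<close>. The rest \<open>y\<close> has exponents below
      \<open>e n\<close> at \<open>n\<close>, like \<open>r\<close>, so the multiple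
      \<open>H * p n\<close> is reduced and \<open>H\<close> vanishes.\<close>
    define H where "H = h n + (\<Sum>j\<in>{k..<n}. q j * p j)"
    define y where "y = (\<Sum>j\<in>{k..<n}. h' j * p j)"
    have "r = h n * p n + (\<Sum>j\<in>{k..<n}. h j * p j)"
      unfolding h using step.hyps by (simp add: add.commute)
    also have "(\<Sum>j\<in>{k..<n}. h j * p j) = (\<Sum>j\<in>{k..<n}. q j * p j * p n + h' j * p j)"
      by (intro sum.cong refl, subst qh(1)) (simp add: algebra_simps)
    also have "h n * p n + \<dots> = H * p n + y"
      by (simp add: H_def y_def sum.distrib sum_distrib_right distrib_right)
    finally have ry: "H * p n = r - y" by simp
    have yn: "lookup \<gamma> n < e n" if "\<gamma> \<in> keys y" for \<gamma>
    proof -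
      obtain j where j: "j \<in> {k..<n}" "\<gamma> \<in> keys (h' j * p j)"
        using \<open>\<gamma> \<in> _\<close> Poly_Mapping.keys_sum[of "\<lambda>j. h' j * p j" "{k..<n}"] unfolding y_def by blast
      then obtain \<alpha> \<beta> where ab: "\<alpha> \<in> keys (h' j)" "\<beta> \<in> keys (p j)" "\<gamma> = \<alpha> + \<beta>"
        using keys_mult[of "h' j" "p j"] by blast
      have "p j \<in> polys_in {..j}" using monic[of j] j step by (auto simp: monic_in_def)
      then have "lookup \<beta> n = 0" using lookup_eq_0_polys_in[OF _ ab(2)] j by auto
      then show ?thesis using qh(2)[OF ab(1)] by (simp add: ab(3) lookup_add)
    qed
    have "H = 0"
    proof (rule monic_multiple_not_reduced[OF mn])
      fix \<alpha> assume "\<alpha> \<in> keys (H * p n)"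
      then have "\<alpha> \<in> keys r \<or> \<alpha> \<in> keys y"
        using keys_diff[of r y] ry by (metis UnE subsetD)
      then show "lookup \<alpha> n < e n" using yn step by (auto simp: reduced_def)
    qed
    then have "r = y" using ry by simp
    then have "r \<in> lin_ideal {k..<n} p" by (auto simp: y_def lin_ideal_def)
    then show ?case using step by (intro step.IH) (auto simp: reduced_def)
  qed
  then show ?thesis using assms kN by (auto simp: I0_def)
qed

text \<open>A factor in the free variables keeps a normal form reduced, so \<open>c * r\<close> can
  lie in \<open>I0\<close> only if it is zero.\<close>

lemma torsion_free:
  assumes "a \<in> polys_in {..<N}" "c \<in> polys_in {..<k}" "c \<noteq> 0" "c * a \<in> I0"
  shows "a \<in> I0"
proof -
  obtain r where r: "a - r \<in> I0" "reduced {k..<N} e r"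
    using normal_form[OF assms(1), of "total_degree a"] tot_le_total_degree by blast
  have "c * a - c * (a - r) \<in> I0" using assms(4) r(1) by (intro I0_simps(6)[of "c * a"] I0_simps(3)[of "a - r"])
  then have "c * r \<in> I0" by (simp add: algebra_simps)
  moreover have "reduced {k..<N} e (c * r)"
    unfolding reduced_def
  proof (intro ballI)
    fix \<gamma> j assume "\<gamma> \<in> keys (c * r)" and j: "j \<in> {k..<N}"
    then obtain \<alpha> \<beta> where ab: "\<alpha> \<in> keys c" "\<beta> \<in> keys r" "\<gamma> = \<alpha> + \<beta>"
      using keys_mult[of c r] by blast
    have "lookup \<alpha> j = 0" using lookup_eq_0_polys_in[OF assms(2) ab(1)] j by auto
    then show "lookup \<gamma> j < e j" using r(2) ab(2) j by (simp add: ab(3) lookup_add reduced_def)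
  qed
  ultimately have "c * r = 0" by (rule reduced_in_ideal_eq_0)
  then show ?thesis using r(1) assms(3) by simp
qed

end

text \<open>\<open>T\<close> is so large that \<open>(1 + Q / (T + 1)) ^ k < 1 + 1 / M\<close>; this
  is Bernoulli's inequality for \<open>(1 - y) ^ k\<close>.\<close>

lemma siegel_count:
  fixes k M Q :: nat
  assumes "1 \<le> M"
  defines "T \<equiv> 2 * k * M * Q"
  shows "M * (T + Q + 1) ^ k < (M + 1) * (T + 1) ^ k"
proof -
  let ?X = "real T + 1" and ?M = "real M" and ?Q = "real Q" and ?k = "real k"
  define y where "y = ?Q / (?X + ?Q)"
  have pos: "?X + ?Q > 0" by linarith
  have y: "0 \<le> y" "y \<le> 1" using pos by (auto simp: y_def field_simps)
  have "?k * ?Q * (?M + 1) \<le> ?k * ?Q * (2 * ?M)" using assms(1) by (intro mult_left_mono) auto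
  also have "\<dots> = real T" by (simp add: T_def)
  finally have "?k * ?Q * (?M + 1) < ?X + ?Q" by linarith
  then have ky: "?k * y * (?M + 1) < 1" using pos by (simp add: y_def field_simps)
  have "1 - ?k * y \<le> (1 - y) ^ k"
    using Bernoulli_inequality[of "- y" k] y by (simp add: algebra_simps)
  moreover have "1 - y = ?X / (?X + ?Q)" using pos by (simp add: y_def field_simps)
  ultimately have le: "1 - ?k * y \<le> ?X ^ k / (?X + ?Q) ^ k" by (simp add: power_divide)
  have "?M < (?M + 1) * (1 - ?k * y)" using ky by (simp add: algebra_simps)
  also have "\<dots> \<le> (?M + 1) * (?X ^ k / (?X + ?Q) ^ k)" using le by (intro mult_left_mono) auto
  finally have "?M * (?X + ?Q) ^ k < (?M + 1) * ?X ^ k" using pos by (simp add: field_simps)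
  then have "real (M * (T + Q + 1) ^ k) < real ((M + 1) * (T + 1) ^ k)" by (simp add: algebra_simps)
  then show ?thesis by (simp only: of_nat_less_iff)
qed

lemma least_nonzero:
  fixes c :: "nat \<Rightarrow> 'a::zero"
  assumes "\<exists>i\<le>M. c i \<noteq> 0"
  obtains i0 where "c i0 \<noteq> 0" "i0 \<le> M" "\<And>i. i < i0 \<Longrightarrow> c i = 0"
proof -
  obtain i where i: "i \<le> M" "c i \<noteq> 0" using assms by blast
  show thesis
  proof (rule that[of "LEAST i. c i \<noteq> 0"])
    show "c (LEAST i. c i \<noteq> 0) \<noteq> 0" using i(2) by (rule LeastI)
    show "(LEAST i. c i \<noteq> 0) \<le> M" using Least_le[of "\<lambda>i. c i \<noteq> 0", OF i(2)] i(1) by simp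
    show "c j = 0" if "j < (LEAST i. c i \<noteq> 0)" for j using not_less_Least[OF that] by simp
  qed
qed

section \<open>Dependence relations over the free variables and primes above a monic system\<close>

context monic_system
begin

text \<open>In a module of rank \<open>M\<close> any \<open>M + 1\<close> elements are dependent.
  The degree bound comes from counting as in Siegel's lemma: \<open>(M + 1) * (T + 1) ^ k\<close>
  unknown complex coefficients against at most \<open>M * (T + Q + 1) ^ k\<close> monomials that
  must cancel.\<close>

lemma dependent_mod_ideal:
  fixes x :: "nat \<Rightarrow> nat mpoly"
  assumes x: "\<forall>i\<le>M. x i \<in> polys_in {..<N} \<and> tot_le (x i) Q"
  obtains c where "\<And>i. c i \<in> polys_in {..<k}" "\<And>i. tot_le (c i) (k * (2 * k * M * Q))" "\<exists>i\<le>M. c i \<noteq> 0"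
    "(\<Sum>i\<le>M. c i * x i) \<in> I0"
proof -
  define T where "T = 2 * k * M * Q"
  have "\<exists>r. x i - r \<in> I0 \<and> reduced {k..<N} e r \<and> tot_le r Q \<and> r \<in> polys_in {..<N}" if "i \<le> M" for i
    using normal_form[of "x i" Q] x that by metis
  then obtain r where r: "\<And>i. i \<le> M \<Longrightarrow> x i - r i \<in> I0 \<and> reduced {k..<N} e (r i) \<and> tot_le (r i) Q \<and> r i \<in> polys_in {..<N}"
    by metis
  \<comment> \<open>Exponents of the unknown coefficient polynomials: at most \<open>T\<close> in
    each free variable, hence total degree at most \<open>k * T\<close>.\<close>
  define E where "E = PiE {..<k} (\<lambda>_. {..T})"
  define mk :: "(nat \<Rightarrow> nat) \<Rightarrow> nat \<Rightarrow>\<^sub>0 nat" where "mk = (\<lambda>f. Abs_poly_mapping (\<lambda>l. if l < k then f l else 0))"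
  have lk: "lookup (mk f) l = (if l < k then f l else 0)" for f l
    unfolding mk_def by (subst lookup_Abs_poly_mapping) (auto intro: finite_subset[of _ "{..<k}"])
  have mk_inj: "inj_on mk E"
  proof (rule inj_onI)
    fix f g assume fg: "f \<in> E" "g \<in> E" "mk f = mk g"
    then have "f l = g l" if "l < k" for l using lk[of f l] lk[of g l] fg(3) that by simp
    then show "f = g" using fg(1,2) unfolding E_def by (intro PiE_ext[of f _ _ g]) auto
  qed
  have mk_le: "lookup (mk f) l \<le> T" if "f \<in> E" for f l
    using that by (auto simp: lk E_def PiE_def Pi_def)
  have mk_keys: "keys (mk f) \<subseteq> {..<k}" for f
    by (auto simp: in_keys_iff lk split: if_splits)
  \<comment> \<open>\<open>J\<close> indexes the equations. It contains every monomial in a product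
    of such a coefficient monomial with a normal form: exponents up to \<open>T + Q\<close> in free
    variables, below \<open>e l\<close> in the others.\<close>
  define bd where "bd = (\<lambda>l. if l < k then {..T + Q} else {..<e l})"
  define J where "J = {\<gamma>. keys \<gamma> \<subseteq> {..<N} \<and> (\<forall>l<N. lookup \<gamma> l \<in> bd l)}"
  have inj: "inj_on (\<lambda>\<gamma>. restrict (lookup \<gamma>) {..<N}) J"
  proof (rule inj_onI)
    fix \<gamma> \<delta> assume g: "\<gamma> \<in> J" "\<delta> \<in> J" "restrict (lookup \<gamma>) {..<N} = restrict (lookup \<delta>) {..<N}"
    show "\<gamma> = \<delta>"
    proof (rule poly_mapping_eqI)
      fix l
      show "lookup \<gamma> l = lookup \<delta> l"
      proof (cases "l < N")
        case True
        then show ?thesis using fun_cong[OF g(3), of l] by simp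
      next
        case False
        then have "l \<notin> keys \<gamma>" "l \<notin> keys \<delta>" using g by (auto simp: J_def)
        then show ?thesis by (simp add: in_keys_iff)
      qed
    qed
  qed
  have img: "(\<lambda>\<gamma>. restrict (lookup \<gamma>) {..<N}) ` J \<subseteq> PiE {..<N} bd"
    by (intro image_subsetI) (simp add: J_def restrict_PiE_iff)
  have fP: "finite (PiE {..<N} bd)" by (intro finite_PiE) (auto simp: bd_def)
  have finJ: "finite J" using finite_imageD[OF finite_subset[OF img fP] inj] .
  have "card J \<le> card (PiE {..<N} bd)" using card_inj_on_le[OF inj img fP] .
  also have "\<dots> = (\<Prod>l<N. card (bd l))" by (simp add: card_PiE)
  also have "\<dots> = (\<Prod>l\<in>{..<k} \<union> {k..<N}. card (bd l))" using kN by (intro prod.cong) auto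
  also have "\<dots> = (\<Prod>l<k. card (bd l)) * (\<Prod>l\<in>{k..<N}. card (bd l))"
    by (intro prod.union_disjoint) auto
  also have "\<dots> = (T + Q + 1) ^ k * M" by (simp add: bd_def M_def)
  also have "\<dots> < (M + 1) * (T + 1) ^ k"
    using siegel_count[OF M_pos, of k Q] by (simp add: T_def mult.commute)
  also have "\<dots> = card ({..M} \<times> E)" by (simp add: E_def card_cartesian_product card_PiE)
  finally have card: "card J < card ({..M} \<times> E)" .
  have finE: "finite E" unfolding E_def by (intro finite_PiE) auto
  obtain \<xi> where \<xi>: "\<exists>i\<in>{..M} \<times> E. \<xi> i \<noteq> 0"
    "\<forall>\<gamma>\<in>J. (\<Sum>i\<in>{..M} \<times> E. lookup (pmon (mk (snd i)) * r (fst i)) \<gamma> * \<xi> i) = 0"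
    using homogeneous_system[OF finJ _ card, of "\<lambda>\<gamma> i. lookup (pmon (mk (snd i)) * r (fst i)) \<gamma>"] finE
    by auto
  define c where "c = (\<lambda>i. \<Sum>f\<in>E. Const (\<xi> (i, f)) * pmon (mk f))"
  have cin: "c i \<in> polys_in {..<k}" for i
    unfolding c_def using mk_keys
    by (intro polys_in_simps(8) polys_in_simps(4) Const_in_polys_in) (auto simp: polys_in_def mvars_pmon)
  have ctot: "tot_le (c i) (k * T)" for i
    unfolding c_def
  proof (rule tot_le_sum)
    fix f assume f: "f \<in> E"
    have "tdeg (mk f) = (\<Sum>l<k. lookup (mk f) l)" by (intro tdeg_superset mk_keys) auto
    also have "\<dots> \<le> (\<Sum>l<k. T)" by (intro sum_mono mk_le f)
    finally have "tot_le (Const (\<xi> (i, f)) * pmon (mk f)) (0 + k * T)"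
      by (intro tot_le_mult tot_le_Const tot_le_pmon) simp
    then show "tot_le (Const (\<xi> (i, f)) * pmon (mk f)) (k * T)" by simp
  qed
  \<comment> \<open>By injectivity of \<open>mk\<close> no two unknowns share a monomial, so a
    nonzero \<open>\<xi>\<close> produces a nonzero coefficient polynomial.\<close>
  have lc: "lookup (c i) (mk f) = \<xi> (i, f)" if "f \<in> E" for i f
  proof -
    have "lookup (c i) (mk f) = (\<Sum>g\<in>E. if g = f then \<xi> (i, g) else 0)"
      unfolding c_def lookup_sum single_eq_pmon[symmetric]
      using mk_inj that by (intro sum.cong) (auto simp: lookup_single when_def inj_on_def)
    then show ?thesis using that finE by simp
  qed
  obtain i f where "i \<le> M" "f \<in> E" "\<xi> (i, f) \<noteq> 0" using \<xi>(1) by auto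
  then have cne: "\<exists>i\<le>M. c i \<noteq> 0" using lc[of f i] by (metis lookup_zero)
  have zero: "(\<Sum>i\<le>M. c i * r i) = 0"
  proof -
    have "(\<Sum>i\<le>M. c i * r i) = (\<Sum>i\<le>M. \<Sum>f\<in>E. Const (\<xi> (i, f)) * (pmon (mk f) * r i))"
      by (simp add: c_def sum_distrib_right mult.assoc)
    also have "\<dots> = (\<Sum>i\<in>{..M} \<times> E. Const (\<xi> i) * (pmon (mk (snd i)) * r (fst i)))"
      by (simp add: sum.cartesian_product case_prod_unfold)
    also have "\<dots> = 0"
    proof (rule poly_mapping_eqI)
      fix \<gamma>
      have "(\<Sum>i\<in>{..M} \<times> E. \<xi> i * lookup (pmon (mk (snd i)) * r (fst i)) \<gamma>) = 0"
      proof (cases "\<gamma> \<in> J")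
        case True
        then show ?thesis using \<xi>(2) by (simp add: mult.commute)
      next
        case False
        have "lookup (pmon (mk f) * r i) \<gamma> = 0" if fi: "i \<le> M" "f \<in> E" for i f
        proof (rule ccontr)
          assume "lookup (pmon (mk f) * r i) \<gamma> \<noteq> 0"
          then have "\<gamma> \<in> keys (pmon (mk f) * r i)" by (simp add: in_keys_iff)
          then obtain \<beta> where \<beta>: "\<beta> \<in> keys (r i)" "\<gamma> = mk f + \<beta>"
            using keys_mult[of "pmon (mk f)" "r i"] by (auto simp: pmon_def)
          have b1: "keys \<beta> \<subseteq> {..<N}" using r[OF fi(1)] \<beta>(1) by (auto simp: polys_in_def mvars_def)
          have b2: "lookup \<beta> l \<le> Q" for l
            using r[OF fi(1)] \<beta>(1) lookup_le_tdeg[of \<beta> l] by (fastforce simp: tot_le_def)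
          have b3: "lookup \<beta> l < e l" if "l \<in> {k..<N}" for l
            using r[OF fi(1)] \<beta>(1) that by (auto simp: reduced_def)
          have "lookup \<gamma> l \<in> bd l" if "l < N" for l
          proof (cases "l < k")
            case True
            then show ?thesis using add_mono[OF mk_le[OF fi(2), of l] b2[of l]] by (simp add: bd_def \<beta>(2) lookup_add)
          next
            case False
            then show ?thesis using b3[of l] that by (simp add: bd_def \<beta>(2) lookup_add lk)
          qed
          moreover have "keys \<gamma> \<subseteq> {..<N}"
            using b1 mk_keys[of f] kN by (auto simp: \<beta>(2) keys_add_nat)
          ultimately show False using False by (simp add: J_def)
        qed
        then show ?thesis by (intro sum.neutral) auto
      qed
      then show "lookup (\<Sum>i\<in>{..M} \<times> E. Const (\<xi> i) * (pmon (mk (snd i)) * r (fst i))) \<gamma> = lookup 0 \<gamma>"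
        by (simp add: lookup_sum lookup_Const_mult)
    qed
    finally show ?thesis .
  qed
  have "(\<Sum>i\<le>M. c i * (x i - r i)) \<in> I0" using r by (intro I0_simps(7) I0_simps(3)) auto
  then have "(\<Sum>i\<le>M. c i * x i) \<in> I0" using zero by (simp add: algebra_simps sum_subtractf)
  then show thesis using that cin ctot cne by (auto simp: T_def)
qed

lemma tot_le_uniform:
  fixes x :: "nat \<Rightarrow> 'v mpoly"
  obtains Q where "\<And>i. i \<le> n \<Longrightarrow> tot_le (x i) Q"
proof
  fix i assume "i \<le> n"
  then have "total_degree (x i) \<le> (\<Sum>i\<le>n. total_degree (x i))" by (intro member_le_sum) auto
  then show "tot_le (x i) (\<Sum>i\<le>n. total_degree (x i))" by (simp add: tot_le_total_degree)
qed

text \<open>If a product of elements vanishes modulo the torsion-free algebra \<open>A / I0\<close> of rank \<open>M\<close> over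
  \<open>\<complex>[y\<^sub>0, \<dots>]\<close>, then so does a subproduct of length at most \<open>M\<close>: in a shortest one the
  successive partial products are linearly independent.\<close>

lemma short_zero_product:
  assumes "set as \<subseteq> W" "W \<subseteq> polys_in {..<N}" "c \<in> polys_in {..<k}" "c \<noteq> 0" "c * prod_list as \<in> I0"
  shows "\<exists>bs. set bs \<subseteq> W \<and> length bs \<le> M \<and> prod_list bs \<in> I0"
proof -
  define Z where "Z = (\<lambda>as. set as \<subseteq> W \<and> (\<exists>c\<in>polys_in {..<k}. c \<noteq> 0 \<and> c * prod_list as \<in> I0))"
  have "Z as" using assms by (auto simp: Z_def)
  then obtain bs where bs: "Z bs" and min: "\<And>bs'. Z bs' \<Longrightarrow> length bs \<le> length bs'"
    using ex_has_least_nat[of Z as length] by blast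
  obtain c where c: "c \<in> polys_in {..<k}" "c \<noteq> 0" "c * prod_list bs \<in> I0" and bsW: "set bs \<subseteq> W"
    using bs by (auto simp: Z_def)
  have pl: "prod_list xs \<in> polys_in {..<N}" if "set xs \<subseteq> W" for xs
    using that assms(2) by (induction xs) (auto intro: polys_in_simps(1) polys_in_simps(4))
  have "length bs \<le> M"
  proof (rule ccontr)
    assume "\<not> ?thesis"
    then have len: "M < length bs" by simp
    define x where "x = (\<lambda>i. prod_list (take i bs))"
    obtain Q where Q: "\<And>i. i \<le> M \<Longrightarrow> tot_le (x i) Q" using tot_le_uniform by blast
    have "x i \<in> polys_in {..<N}" for i unfolding x_def using bsW set_take_subset[of i bs] by (intro pl) auto
    with Q have "\<forall>i\<le>M. x i \<in> polys_in {..<N} \<and> tot_le (x i) Q" by blast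
    from dependent_mod_ideal[OF this]
    obtain a where a1: "\<And>i. a i \<in> polys_in {..<k}" and "\<And>i. tot_le (a i) (k * (2 * k * M * Q))"
      and a2: "\<exists>i\<le>M. a i \<noteq> 0" and a3: "(\<Sum>i\<le>M. a i * x i) \<in> I0" by blast
    note a = a1 a2 a3
    obtain i0 where i0: "a i0 \<noteq> 0" "i0 \<le> M" "\<And>i. i < i0 \<Longrightarrow> a i = 0"
      using least_nonzero[OF a(2)] by blast
    \<comment> \<open>Drop the factor at position \<open>i0\<close>, where \<open>i0\<close> is the
      first index with nonzero coefficient. Multiplying the relation by \<open>c * z\<close> turns
      every later partial product into a multiple of the full product, so the product without this
      factor is torsion as well, against minimality.\<close>
    define z where "z = prod_list (drop (Suc i0) bs)"
    define bs' where "bs' = take i0 bs @ drop (Suc i0) bs"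
    have xz: "\<exists>w. x i * z = prod_list bs * w" if "i0 < i" for i
    proof -
      have "take i bs = take (Suc i0) bs @ take (i - Suc i0) (drop (Suc i0) bs)"
        using take_add[of "Suc i0" "i - Suc i0" bs] that by simp
      then have "x i * z = (prod_list (take (Suc i0) bs) * z) * prod_list (take (i - Suc i0) (drop (Suc i0) bs))"
        by (simp add: x_def algebra_simps)
      also have "prod_list (take (Suc i0) bs) * z = prod_list bs"
        unfolding z_def by (metis append_take_drop_id prod_list.append)
      finally show ?thesis by blast
    qed
    have "c * z * (\<Sum>i\<le>M. a i * x i) = (\<Sum>i\<le>M. c * (a i * (x i * z)))"
      by (simp add: sum_distrib_left algebra_simps)
    also have "\<dots> = c * (a i0 * (x i0 * z)) + (\<Sum>i\<in>{..M} - {i0}. c * (a i * (x i * z)))"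
      using i0(2) by (intro sum.remove) auto
    finally have eq: "c * (a i0 * (x i0 * z)) = c * z * (\<Sum>i\<le>M. a i * x i) - (\<Sum>i\<in>{..M} - {i0}. c * (a i * (x i * z)))"
      by simp
    have "c * (a i * (x i * z)) \<in> I0" if ne: "i \<noteq> i0" for i
    proof (cases "i < i0")
      case True
      then show ?thesis using i0(3) I0_simps(1) by simp
    next
      case False
      then obtain w where "x i * z = prod_list bs * w" using xz[of i] ne by (metis linorder_neqE_nat)
      then have "c * (a i * (x i * z)) = (a i * w) * (c * prod_list bs)" by (simp add: algebra_simps)
      then show ?thesis using I0_simps(3)[OF c(3)] by metis
    qed
    then have "c * (a i0 * (x i0 * z)) \<in> I0" unfolding eq
      by (intro I0_simps(6) I0_simps(7) I0_simps(3)[OF a(3)]) auto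
    moreover have "x i0 * z = prod_list bs'" by (simp add: bs'_def x_def z_def)
    ultimately have "(c * a i0) * prod_list bs' \<in> I0" by (simp add: mult.assoc)
    moreover have "set bs' \<subseteq> W" using bsW set_take_subset[of i0 bs] set_drop_subset[of "Suc i0" bs] by (auto simp: bs'_def)
    moreover have "c * a i0 \<in> polys_in {..<k}" "c * a i0 \<noteq> 0" using c a(1) i0 by (auto intro: polys_in_simps(4))
    ultimately have "Z bs'" unfolding Z_def by blast
    moreover have "length bs' < length bs" using i0(2) len by (simp add: bs'_def)
    ultimately show False using min by fastforce
  qed
  moreover have "prod_list bs \<in> I0" using torsion_free[OF pl[OF bsW] c] .
  ultimately show ?thesis using bsW by blast
qed

text \<open>\<open>P\<close> is chosen to avoid the multiplicative set generated by the elements of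
  order at most \<open>\<tau>\<close> and the nonzero polynomials in the free variables.
  \<open>I0\<close> misses this set: otherwise a product of at most \<open>M\<close> elements of
  order at most \<open>\<tau>\<close> would lie in \<open>I0\<close>, where all orders are at least
  \<open>\<Lambda>\<close>.\<close>

lemma prime_of_order:
  assumes V: "is_val V" and p: "\<And>j. k \<le> j \<Longrightarrow> j < N \<Longrightarrow> V (p j) \<Lambda>" and \<Lambda>: "M * (\<tau> + 1) + 1 \<le> \<Lambda>"
  obtains P where "is_prime P" "I0 \<subseteq> P" "\<And>a. a \<in> polys_in {..<N} \<Longrightarrow> a \<in> P \<Longrightarrow> V a (\<tau> + 1)"
    "\<And>c. c \<in> polys_in {..<k} \<Longrightarrow> c \<in> P \<Longrightarrow> c = 0"
proof -
  note Vs = is_val_simps[OF V]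
  define W where "W = {a \<in> polys_in {..<N}. \<not> V a (\<tau> + 1)}"
  define S where "S = {c * prod_list as | c as. c \<in> polys_in {..<k} \<and> c \<noteq> 0 \<and> set as \<subseteq> W}"
  have SI: "c * prod_list as \<in> S" if "c \<in> polys_in {..<k}" "c \<noteq> 0" "set as \<subseteq> W" for c as
    using that by (auto simp: S_def)
  have V0: "V a \<Lambda>" if "a \<in> I0" for a
    using that p by (auto simp: I0_def lin_ideal_def intro!: Vs(9) Vs(2))
  have dis: "I0 \<inter> S = {}"
  proof (rule ccontr)
    assume "\<not> ?thesis"
    then obtain c as where "c \<in> polys_in {..<k}" "c \<noteq> 0" "set as \<subseteq> W" "c * prod_list as \<in> I0"
      by (auto simp: S_def)
    then obtain bs where bs: "set bs \<subseteq> W" "length bs \<le> M" "prod_list bs \<in> I0"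
      using short_zero_product[of as W c] by (auto simp: W_def)
    have "\<not> V (prod_list bs) (length bs * (\<tau> + 1) + 1)"
      using bs(1) by (intro not_V_prod_list[OF V]) (auto simp: W_def)
    moreover have "length bs * (\<tau> + 1) + 1 \<le> \<Lambda>"
      using mult_right_mono[OF bs(2), of "\<tau> + 1"] \<Lambda> by simp
    ultimately show False using Vs(5)[OF V0[OF bs(3)]] by blast
  qed
  have oS: "1 \<in> S" using SI[of 1 "[]"] polys_in_simps(1) by auto
  have mS: "a * b \<in> S" if ab: "a \<in> S" "b \<in> S" for a b
  proof -
    obtain c as d bs where "a = c * prod_list as" "b = d * prod_list bs" "c \<in> polys_in {..<k}" "d \<in> polys_in {..<k}"
      "c \<noteq> 0" "d \<noteq> 0" "set as \<subseteq> W" "set bs \<subseteq> W" using ab unfolding S_def by blast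
    then show ?thesis using SI[of "c * d" "as @ bs"] polys_in_simps(4)[of c _ d] by (simp add: algebra_simps)
  qed
  obtain P where P: "is_prime P" "I0 \<subseteq> P" "P \<inter> S = {}"
    using prime_avoiding[OF I0_ideal oS mS dis] by blast
  show thesis
  proof (rule that[OF P(1,2)])
    fix a assume a: "a \<in> polys_in {..<N}" "a \<in> P"
    show "V a (\<tau> + 1)"
    proof (rule ccontr)
      assume "\<not> ?thesis"
      then have "a \<in> S" using a SI[OF polys_in_simps(1), of "[a]"] by (simp add: W_def)
      then show False using a P(3) by blast
    qed
  next
    fix c assume c: "c \<in> polys_in {..<k}" "c \<in> P"
    show "c = 0"
    proof (rule ccontr)
      assume "c \<noteq> 0"
      then have "c \<in> S" using c SI[of c "[]"] by simp
      then show False using c P(3) by blast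
    qed
  qed
qed

text \<open>The powers of \<open>a\<close> up to \<open>M\<close> are dependent modulo
  \<open>I0\<close>. If \<open>a\<close> were outside \<open>P\<close>, the relation could be
  divided by a power of \<open>a\<close> modulo \<open>P\<close>; then its lowest coefficient is
  congruent to a multiple of \<open>a\<close>, hence has order at least \<open>\<tau>\<close>,
  although it is a nonzero polynomial of low degree in the free variables.\<close>

lemma low_degree_in_prime:
  assumes V: "is_val V" and P: "is_prime P" "I0 \<subseteq> P" "\<And>a. a \<in> polys_in {..<N} \<Longrightarrow> a \<in> P \<Longrightarrow> V a (\<tau> + 1)"
    and indep: "\<And>c. c \<in> polys_in {..<k} \<Longrightarrow> c \<noteq> 0 \<Longrightarrow> tot_le c B \<Longrightarrow> \<not> V c \<tau>"
    and B: "k * (2 * k * M * (M * B')) \<le> B"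
    and a: "a \<in> polys_in {..<N}" "tot_le a B'" "V a \<tau>"
  shows "a \<in> P"
proof (rule ccontr)
  assume "a \<notin> P"
  note Vs = is_val_simps[OF V]
  have "tot_le (a ^ i) (M * B')" if "i \<le> M" for i
    using tot_le_weaken[OF tot_le_power[OF a(2), of i] mult_right_mono[OF that]] by simp
  then have "\<forall>i\<le>M. a ^ i \<in> polys_in {..<N} \<and> tot_le (a ^ i) (M * B')"
    using a(1) polys_in_simps(7) by blast
  from dependent_mod_ideal[OF this]
  obtain c where c: "\<And>i. c i \<in> polys_in {..<k}" "\<And>i. tot_le (c i) (k * (2 * k * M * (M * B')))" "\<exists>i\<le>M. c i \<noteq> 0"
    "(\<Sum>i\<le>M. c i * a ^ i) \<in> I0"
    by blast
  obtain i0 where i0: "c i0 \<noteq> 0" "i0 \<le> M" "\<And>i. i < i0 \<Longrightarrow> c i = 0"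
    using least_nonzero[OF c(3)] by blast
  define w where "w = (\<Sum>i\<in>{Suc i0..M}. c i * a ^ (i - Suc i0))"
  have "(\<Sum>i\<le>M. c i * a ^ i) = (\<Sum>i\<in>{i0..M}. c i * a ^ i)"
    using i0 by (intro sum.mono_neutral_right) auto
  also have "\<dots> = c i0 * a ^ i0 + (\<Sum>i\<in>{Suc i0..M}. c i * a ^ i)"
    using i0(2) by (simp add: sum.atLeast_Suc_atMost)
  also have "(\<Sum>i\<in>{Suc i0..M}. c i * a ^ i) = a ^ Suc i0 * w"
    unfolding w_def sum_distrib_left
  proof (rule sum.cong)
    fix i assume "i \<in> {Suc i0..M}"
    then have "a ^ i = a ^ Suc i0 * a ^ (i - Suc i0)"
      by (metis atLeastAtMost_iff le_add_diff_inverse power_add)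
    then show "c i * a ^ i = a ^ Suc i0 * (c i * a ^ (i - Suc i0))" by (simp add: algebra_simps)
  qed simp
  finally have "a ^ i0 * (c i0 + a * w) \<in> I0" using c(4) by (simp add: algebra_simps)
  then have "c i0 + a * w \<in> P"
    using P(2) is_prime_simps(3,4)[OF P(1)] \<open>a \<notin> P\<close> by blast
  moreover have "c i \<in> polys_in {..<N}" for i using c(1)[of i] kN by (auto simp: polys_in_def)
  then have "c i0 + a * w \<in> polys_in {..<N}" unfolding w_def using a(1)
    by (intro polys_in_simps(3) polys_in_simps(4) polys_in_simps(8) polys_in_simps(7)) auto
  ultimately have "V (c i0 + a * w) (\<tau> + 1)" by (intro P(3))
  then have "V (c i0 + a * w) \<tau>" by (rule Vs) simp
  then have "V (c i0 + a * w - a * w) \<tau>" by (intro Vs(8) Vs(3)[OF a(3)])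
  then show False using indep[OF c(1) i0(1)] tot_le_weaken[OF c(2) B] by simp
qed

end

section \<open>Noether normalisation relative to an order function\<close>

definition to_poly :: "'v \<Rightarrow> 'v mpoly \<Rightarrow> 'v mpoly poly" where
  "to_poly y = mhom (\<lambda>c. [:Const c:]) (\<lambda>v. if v = y then [:0, 1:] else [:Var v:])"

lemma is_hom_const_poly: "is_hom h \<Longrightarrow> is_hom (\<lambda>c. [:h c:])"
  by (intro is_homI) (auto simp: is_hom_simps one_pCons)

lemma is_hom_to_poly: "is_hom (to_poly y)"
  unfolding to_poly_def by (rule is_hom_mhom[OF is_hom_const_poly[OF is_hom_Const]])

lemma to_poly_Const: "to_poly y (Const c) = [:Const c:]"
  by (simp add: to_poly_def mhom_Const[OF is_hom_const_poly[OF is_hom_Const]])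

lemma to_poly_Var: "to_poly y (Var v) = (if v = y then [:0, 1:] else [:Var v:])"
  by (simp add: to_poly_def mhom_Var[OF is_hom_const_poly[OF is_hom_Const]])

lemma poly_to_poly: "poly (to_poly y p) (Var y) = p"
proof -
  have "is_hom (\<lambda>p. poly (to_poly y p) (Var y))"
    by (intro is_homI) (auto simp: is_hom_simps[OF is_hom_to_poly])
  then show ?thesis
    by (rule hom_eq_on_polys_in[OF polys_in_UNIV]) (auto simp: is_hom_id to_poly_Const to_poly_Var)
qed

lemma to_poly_in: "p \<in> polys_in X \<Longrightarrow> to_poly y p \<in> polys_over (polys_in (X - {y}))"
  unfolding to_poly_def
  by (rule mhom_in_subring[of _ X, OF _ is_hom_const_poly[OF is_hom_Const] is_subring_polys_over[OF is_subring_polys_in]])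
    (auto simp: polys_over_def coeff_pCons Const_in_polys_in Var_in_polys_in polys_in_simps split: nat.splits)

lemma mhom_cong:
  assumes "is_hom \<kappa>" "p \<in> polys_in X" "\<And>v. v \<in> X \<Longrightarrow> s v = s' v"
  shows "mhom \<kappa> s p = mhom \<kappa> s' p"
  by (rule hom_eq_on_polys_in[OF assms(2)])
    (auto simp: is_hom_mhom[OF assms(1)] assms(3) mhom_Const[OF assms(1)] mhom_Var[OF assms(1)])

lemma polys_in_empty: "p \<in> polys_in {} \<Longrightarrow> \<exists>c. p = Const c"
  unfolding polys_in_def mem_Collect_eq
  by (induction p rule: mpoly_induct) (auto, metis Const_simps(3), metis Const_simps(4))

lemma hom_poly:
  assumes "is_hom h"
  shows "h (poly p x) = poly (map_poly h p) (h x)"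
proof (induction p)
  case (pCons a p)
  have "map_poly h (pCons a p) = pCons (h a) (map_poly h p)"
    by (intro map_poly_pCons) (simp add: is_hom_simps[OF assms])
  then show ?case using pCons by (simp add: is_hom_simps[OF assms])
qed (simp add: is_hom_simps[OF assms])

text \<open>One variable at a time: a nonzero univariate complex polynomial has a value that is not
  zero.\<close>

lemma nonzero_mpoly_nonvanishing:
  assumes "finite X" "p \<in> polys_in X" "p \<noteq> 0"
  shows "\<exists>a. mhom (\<lambda>c. c) a p \<noteq> (0::complex)"
  using assms
proof (induction X arbitrary: p rule: finite_induct)
  case empty
  then obtain c where "p = Const c" using polys_in_empty by blast
  then show ?case using empty by (auto simp: mhom_Const[OF is_hom_id] Const_simps)
next
  case (insert y X)
  define P where "P = to_poly y p"
  have P: "poly P (Var y) = p" by (simp add: P_def poly_to_poly)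
  have Pin: "coeff P i \<in> polys_in X" for i
    using to_poly_in[OF insert.prems(1), of y] insert.hyps by (simp add: polys_over_def P_def)
  have "P \<noteq> 0" using P insert.prems by auto
  then obtain i where "coeff P i \<noteq> 0" by (metis leading_coeff_0_iff)
  then obtain a where a: "mhom (\<lambda>c. c) a (coeff P i) \<noteq> (0::complex)" using insert.IH[OF Pin] by blast
  define R where "R = map_poly (mhom (\<lambda>c. c) a) P"
  have h0: "mhom (\<lambda>c. c) a 0 = (0::complex)" by (simp add: is_hom_simps[OF is_hom_mhom[OF is_hom_id]])
  have "R \<noteq> 0" using a by (metis R_def coeff_0 coeff_map_poly h0)
  then obtain t where t: "poly R t \<noteq> 0" using poly_all_0_iff_0 by blast
  have "map_poly (mhom (\<lambda>c. c) (a(y := t))) P = R"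
  proof (rule poly_eqI)
    fix j
    have "mhom (\<lambda>c. c) (a(y := t)) (coeff P j) = mhom (\<lambda>c. c) a (coeff P j)"
      using insert.hyps by (intro mhom_cong[OF is_hom_id Pin]) auto
    then show "coeff (map_poly (mhom (\<lambda>c. c) (a(y := t))) P) j = coeff R j"
      by (simp add: R_def coeff_map_poly is_hom_simps[OF is_hom_mhom[OF is_hom_id]])
  qed
  then have "mhom (\<lambda>c. c) (a(y := t)) p = poly R t"
    using hom_poly[OF is_hom_mhom[OF is_hom_id], of "a(y := t)" P "Var y"] P by (simp add: mhom_Var[OF is_hom_id])
  then show ?case using t by metis
qed

text \<open>Restriction to a coordinate axis. It reads off the coefficients of pure powers, as
  \<open>monic_in\<close> requires, and being a homomorphism it can be compared with substitutions
  on variables.\<close>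

definition axis :: "nat \<Rightarrow> nat mpoly \<Rightarrow> complex poly" where
  "axis j = mhom (\<lambda>c. [:c:]) (\<lambda>l. if l = j then [:0, 1:] else 0)"

lemma is_hom_axis: "is_hom (axis j)"
  unfolding axis_def by (rule is_hom_mhom[OF is_hom_const_poly[OF is_hom_id]])

lemma axis_simps: "axis j (Const c) = [:c:]" "axis j (Var l) = (if l = j then [:0, 1:] else 0)"
  by (simp_all add: axis_def mhom_Const[OF is_hom_const_poly[OF is_hom_id]] mhom_Var[OF is_hom_const_poly[OF is_hom_id]])

lemma mev_monom: "mev (\<lambda>l. monom (a l) 1) \<alpha> = monom (mev a \<alpha>) (tdeg \<alpha>)"
proof -
  have "(\<Prod>v\<in>F. monom (a v) 1 ^ n v) = monom (\<Prod>v\<in>F. a v ^ n v) (\<Sum>v\<in>F. n v)" for F n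
    by (induction F rule: infinite_finite_induct)
      (auto simp: monom_power mult_monom monom_0 one_pCons)
  then show ?thesis by (simp add: mev_def tdeg_def)
qed

text \<open>On the line through the origin in direction \<open>a\<close>, the homogeneous part of
  degree \<open>t\<close> contributes exactly the \<open>t\<close>-th power of the
  parameter.\<close>

lemma coeff_mhom_monom:
  "coeff (mhom (\<lambda>c. [:c:]) (\<lambda>l. monom (a l) 1) p) t =
     (\<Sum>\<alpha>\<in>{\<alpha> \<in> keys p. tdeg \<alpha> = t}. lookup p \<alpha> * mev a \<alpha>)"
proof -
  have "coeff (mhom (\<lambda>c. [:c:]) (\<lambda>l. monom (a l) 1) p) t =
    (\<Sum>\<alpha>\<in>keys p. if tdeg \<alpha> = t then lookup p \<alpha> * mev a \<alpha> else 0)"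
    by (simp add: mhom_def coeff_sum mev_monom coeff_monom if_distrib del: One_nat_def cong: if_cong)
  then show ?thesis by (simp add: sum.If_cases Int_def)
qed

lemma monom_1_eq: "[:0, a:] = monom a 1"
  by (simp add: monom_0 monom_Suc)

lemma coeff_axis: "coeff (axis j p) t = lookup p (single j t)"
proof -
  have "axis j = mhom (\<lambda>c. [:c:]) (\<lambda>l. monom (if l = j then 1 else 0) 1)"
    unfolding axis_def by (rule arg_cong[where f="mhom _"]) (auto simp: fun_eq_iff monom_1_eq[simplified])
  then have "coeff (axis j p) t = (\<Sum>\<alpha>\<in>{\<alpha> \<in> keys p. tdeg \<alpha> = t}.
      lookup p \<alpha> * mev (\<lambda>l. if l = j then 1 else 0) \<alpha>)"
    by (simp only: coeff_mhom_monom)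
  also have "\<dots> = (\<Sum>\<alpha>\<in>{\<alpha> \<in> keys p. tdeg \<alpha> = t}.
      if \<alpha> = single j t then lookup p \<alpha> else 0)"
  proof (rule sum.cong)
    fix \<alpha> assume \<alpha>: "\<alpha> \<in> {\<alpha> \<in> keys p. tdeg \<alpha> = t}"
    show "lookup p \<alpha> * mev (\<lambda>l. if l = j then 1 else 0) \<alpha> =
      (if \<alpha> = single j t then lookup p \<alpha> else 0)"
    proof (cases "keys \<alpha> \<subseteq> {j}")
      case True
      then have "tdeg \<alpha> = lookup \<alpha> j" by (subst tdeg_superset[of "{j}"]) auto
      moreover have "\<alpha> = single j (lookup \<alpha> j)"
        using True by (intro poly_mapping_eqI) (auto simp: lookup_single when_def in_keys_iff)
      ultimately have "\<alpha> = single j t" using \<alpha> by simp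
      then show ?thesis by (simp add: mev_single)
    next
      case False
      then obtain v where v: "v \<in> keys \<alpha>" "v \<noteq> j" by auto
      then have "mev (\<lambda>l. if l = j then 1 else 0 :: complex) \<alpha> = 0"
        unfolding mev_def by (intro prod_zero) (auto simp: in_keys_iff intro!: bexI[of _ v])
      moreover have "\<alpha> \<noteq> single j t" using v by (auto simp: in_keys_iff lookup_single when_def split: if_splits)
      ultimately show ?thesis by simp
    qed
  qed simp
  also have "\<dots> = lookup p (single j t)"
    by (simp add: sum.delta in_keys_iff)
  finally show ?thesis .
qed

abbreviation sb :: "('v \<Rightarrow> 'w mpoly) \<Rightarrow> 'v mpoly \<Rightarrow> 'w mpoly" where
  "sb \<equiv> mhom Const"

lemmas is_hom_sb = is_hom_mhom[OF is_hom_Const]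
lemmas sb_simps = mhom_Const[OF is_hom_Const] mhom_Var[OF is_hom_Const]

lemma sb_in: "p \<in> polys_in X \<Longrightarrow> (\<And>v. v \<in> X \<Longrightarrow> s v \<in> polys_in Y) \<Longrightarrow> sb s p \<in> polys_in Y"
  by (rule mhom_in_subring[of _ X]) (auto simp: is_hom_Const is_subring_polys_in Const_in_polys_in)

lemma sb_sb: "sb s (sb s' p) = sb (\<lambda>v. sb s (s' v)) p"
  by (rule hom_eq_on_polys_in[OF polys_in_UNIV])
    (auto simp: is_hom_sb is_hom_comp[OF is_hom_sb is_hom_sb] sb_simps)

lemma sb_Var: "sb Var p = p"
  by (rule hom_eq_on_polys_in[OF polys_in_UNIV, where h="\<lambda>x. x"]) (auto simp: is_hom_sb is_hom_id sb_simps)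

text \<open>The inverse is carried along because primes and derivations must be transported back;
  degree at most 1 in both directions preserves all bounds on total degrees.\<close>

definition lin_aut :: "nat \<Rightarrow> (nat \<Rightarrow> nat mpoly) \<Rightarrow> (nat \<Rightarrow> nat mpoly) \<Rightarrow> bool" where
  "lin_aut N s s' \<longleftrightarrow> (\<forall>l. tot_le (s l) 1 \<and> tot_le (s' l) 1) \<and>
     (\<forall>l<N. s l \<in> polys_in {..<N} \<and> s' l \<in> polys_in {..<N}) \<and>
     (\<forall>l. sb s (s' l) = Var l \<and> sb s' (s l) = Var l)"

lemma lin_aut_inverse: "lin_aut N s s' \<Longrightarrow> sb s (sb s' p) = p" "lin_aut N s s' \<Longrightarrow> sb s' (sb s p) = p"
  by (simp_all add: sb_sb lin_aut_def sb_Var)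

text \<open>Make \<open>c\<close> monic in the last variable \<open>y\<^sub>j\<close> by the substitution \<open>y\<^sub>l \<mapsto> y\<^sub>l + a\<^sub>l y\<^sub>j\<close>
  (\<open>l < j\<close>), \<open>y\<^sub>j \<mapsto> a\<^sub>j y\<^sub>j\<close>, where \<open>a\<close> is not a zero of the top degree form of \<open>c\<close>.\<close>

lemma make_monic:
  assumes c: "c \<in> polys_in {..j}" "c \<noteq> 0" and jN: "j < N"
  obtains \<rho> \<rho>' b where "lin_aut N \<rho> \<rho>'" "b \<noteq> 0" "monic_in j (total_degree c) (Const b * sb \<rho> c)"
    "\<And>l. l > j \<Longrightarrow> \<rho> l = Var l" "\<And>l. l \<le> j \<Longrightarrow> \<rho> l \<in> polys_in {..j}"
    "\<And>i p. i > j \<Longrightarrow> axis i (sb \<rho> p) = axis i p"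
proof -
  let ?t = "total_degree c"
  have tc: "tot_le c ?t" by (simp flip: tot_le_total_degree)
  have "\<exists>\<alpha>\<in>keys c. tdeg \<alpha> = ?t"
  proof -
    obtain \<alpha> where \<alpha>: "\<alpha> \<in> keys c" using c(2) by (metis all_not_in_conv keys_eq_empty)
    have "?t \<in> insert 0 (tdeg ` keys c)"
      unfolding total_degree_def tdeg_def by (intro Max_in) auto
    then show ?thesis using \<alpha> tc unfolding tot_le_def by (metis image_iff insert_iff le_zero_eq)
  qed
  then obtain \<alpha> where \<alpha>: "\<alpha> \<in> keys c" "tdeg \<alpha> = ?t" by blast
  define top where "top = (\<Sum>\<alpha>\<in>{\<alpha> \<in> keys c. tdeg \<alpha> = ?t}. single \<alpha> (lookup c \<alpha>))"
  have "lookup top \<alpha> = lookup c \<alpha>"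
    using \<alpha> by (simp add: top_def lookup_sum lookup_single when_def sum.delta)
  then have top0: "top \<noteq> 0" using \<alpha>(1) by (auto simp: in_keys_iff)
  have sin: "single \<alpha> x \<in> polys_in {..j}" if "\<alpha> \<in> keys c" for \<alpha> x
    using that c(1) by (cases "x = 0") (auto simp: polys_in_def mvars_def)
  have "top \<in> polys_in {..j}" unfolding top_def by (intro polys_in_simps(8) sin) auto
  \<comment> \<open>The extra factor \<open>Var j\<close> makes \<open>a j\<close> nonzero as well,
    so that the substitution is invertible.\<close>
  then have "top * Var j \<in> polys_in {..j}" by (intro polys_in_simps(4) Var_in_polys_in) auto
  moreover have "top * Var j \<noteq> 0" using top0 by (simp add: Var_def) (metis keys_eq_empty keys_single insert_not_empty one_neq_zero)
  ultimately obtain a where a: "mhom (\<lambda>c. c) a (top * Var j) \<noteq> (0::complex)"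
    using nonzero_mpoly_nonvanishing[of "{..j}"] by blast
  define b where "b = mhom (\<lambda>c. c) a top"
  have ab: "b \<noteq> 0" "a j \<noteq> 0" using a by (auto simp: b_def mhom_mult[OF is_hom_id] mhom_Var[OF is_hom_id])
  have b_eq: "b = (\<Sum>\<alpha>\<in>{\<alpha> \<in> keys c. tdeg \<alpha> = ?t}. lookup c \<alpha> * mev a \<alpha>)"
    by (simp add: b_def top_def mhom_sum[OF is_hom_id] mhom_single[OF is_hom_id])
  define \<rho> where "\<rho> = (\<lambda>l. if l < j then Var l + Const (a l) * Var j else if l = j then Const (a j) * Var j else Var l)"
  define \<rho>' where "\<rho>' = (\<lambda>l. if l < j then Var l - Const (a l / a j) * Var j else if l = j then Const (1 / a j) * Var j else Var l)"
  have tl: "tot_le (Const x * Var j) 1" for x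
    using tot_le_mult[OF tot_le_Const[of x 0] tot_le_Var[of j]] by simp
  have cc: "Const x * (Const y * z) = Const (x * y) * z" for x y and z :: "nat mpoly" by (simp add: Const_simps mult.assoc)
  have aut: "lin_aut N \<rho> \<rho>'"
    unfolding lin_aut_def
  proof (intro conjI allI impI)
    fix l
    show "tot_le (\<rho> l) 1" "tot_le (\<rho>' l) 1"
      by (auto simp: \<rho>_def \<rho>'_def tl[simplified] tot_le_Var intro: tot_le_add tot_le_diff)
    show "sb \<rho> (\<rho>' l) = Var l"
      using ab by (auto simp: \<rho>'_def is_hom_simps[OF is_hom_sb] sb_simps \<rho>_def cc Const_simps)
    show "sb \<rho>' (\<rho> l) = Var l"
      using ab by (auto simp: \<rho>_def is_hom_simps[OF is_hom_sb] sb_simps \<rho>'_def cc Const_simps)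
    assume "l < N"
    then show "\<rho> l \<in> polys_in {..<N}" "\<rho>' l \<in> polys_in {..<N}"
      using jN by (auto simp: \<rho>_def \<rho>'_def intro!: polys_in_simps(3) polys_in_simps(4) polys_in_simps(6)
          Const_in_polys_in Var_in_polys_in)
  qed
  have rin: "\<rho> l \<in> polys_in {..j}" if "l \<le> j" for l
    using that by (auto simp: \<rho>_def intro!: polys_in_simps(3) polys_in_simps(4) Const_in_polys_in Var_in_polys_in)
  \<comment> \<open>The images of the variables up to \<open>j\<close> vanish on a later axis, so
    equations already monic in later variables remain so.\<close>
  have ax: "axis i (sb \<rho> p) = axis i p" if i: "i > j" for i p
  proof (rule hom_eq_on_polys_in[where g="\<lambda>p. axis i (sb \<rho> p)" and h="axis i" and X=UNIV])
    show "axis i (sb \<rho> (Var l)) = axis i (Var l)" for l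
      using i by (auto simp: sb_simps axis_simps \<rho>_def is_hom_simps[OF is_hom_axis])
  qed (simp_all only: polys_in_UNIV is_hom_comp[OF is_hom_axis is_hom_sb] is_hom_axis sb_simps)
  have "axis j (sb \<rho> c) = mhom (\<lambda>c. [:c:]) (\<lambda>l. monom (a l) 1) c"
  proof (rule hom_eq_on_polys_in[where g="\<lambda>p. axis j (sb \<rho> p)" and X="{..j}"])
    show "axis j (sb \<rho> (Var l)) = mhom (\<lambda>c. [:c:]) (\<lambda>l. monom (a l) 1) (Var l)" if "l \<in> {..j}" for l
      unfolding mhom_Var[OF is_hom_const_poly[OF is_hom_id]] monom_1_eq[symmetric]
      using that by (auto simp: sb_simps axis_simps \<rho>_def is_hom_simps[OF is_hom_axis])
  qed (simp_all only: c(1) is_hom_comp[OF is_hom_axis is_hom_sb] is_hom_mhom[OF is_hom_const_poly[OF is_hom_id]]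
      sb_simps axis_simps mhom_Const[OF is_hom_const_poly[OF is_hom_id]])
  then have "lookup (sb \<rho> c) (single j ?t) = b"
    by (simp only: coeff_axis[symmetric] coeff_mhom_monom b_eq)
  moreover have "tot_le (sb \<rho> c) ?t" using aut by (intro tot_le_mhom tc) (simp add: lin_aut_def)
  then have "tot_le (Const (1 / b) * sb \<rho> c) ?t" using tot_le_mult[OF tot_le_Const[of "1 / b" 0]] by simp
  moreover have "Const (1 / b) * sb \<rho> c \<in> polys_in {..j}"
    using sb_in[OF c(1) rin] by (intro polys_in_simps(4) Const_in_polys_in) auto
  ultimately have "monic_in j ?t (Const (1 / b) * sb \<rho> c)"
    using ab by (simp add: monic_in_def lookup_Const_mult)
  then show thesis using that[OF aut, of "1 / b"] ab ax rin by (auto simp: \<rho>_def)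
qed

text \<open>Take the least \<open>k\<close> that admits such a system. A nonzero \<open>c\<close> of
  low degree and high order in the first \<open>k\<close> variables could be made monic in the last
  of them, giving a system for \<open>k - 1\<close>. The bounds depend on the number of variables
  from which the relation was taken, hence \<open>Suc j\<close> for the equation of variable
  \<open>j\<close>.\<close>

lemma normalisation:
  fixes V :: "nat mpoly \<Rightarrow> nat \<Rightarrow> bool" and B la :: "nat \<Rightarrow> nat"
  assumes V: "is_val V" and la: "\<And>i. 1 \<le> la i"
  obtains k s s' e p where "k \<le> N" "lin_aut N s s'"
    "\<And>j. k \<le> j \<Longrightarrow> j < N \<Longrightarrow> monic_in j (e j) (p j) \<and> 1 \<le> e j \<and> e j \<le> B (Suc j) \<and> V (sb s (p j)) (la (Suc j))"
    "\<And>c. c \<in> polys_in {..<k} \<Longrightarrow> c \<noteq> 0 \<Longrightarrow> tot_le c (B k) \<Longrightarrow> \<not> V (sb s c) (la k)"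
proof -
  note Vs = is_val_simps[OF V]
  define good where "good = (\<lambda>k s s' e p. lin_aut N s s' \<and> (\<forall>j. k \<le> j \<longrightarrow> j < N \<longrightarrow>
      monic_in j (e j) (p j) \<and> 1 \<le> e j \<and> e j \<le> B (Suc j) \<and> V (sb s (p j)) (la (Suc j))))"
  define G where "G = (\<lambda>k. k \<le> N \<and> (\<exists>s s' e p. good k s s' e p))"
  have "lin_aut N Var Var" by (simp add: lin_aut_def tot_le_Var[simplified] Var_in_polys_in sb_simps)
  then have "G N" unfolding G_def good_def by (intro conjI exI[of _ Var]) auto
  define k where "k = (LEAST k. G k)"
  have Gk: "G k" unfolding k_def using \<open>G N\<close> by (rule LeastI)
  then obtain s s' e p where g: "good k s s' e p" and kN: "k \<le> N" by (auto simp: G_def)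
  have aut: "lin_aut N s s'" using g by (simp add: good_def)
  have constV: "\<not> V (sb s (Const x)) 1" if "x \<noteq> 0" for x using not_V_Const[OF V that] by (simp add: sb_simps)
  have "\<not> V (sb s c) (la k)" if c: "c \<in> polys_in {..<k}" "c \<noteq> 0" "tot_le c (B k)" for c
  proof
    assume Vc: "V (sb s c) (la k)"
    \<comment> \<open>A nonzero constant has order below \<open>1\<close>, while \<open>la k\<close>
      is at least \<open>1\<close>; this also excludes \<open>k = 0\<close>.\<close>
    have nc: "c \<noteq> Const x" for x
      using constV[of x] Vs(5)[OF Vc la[of k]] c(2) by (cases "x = 0") (auto simp: Const_simps)
    then obtain j where kj: "k = Suc j" using polys_in_empty[of c] c(1) by (cases k) auto
    have cj: "c \<in> polys_in {..j}" using c(1) by (simp add: kj lessThan_Suc_atMost)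
    have jN: "j < N" using kN kj by simp
    obtain \<rho> \<rho>' b where r: "lin_aut N \<rho> \<rho>'" "b \<noteq> 0" "monic_in j (total_degree c) (Const b * sb \<rho> c)"
      "\<And>l. l > j \<Longrightarrow> \<rho> l = Var l" "\<And>l. l \<le> j \<Longrightarrow> \<rho> l \<in> polys_in {..j}"
      "\<And>i p. i > j \<Longrightarrow> axis i (sb \<rho> p) = axis i p"
      using make_monic[OF cj c(2) jN] by blast
    \<comment> \<open>Composing \<open>s\<close> with the inverse \<open>\<rho>'\<close> makes
      \<open>sb t\<close> undo \<open>\<rho>\<close>, so the transformed equations keep their
      orders.\<close>
    define t where "t = (\<lambda>l. sb s (\<rho>' l))"
    define t' where "t' = (\<lambda>l. sb \<rho> (s' l))"
    have st: "sb t x = sb s (sb \<rho>' x)" "sb t' x = sb \<rho> (sb s' x)" for x by (simp_all add: t_def t'_def sb_sb)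
    have taut: "lin_aut N t t'"
      unfolding lin_aut_def
    proof (intro conjI allI impI)
      fix l
      show "tot_le (t l) 1" "tot_le (t' l) 1" unfolding t_def t'_def
        using aut r(1) by (auto simp: lin_aut_def intro!: tot_le_mhom)
      show "sb t (t' l) = Var l" unfolding st(1) t'_def
        using lin_aut_inverse[OF r(1)] aut by (simp add: lin_aut_def)
      show "sb t' (t l) = Var l" unfolding st(2) t_def
        using lin_aut_inverse[OF aut] r(1) by (simp add: lin_aut_def)
      assume "l < N"
      then show "t l \<in> polys_in {..<N}" "t' l \<in> polys_in {..<N}" unfolding t_def t'_def
        using aut r(1) by (auto simp: lin_aut_def intro!: sb_in[of _ "{..<N}"])
    qed
    define p' where "p' = (\<lambda>i. if i = j then Const b * sb \<rho> c else sb \<rho> (p i))"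
    define e' where "e' = (\<lambda>i. if i = j then total_degree c else e i)"
    have "monic_in i (e' i) (p' i) \<and> 1 \<le> e' i \<and> e' i \<le> B (Suc i) \<and> V (sb t (p' i)) (la (Suc i))"
      if i: "j \<le> i" "i < N" for i
    proof (cases "i = j")
      case True
      have "total_degree c \<noteq> 0"
      proof
        assume "total_degree c = 0"
        then have "tdeg \<alpha> = 0" if "\<alpha> \<in> keys c" for \<alpha>
          using that tot_le_total_degree[of c 0] by (auto simp: tot_le_def)
        then have "c \<in> polys_in {}"
          by (intro polys_inI) (metis lookup_le_tdeg le_zero_eq)
        then show False using polys_in_empty nc by blast
      qed
      moreover have "total_degree c \<le> B k" using c(3) by (simp add: tot_le_total_degree)
      moreover have "sb t (Const b * sb \<rho> c) = Const b * sb s c"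
        using lin_aut_inverse[OF r(1)] by (simp add: st is_hom_simps[OF is_hom_sb] sb_simps)
      ultimately show ?thesis using True r(3) Vs(2)[OF Vc] by (simp add: p'_def e'_def kj)
    next
      case False
      then have ij: "i > j" "k \<le> i" using i kj by auto
      have m: "monic_in i (e i) (p i)" "1 \<le> e i" "e i \<le> B (Suc i)" "V (sb s (p i)) (la (Suc i))"
        using g ij i(2) by (auto simp: good_def)
      have "\<rho> l \<in> polys_in {..i}" if "l \<le> i" for l
      proof (cases "l \<le> j")
        case True
        then show ?thesis using r(5)[OF True] ij by (auto simp: polys_in_def)
      next
        case False
        then show ?thesis using r(4)[of l] that by (auto intro!: Var_in_polys_in)
      qed
      then have "sb \<rho> (p i) \<in> polys_in {..i}"
        using m(1) by (intro sb_in[of _ "{..i}"]) (auto simp: monic_in_def)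
      moreover have "tot_le (sb \<rho> (p i)) (e i)"
        using m(1) r(1) by (intro tot_le_mhom) (auto simp: monic_in_def lin_aut_def)
      moreover have "lookup (sb \<rho> (p i)) (single i (e i)) = 1"
        using m(1) r(6)[OF ij(1), of "p i"] by (simp add: coeff_axis[symmetric] monic_in_def)
      moreover have "sb t (sb \<rho> (p i)) = sb s (p i)" using lin_aut_inverse[OF r(1)] by (simp add: st)
      ultimately show ?thesis using False m by (simp add: p'_def e'_def monic_in_def)
    qed
    then have "good j t t' e' p'" using taut by (simp add: good_def)
    then have "G j" using jN by (auto simp: G_def)
    then have "k \<le> j" unfolding k_def by (rule Least_le)
    then show False using kj by simp
  qed
  then show thesis using that[OF kN aut, of e p] g by (simp add: good_def)
qed

section \<open>Separable equations by repeated differentiation\<close>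

lemma pdv_eq_0: "p \<in> polys_in X \<Longrightarrow> j \<notin> X \<Longrightarrow> pdv j p = 0"
  unfolding polys_in_def mem_Collect_eq
  by (induction p rule: mpoly_induct) (auto simp: pdv_def is_deriv_simps[OF is_deriv_dext])

lemma poly_pderiv_eq_pdv:
  fixes Q :: "nat mpoly poly"
  assumes "Q \<in> polys_over (polys_in X)" "j \<notin> X"
  shows "poly (pderiv Q) (Var j) = pdv j (poly Q (Var j))"
proof -
  have d: "is_deriv (pdv j :: nat mpoly \<Rightarrow> _)" by (simp add: pdv_def is_deriv_dext)
  have "map_poly (pdv j) Q = 0"
    using assms(1) pdv_eq_0[OF _ assms(2)]
    by (intro poly_eqI) (simp add: coeff_map_poly is_deriv_simps[OF d] polys_over_def)
  then show ?thesis by (simp add: deriv_poly[OF d]) (simp add: pdv_def)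
qed

lemma pderiv_in_polys_over: "is_subring C \<Longrightarrow> Q \<in> polys_over C \<Longrightarrow> pderiv Q \<in> polys_over C"
  by (auto simp: polys_over_def coeff_pderiv simp del: of_nat_Suc intro!: is_subring_simps(4) is_subring_simps(10))

lemma degree_mev_le: "degree (mev s \<alpha>) \<le> (\<Sum>v\<in>keys \<alpha>. degree (s v) * lookup \<alpha> v)"
proof -
  have "degree (\<Prod>v\<in>F. s v ^ lookup \<alpha> v) \<le> (\<Sum>v\<in>F. degree (s v) * lookup \<alpha> v)" if "finite F" for F
    using that
  proof (induction F rule: finite_induct)
    case (insert v F)
    then show ?case using degree_mult_le[of "s v ^ lookup \<alpha> v" "\<Prod>v\<in>F. s v ^ lookup \<alpha> v"]
        degree_power_le[of "s v" "lookup \<alpha> v"] by simp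
  qed simp
  then show ?thesis by (simp add: mev_def)
qed

lemma degree_to_poly_less:
  assumes "\<And>\<alpha>. \<alpha> \<in> keys q \<Longrightarrow> lookup \<alpha> j < e" "i \<ge> e"
  shows "coeff (to_poly j q) i = 0"
proof -
  have "coeff ([:Const (lookup q \<alpha>):] * mev (\<lambda>v. if v = j then [:0, 1:] else [:Var v:]) \<alpha>) i = 0"
    if \<alpha>: "\<alpha> \<in> keys q" for \<alpha>
  proof -
    let ?s = "\<lambda>v. if v = j then [:0, 1:] else [:Var v:] :: 'a mpoly poly"
    have "degree (mev ?s \<alpha>) \<le> (\<Sum>v\<in>keys \<alpha>. degree (?s v) * lookup \<alpha> v)" by (rule degree_mev_le)
    also have "\<dots> = (\<Sum>v\<in>keys \<alpha>. if v = j then lookup \<alpha> j else 0)"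
      by (rule sum.cong) auto
    also have "\<dots> \<le> lookup \<alpha> j" by (simp add: sum.delta)
    also have "\<dots> < i" using assms \<alpha> by fastforce
    finally show ?thesis by (simp add: coeff_eq_0)
  qed
  then show ?thesis by (simp add: to_poly_def mhom_def coeff_sum)
qed

lemma higher_pderiv_monic:
  assumes "monic_in j e p"
  shows "(pderiv ^^ e) (to_poly j p) = [:Const (fact e):]"
proof -
  obtain p0 where p0: "p = Var j ^ e + p0"
    "\<And>\<alpha>. \<alpha> \<in> keys p0 \<Longrightarrow> lookup \<alpha> j < e \<and> tdeg \<alpha> \<le> e \<and> keys \<alpha> \<subseteq> {..j}"
    using monic_in_lower_terms[OF assms] by blast
  have z: "coeff (to_poly j p0) i = 0" if "i \<ge> e" for i
    using degree_to_poly_less[of p0 j e i] p0(2) that by blast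
  have "to_poly j p = monom 1 e + to_poly j p0"
    by (simp add: p0(1) is_hom_simps[OF is_hom_to_poly] to_poly_Var monom_altdef)
  then have c: "coeff (to_poly j p) (i + e) = (if i = 0 then 1 else 0)" for i
    by (simp add: z)
  show ?thesis
  proof (rule poly_eqI)
    fix i
    have "coeff ((pderiv ^^ e) (to_poly j p)) i = pochhammer (of_nat (Suc i)) e * coeff (to_poly j p) (i + e)"
      by (rule coeff_higher_pderiv)
    also have "\<dots> = coeff [:Const (fact e):] i"
    proof (cases i)
      case 0
      have "pochhammer (1 :: nat mpoly) e = of_nat (fact e)" by (simp add: pochhammer_fact[symmetric])
      moreover have "of_nat (fact e) = (Const (fact e) :: nat mpoly)" by (simp only: of_nat_eq_Const of_nat_fact)
      ultimately show ?thesis using c[of i] 0 by simp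
    qed (use c[of i] in simp)
    finally show "coeff ((pderiv ^^ e) (to_poly j p)) i = coeff [:Const (fact e):] i" .
  qed
qed

context monic_system
begin

text \<open>The \<open>e j\<close>-fold derivative of \<open>p j\<close> in its main variable is the
  constant \<open>fact (e j)\<close>, which is outside \<open>P\<close>. So some derivative lies in
  \<open>P\<close> while the next does not, and differentiation keeps the degree bound.\<close>

lemma separable_equation:
  assumes P: "is_prime P" "I0 \<subseteq> P" and j: "k \<le> j" "j < N"
  obtains Q where "Q \<in> polys_over (polys_in {..<j})" "poly Q (Var j) \<in> P" "poly (pderiv Q) (Var j) \<notin> P"
    "tot_le (poly Q (Var j)) (e j)" "poly Q (Var j) \<in> polys_in {..j}"
proof -
  define T where "T = to_poly j (p j)"
  have m: "monic_in j (e j) (p j)" using monic[OF j] .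
  have T: "(pderiv ^^ l) T \<in> polys_over (polys_in {..<j})" for l
  proof (induction l)
    case 0
    have "T \<in> polys_over (polys_in ({..j} - {j}))" unfolding T_def using m by (intro to_poly_in) (simp add: monic_in_def)
    moreover have "{..j} - {j} = {..<j}" by auto
    ultimately show ?case by simp
  qed (auto intro: pderiv_in_polys_over[OF is_subring_polys_in])
  have eq: "poly ((pderiv ^^ l) T) (Var j) = (pdv j ^^ l) (p j)" for l
    by (induction l) (auto simp: T_def poly_to_poly poly_pderiv_eq_pdv[OF T[unfolded T_def]])
  have tot: "tot_le ((pdv j ^^ l) (p j)) (e j) \<and> (pdv j ^^ l) (p j) \<in> polys_in {..j}" for l
    using m by (induction l) (auto simp: monic_in_def intro: tot_le_pdv pdv_in_polys_in)
  have "p j \<in> P" using P(2) gen_in_lin_ideal[of "{k..<N}" j p] j by (auto simp: I0_def)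
  moreover have "poly ((pderiv ^^ e j) T) (Var j) \<notin> P"
  proof
    assume "poly ((pderiv ^^ e j) T) (Var j) \<in> P"
    then have "Const (fact (e j)) \<in> P" by (simp add: T_def higher_pderiv_monic[OF m])
    then have "Const (1 / fact (e j)) * Const (fact (e j)) \<in> P"
      by (rule is_ideal_simps(3)[OF is_prime_simps(1)[OF P(1)]])
    then show False using is_prime_simps(2)[OF P(1)] by (simp flip: Const_simps(4) add: Const_simps(2))
  qed
  ultimately obtain l where l: "poly ((pderiv ^^ l) T) (Var j) \<in> P" "poly ((pderiv ^^ Suc l) T) (Var j) \<notin> P"
  proof -
    have "\<exists>l. poly ((pderiv ^^ l) T) (Var j) \<in> P \<and> poly ((pderiv ^^ Suc l) T) (Var j) \<notin> P"
    proof (rule ccontr)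
      assume *: "\<not> ?thesis"
      have "poly ((pderiv ^^ l) T) (Var j) \<in> P" for l
        by (induction l) (use \<open>p j \<in> P\<close> * in \<open>auto simp: T_def poly_to_poly\<close>)
      then show False using \<open>poly ((pderiv ^^ e j) T) (Var j) \<notin> P\<close> by blast
    qed
    then show thesis using that by blast
  qed
  then show thesis using that[OF T[of l]] tot[of l] by (simp add: eq)
qed

end

text \<open>After \<open>i\<close> elimination steps the quotient algebra has rank at most \<open>degree_bound K D i\<close>, and relations of
  degree \<open>K * degree_bound K D i ^ 3\<close> have to be excluded; an element of order \<open>order_bound X (Suc k)\<close>
  is no product of \<open>X\<close> elements of order at most \<open>order_bound X k\<close>.\<close>

fun degree_bound :: "nat \<Rightarrow> nat \<Rightarrow> nat \<Rightarrow> nat" where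
  "degree_bound K D 0 = D"
| "degree_bound K D (Suc i) = K * degree_bound K D i ^ 4"

fun order_bound :: "nat \<Rightarrow> nat \<Rightarrow> nat" where
  "order_bound X 0 = 1"
| "order_bound X (Suc i) = X * (order_bound X i + 1) + 1"

lemma degree_bound_mono: "1 \<le> K \<Longrightarrow> 1 \<le> D \<Longrightarrow> i \<le> j \<Longrightarrow> 1 \<le> degree_bound K D i \<and> degree_bound K D i \<le> degree_bound K D j"
proof -
  assume K: "1 \<le> K" "1 \<le> D" and "i \<le> j"
  have p: "1 \<le> degree_bound K D i" for i using K by (induction i) auto
  have "degree_bound K D i \<le> degree_bound K D (Suc i)" for i
    using K p[of i] self_le_power[of "degree_bound K D i" 4] mult_le_mono[of 1 K "degree_bound K D i" "degree_bound K D i ^ 4"] by simp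
  then show ?thesis using p \<open>i \<le> j\<close> lift_Suc_mono_le[of "degree_bound K D" i j] by blast
qed

lemma order_bound_mono: "1 \<le> X \<Longrightarrow> i \<le> j \<Longrightarrow> order_bound X i \<le> order_bound X j"
proof -
  assume X: "1 \<le> X" and "i \<le> j"
  have "order_bound X i \<le> order_bound X (Suc i)" for i using X mult_le_mono1[of 1 X "order_bound X i + 1"] by simp
  then show ?thesis using \<open>i \<le> j\<close> lift_Suc_mono_le[of "order_bound X" i j] by blast
qed

lemma order_bound_ge_1: "1 \<le> order_bound X i" by (cases i) auto

text \<open>The prime \<open>P\<close> is an exact model of the approximate zero described by \<open>V\<close>: in low degree it
  contains precisely the polynomials of high order.\<close>

lemma prime_from_order:
  fixes V :: "nat mpoly \<Rightarrow> nat \<Rightarrow> bool" and N D :: nat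
  assumes V: "is_val V" and D: "1 \<le> D"
  defines "K \<equiv> 2 ^ (3 * N + 2)"
  shows "\<exists>P J m \<tau> M. is_prime P \<and> finite (J :: nat set) \<and> D \<le> M \<and> \<tau> \<le> order_bound (degree_bound K D N) N \<and>
    (\<forall>a\<in>polys_in {..<N}. a \<in> P \<longrightarrow> V a (\<tau> + 1)) \<and>
    (\<forall>a\<in>polys_in {..<N}. tot_le a (2 ^ (N + 1) * M) \<longrightarrow> V a \<tau> \<longrightarrow> a \<in> P) \<and>
    (\<forall>j\<in>J. m j \<in> polys_in {..<N} \<and> m j \<in> P \<and> tot_le (m j) M) \<and>
    (\<forall>d. is_deriv d \<longrightarrow> (\<forall>j\<in>J. d (m j) \<in> P) \<longrightarrow> (\<forall>a\<in>polys_in {..<N}. a \<in> P \<longrightarrow> d a \<in> P))"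
proof -
  \<comment> \<open>With \<open>i\<close> free coordinates, \<open>N - i\<close> have been
    eliminated. By \<open>low_degree_in_prime\<close> relations up to degree
    \<open>k * (2 * k * M * (M * B'))\<close> must be excluded, where
    \<open>B' = 2 ^ (N + 1) * M'\<close>; bounding \<open>k\<close> by \<open>2 ^ N\<close> and
    \<open>M\<close> by \<open>M'\<close> gives \<open>K * M' ^ 3\<close>.\<close>
  define B where "B = (\<lambda>i. K * degree_bound K D (N - i) ^ 3)"
  define X where "X = degree_bound K D N"
  have K1: "1 \<le> K" by (simp add: K_def)
  have X1: "1 \<le> X" using degree_bound_mono[OF K1 D, of N N] by (simp add: X_def)
  obtain k s s' e p where k: "k \<le> N" and aut: "lin_aut N s s'"
    and p: "\<And>j. k \<le> j \<Longrightarrow> j < N \<Longrightarrow> monic_in j (e j) (p j) \<and> 1 \<le> e j \<and> e j \<le> B (Suc j) \<and> V (sb s (p j)) (order_bound X (Suc j))"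
    and ind: "\<And>c. c \<in> polys_in {..<k} \<Longrightarrow> c \<noteq> 0 \<Longrightarrow> tot_le c (B k) \<Longrightarrow> \<not> V (sb s c) (order_bound X k)"
    using normalisation[OF V, of "order_bound X" N B] order_bound_ge_1 by blast
  interpret monic_system k N e p using k p by unfold_locales auto
  define M' where "M' = degree_bound K D (N - k)"
  define \<tau> where "\<tau> = order_bound X k"
  define V' where "V' = (\<lambda>a. V (sb s a))"
  have V': "is_val V'" unfolding V'_def by (rule is_val_hom[OF V is_hom_sb])
  \<comment> \<open>A new equation of degree at most \<open>K * degree_bound K D i ^ 3\<close>
    multiplies the rank, which explains the fourth power. The factor \<open>D\<close> makes
    \<open>M'\<close> bound the degrees of the given polynomials too.\<close>
  have prod: "(\<Prod>j\<in>{l..<N}. e j) * D \<le> degree_bound K D (N - l)" if "l \<le> N" "k \<le> l" for l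
    using that
  proof (induction rule: inc_induct)
    case (step l)
    have "(\<Prod>j\<in>{l..<N}. e j) * D = e l * ((\<Prod>j\<in>{Suc l..<N}. e j) * D)"
      using step.hyps by (simp add: prod.atLeast_Suc_lessThan)
    also have "\<dots> \<le> B (Suc l) * degree_bound K D (N - Suc l)"
      using p[of l] step by (intro mult_le_mono) auto
    also have "\<dots> = degree_bound K D (Suc (N - Suc l))" by (simp add: B_def power_numeral_reduce)
    also have "Suc (N - Suc l) = N - l" using step.hyps by simp
    finally show ?case .
  qed simp
  have MM: "M * D \<le> M'" using prod[of k] k by (simp add: M_def M'_def)
  have "M \<le> M * D" "D \<le> M * D" using D M_pos by auto
  then have M1: "M \<le> M'" "D \<le> M'" using MM by linarith+
  have M'X: "M' \<le> X" unfolding M'_def X_def using degree_bound_mono[OF K1 D, of "N - k" N] by simp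
  have eM: "e j \<le> M'" if "k \<le> j" "j < N" for j
  proof -
    have "e j \<le> M" unfolding M_def using epos that
      by (intro dvd_imp_le dvd_prodI) (auto intro!: prod_pos simp: Suc_le_eq)
    then show ?thesis using M1 by simp
  qed
  \<comment> \<open>This threshold is \<open>order_bound X (Suc k)\<close>; the uniform factor
    \<open>X\<close> dominates the actual rank \<open>M\<close>.\<close>
  have "V' (p j) (X * (\<tau> + 1) + 1)" if "k \<le> j" "j < N" for j
    using p[OF that] is_val_simps(5)[OF V _ order_bound_mono[OF X1, of "Suc k" "Suc j"]] that by (auto simp: V'_def \<tau>_def)
  moreover have "M * (\<tau> + 1) + 1 \<le> X * (\<tau> + 1) + 1" using M1 M'X by (intro add_mono mult_le_mono) auto
  ultimately obtain P0 where P0: "is_prime P0" "I0 \<subseteq> P0"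
    and P0V: "\<And>a. a \<in> polys_in {..<N} \<Longrightarrow> a \<in> P0 \<Longrightarrow> V' a (\<tau> + 1)"
    and P0c: "\<And>c. c \<in> polys_in {..<k} \<Longrightarrow> c \<in> P0 \<Longrightarrow> c = 0"
    using prime_of_order[OF V', of "X * (\<tau> + 1) + 1" \<tau>] by blast
  have "\<exists>Q. Q \<in> polys_over (polys_in {..<j}) \<and> poly Q (Var j) \<in> P0 \<and> poly (pderiv Q) (Var j) \<notin> P0 \<and>
     tot_le (poly Q (Var j)) (e j) \<and> poly Q (Var j) \<in> polys_in {..j}" if "k \<le> j" "j < N" for j
    using separable_equation[OF P0 that] by metis
  then obtain Q where Q: "\<And>j. k \<le> j \<Longrightarrow> j < N \<Longrightarrow> Q j \<in> polys_over (polys_in {..<j}) \<and> poly (Q j) (Var j) \<in> P0 \<and>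
     poly (pderiv (Q j)) (Var j) \<notin> P0 \<and> tot_le (poly (Q j) (Var j)) (e j) \<and> poly (Q j) (Var j) \<in> polys_in {..j}"
    by metis
  \<comment> \<open>Back to the original coordinates, with the equations transported
    accordingly.\<close>
  define P where "P = {a. sb s' a \<in> P0}"
  define m where "m = (\<lambda>j. sb s (poly (Q j) (Var j)))"
  have sin: "sb s a \<in> polys_in {..<N}" "sb s' a \<in> polys_in {..<N}" if "a \<in> polys_in {..<N}" for a
    using that aut by (auto simp: lin_aut_def intro!: sb_in[of a "{..<N}"])
  have stot: "tot_le (sb s a) t" "tot_le (sb s' a) t" if "tot_le a t" for a t
    using that aut by (auto simp: lin_aut_def intro!: tot_le_mhom)
  note inv = lin_aut_inverse[OF aut]
  have p1: "is_prime P"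
    using P0(1) unfolding is_prime_def is_ideal_def P_def by (auto simp: is_hom_simps[OF is_hom_sb])
  have p5: "V a (\<tau> + 1)" if "a \<in> polys_in {..<N}" "a \<in> P" for a
    using P0V[OF sin(2)[OF that(1)]] that(2) by (simp add: P_def V'_def inv)
  have p6: "a \<in> P" if a: "a \<in> polys_in {..<N}" "tot_le a (2 ^ (N + 1) * M')" "V a \<tau>" for a
  proof -
    have "sb s' a \<in> P0"
    proof (rule low_degree_in_prime[OF V' P0 P0V])
      show "\<And>c. c \<in> polys_in {..<k} \<Longrightarrow> c \<noteq> 0 \<Longrightarrow> tot_le c (B k) \<Longrightarrow> \<not> V' c \<tau>"
        using ind by (simp add: V'_def \<tau>_def)
      have kN: "k \<le> 2 ^ N" using k less_exp[of N] by linarith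
      have "k * (2 * k * M * (M * (2 ^ (N + 1) * M'))) \<le> 2 ^ N * (2 * 2 ^ N * M' * (M' * (2 ^ (N + 1) * M')))"
        using kN M1 by (intro mult_le_mono) auto
      also have "\<dots> = B k" by (simp add: B_def K_def M'_def power_add power_mult power3_eq_cube algebra_simps)
      finally show "k * (2 * k * M * (M * (2 ^ (N + 1) * M'))) \<le> B k" .
      show "sb s' a \<in> polys_in {..<N}" "tot_le (sb s' a) (2 ^ (N + 1) * M')" "V' (sb s' a) \<tau>"
        using sin(2)[OF a(1)] stot(2)[OF a(2)] a(3) by (auto simp: V'_def inv)
    qed auto
    then show ?thesis by (simp add: P_def)
  qed
  have p7: "m j \<in> polys_in {..<N} \<and> m j \<in> P \<and> tot_le (m j) M'" if "j \<in> {k..<N}" for j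
  proof -
    have j: "k \<le> j" "j < N" using that by auto
    have "poly (Q j) (Var j) \<in> polys_in {..<N}" using Q[OF j] j by (auto simp: polys_in_def)
    then show ?thesis using Q[OF j] sin(1) stot(1)[OF tot_le_weaken[OF _ eM[OF j]]] by (auto simp: m_def P_def inv)
  qed
  \<comment> \<open>Conjugate \<open>d\<close> into the normalised coordinates. On the free ones
    \<open>P0\<close> contains only zero; each further variable is handled by its separable equation
    \<open>Q i\<close>.\<close>
  have p8: "d a \<in> P" if d: "is_deriv d" "\<forall>j\<in>{k..<N}. d (m j) \<in> P" and a: "a \<in> polys_in {..<N}" "a \<in> P" for d a
  proof -
    define d' where "d' = (\<lambda>x. sb s' (d (sb s x)))"
    have d': "is_deriv d'"
      by (intro is_derivI) (auto simp: d'_def is_hom_simps[OF is_hom_sb] is_deriv_simps[OF d(1)] inv)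
    have "\<forall>b. b \<in> polys_in {..<i} \<longrightarrow> b \<in> P0 \<longrightarrow> d' b \<in> P0" if "k \<le> i" "i \<le> N" for i
      using that
    proof (induction rule: dec_induct)
      case base
      show ?case using P0c is_ideal_simps(1)[OF is_prime_simps(1)[OF P0(1)]] by (metis is_deriv_simps(2)[OF d'])
    next
      case (step i)
      have i: "k \<le> i" "i < N" using step by auto
      show ?case
      proof (intro allI impI)
        fix b assume b: "b \<in> polys_in {..<Suc i}" "b \<in> P0"
        have "{..<Suc i} - {i} = {..<i}" by auto
        then have tb: "to_poly i b \<in> polys_over (polys_in {..<i})" using to_poly_in[OF b(1), of i] by simp
        have "d' (poly (to_poly i b) (Var i)) \<in> P0"
        proof (rule deriv_extends_mod_prime[OF P0(1) d' is_subring_polys_in _ _ _ _ _ tb])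
          show "Q i \<in> polys_over (polys_in {..<i})" "poly (Q i) (Var i) \<in> P0" "poly (pderiv (Q i)) (Var i) \<notin> P0"
            using Q[OF i] by auto
          show "d' (poly (Q i) (Var i)) \<in> P0" using d(2) i by (simp add: d'_def m_def P_def)
          show "\<And>a. a \<in> polys_in {..<i} \<Longrightarrow> a \<in> P0 \<Longrightarrow> d' a \<in> P0" using step by auto
          show "poly (to_poly i b) (Var i) \<in> P0" using b by (simp add: poly_to_poly)
        qed
        then show "d' b \<in> P0" by (simp add: poly_to_poly)
      qed
    qed
    then have "d' (sb s' a) \<in> P0" using k sin(2)[OF a(1)] a(2) by (auto simp: P_def)
    then show ?thesis by (simp add: d'_def inv P_def)
  qed
  have p4: "\<tau> \<le> order_bound (degree_bound K D N) N" unfolding \<tau>_def using order_bound_mono[OF X1 k] by (simp add: X_def)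
  show ?thesis
    by (intro exI[of _ P] exI[of _ "{k..<N}"] exI[of _ m] exI[of _ \<tau>] exI[of _ M'] conjI ballI allI impI
        p1 finite_atLeastLessThan M1(2) p4) (fact p5, fact p6, simp_all only: p7 p8)
qed

section \<open>Orders defined by a derivation\<close>

text \<open>\<open>vge d Q p t\<close> says that the first \<open>t\<close> Taylor coefficients of \<open>p\<close> along the flow of \<open>d\<close> vanish at \<open>Q\<close>.\<close>

definition vge :: "('a \<Rightarrow> 'a) \<Rightarrow> 'a::comm_ring_1 set \<Rightarrow> 'a \<Rightarrow> nat \<Rightarrow> bool" where
  "vge d Q p t \<longleftrightarrow> (\<forall>i<t. (d ^^ i) p \<in> Q)"

text \<open>This loss of one order is the reason for the gap between \<open>\<tau> + 1\<close> and
  \<open>\<tau>\<close>.\<close>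

lemma vge_deriv: "vge d Q p (t + 1) \<Longrightarrow> vge d Q (d p) t"
  unfolding vge_def
proof (intro allI impI)
  fix i assume "\<forall>i<t + 1. (d ^^ i) p \<in> Q" "i < t"
  then have "(d ^^ Suc i) p \<in> Q" by (metis Suc_eq_plus1 Suc_less_eq)
  then show "(d ^^ i) (d p) \<in> Q" by (simp add: funpow_swap1)
qed

text \<open>If \<open>i\<close> and \<open>j\<close> are the first indices at which the derivatives
  of \<open>a\<close> and \<open>b\<close> leave \<open>Q\<close>, then in the Leibniz formula for
  the derivative of order \<open>i + j\<close> only the term of these two is outside
  \<open>Q\<close>; its binomial coefficient is not in \<open>Q\<close> by
  \<open>char0\<close>.\<close>

lemma is_val_vge:
  assumes d: "is_deriv d" and Q: "is_prime Q" and char0: "\<And>k. k > 0 \<Longrightarrow> of_nat k \<notin> Q"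
  shows "is_val (vge d Q)"
  unfolding is_val_def
proof (intro conjI allI impI)
  note Qi = is_ideal_simps[OF is_prime_simps(1)[OF Q]]
  show "vge d Q (a + b) t" if "vge d Q a t" "vge d Q b t" for a b t
    using that by (simp add: vge_def is_deriv_funpow_add[OF d] Qi)
  show "vge d Q (b * a) t" if "vge d Q a t" for a b t
    using that by (auto simp: vge_def is_deriv_Leibniz[OF d] intro!: Qi(7) Qi(3))
  show "vge d Q a s" if "vge d Q a t" "s \<le> t" for a s t using that by (simp add: vge_def)
  show "\<not> vge d Q 1 1" using is_prime_simps(2)[OF Q] by (simp add: vge_def)
  have "(d ^^ i) 0 = 0" for i by (induction i) (auto simp: is_deriv_simps[OF d])
  then show "vge d Q 0 t" for t by (simp add: vge_def Qi)
  fix a b s t assume ab: "\<not> vge d Q a s" "\<not> vge d Q b t"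
  define i where "i = (LEAST i. (d ^^ i) a \<notin> Q)"
  define j where "j = (LEAST j. (d ^^ j) b \<notin> Q)"
  obtain i' where i': "i' < s" "(d ^^ i') a \<notin> Q" using ab(1) by (auto simp: vge_def)
  obtain j' where j': "j' < t" "(d ^^ j') b \<notin> Q" using ab(2) by (auto simp: vge_def)
  have i: "(d ^^ i) a \<notin> Q" "i < s" "\<And>l. l < i \<Longrightarrow> (d ^^ l) a \<in> Q"
    unfolding i_def using LeastI[of "\<lambda>i. (d ^^ i) a \<notin> Q", OF i'(2)] Least_le[of "\<lambda>i. (d ^^ i) a \<notin> Q", OF i'(2)] i'(1)
      not_less_Least[of _ "\<lambda>i. (d ^^ i) a \<notin> Q"] by auto
  have j: "(d ^^ j) b \<notin> Q" "j < t" "\<And>l. l < j \<Longrightarrow> (d ^^ l) b \<in> Q"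
    unfolding j_def using LeastI[of "\<lambda>i. (d ^^ i) b \<notin> Q", OF j'(2)] Least_le[of "\<lambda>i. (d ^^ i) b \<notin> Q", OF j'(2)] j'(1)
      not_less_Least[of _ "\<lambda>i. (d ^^ i) b \<notin> Q"] by auto
  let ?f = "\<lambda>l. of_nat (i + j choose l) * (d ^^ l) a * (d ^^ (i + j - l)) b"
  have "(d ^^ (i + j)) (a * b) = ?f i + (\<Sum>l\<in>{..i + j} - {i}. ?f l)"
    unfolding is_deriv_Leibniz[OF d] by (intro sum.remove) auto
  moreover have "(\<Sum>l\<in>{..i + j} - {i}. ?f l) \<in> Q"
  proof (rule Qi(7))
    fix l assume l: "l \<in> {..i + j} - {i}"
    show "?f l \<in> Q"
    proof (cases "l < i")
      case True
      then show ?thesis by (intro Qi(4) Qi(3) i(3))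
    next
      case False
      then have "i + j - l < j" using l by auto
      then show ?thesis by (intro Qi(3) j(3))
    qed
  qed
  moreover have "?f i \<notin> Q"
    using i(1) j(1) char0[of "i + j choose i"] by (simp add: is_prime_simps(3)[OF Q])
  ultimately have "(d ^^ (i + j)) (a * b) \<notin> Q"
    using Qi(6)[of "(d ^^ (i + j)) (a * b)" "\<Sum>l\<in>{..i + j} - {i}. ?f l"] by auto
  then show "\<not> vge d Q (a * b) (s + t)" using i(2) j(2) by (auto simp: vge_def intro!: exI[of _ "i + j"])
qed

section \<open>Differential points over fraction fields\<close>

text \<open>The derivation \<open>d / q\<close> of the fraction field; the choice of the representative is immaterial.\<close>

definition fract_deriv :: "('a::idom \<Rightarrow> 'a) \<Rightarrow> 'a \<Rightarrow> 'a fract \<Rightarrow> 'a fract" where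
  "fract_deriv d q x = (let r = (SOME r. snd r \<noteq> 0 \<and> x = Fract (fst r) (snd r)) in
     Fract (d (fst r) * snd r - fst r * d (snd r)) (snd r * snd r * q))"

text \<open>Independence of the chosen representative: cross-multiplication reduces it to the
  derivative of the identity \<open>a * b' = a' * b\<close>.\<close>

lemma fract_deriv_Fract:
  assumes d: "is_deriv d" and q: "q \<noteq> 0" and b: "b \<noteq> 0"
  shows "fract_deriv d q (Fract a b) = Fract (d a * b - a * d b) (b * b * q)"
proof -
  define r where "r = (SOME r. snd r \<noteq> 0 \<and> Fract a b = Fract (fst r) (snd r))"
  have "\<exists>r. snd r \<noteq> 0 \<and> Fract a b = Fract (fst r) (snd r)" using b by (intro exI[of _ "(a, b)"]) simp
  then have "snd r \<noteq> 0 \<and> Fract a b = Fract (fst r) (snd r)" unfolding r_def by (rule someI_ex)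
  then obtain a' b' where r: "r = (a', b')" "b' \<noteq> 0" and e: "a * b' = a' * b"
    using b by (cases r) (auto simp: eq_fract)
  have "d (a * b') = d (a' * b)" by (simp only: e)
  then have "d a * b' + a * d b' = d a' * b + a' * d b" by (simp only: is_deriv_simps[OF d])
  then have de: "d a * b' - d a' * b = a' * d b - a * d b'" by (simp add: algebra_simps)
  have "(d a * b - a * d b) * (b' * b') - (d a' * b' - a' * d b') * (b * b) =
      b * b' * (d a * b' - d a' * b) - (a * b') * d b * b' + (a' * b) * d b' * b" by (simp add: algebra_simps)
  also have "\<dots> = b * b' * (a' * d b - a * d b') - (a' * b) * d b * b' + (a * b') * d b' * b" by (simp only: de e)
  also have "\<dots> = 0" by (simp add: algebra_simps)
  finally have "(d a' * b' - a' * d b') * (b * b) = (d a * b - a * d b) * (b' * b')" by simp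
  then have "(d a' * b' - a' * d b') * (b * b * q) = (d a * b - a * d b) * (b' * b' * q)" by (simp only: mult.assoc[symmetric])
  then have "Fract (d a' * b' - a' * d b') (b' * b' * q) = Fract (d a * b - a * d b) (b * b * q)"
    using b r(2) q by (simp add: eq_fract)
  then show ?thesis by (simp add: fract_deriv_def r_def[symmetric] r)
qed

lemma is_deriv_fract_deriv:
  fixes d :: "'a::idom \<Rightarrow> 'a"
  assumes d: "is_deriv d" and q: "q \<noteq> 0"
  shows "is_deriv (fract_deriv d q)"
proof (rule is_derivI)
  note D = is_deriv_simps[OF d] and F = fract_deriv_Fract[OF d q]
  fix x y :: "'a fract"
  obtain a b where x: "x = Fract a b" "b \<noteq> 0" by (cases x) auto
  obtain a' b' where y: "y = Fract a' b'" "b' \<noteq> 0" by (cases y) auto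
  have s: "x + y = Fract (a * b' + a' * b) (b * b')" "x * y = Fract (a * a') (b * b')"
    using x y by simp_all
  have bb: "(b * b') * (b * b') * q \<noteq> 0" "q \<noteq> 0" "b * b' * q \<noteq> 0" using x y q by auto
  have "fract_deriv d q x + fract_deriv d q y = Fract ((d a * b - a * d b) * (b' * b' * q) + (d a' * b' - a' * d b') * (b * b * q)) ((b * b * q) * (b' * b' * q))"
    using x y q by (simp add: F)
  also have "\<dots> = Fract (q * (d (a * b' + a' * b) * (b * b') - (a * b' + a' * b) * d (b * b'))) (q * ((b * b') * (b * b') * q))"
    by (simp add: D algebra_simps)
  also have "\<dots> = fract_deriv d q (x + y)" using x y bb unfolding s by (simp add: F mult_fract_cancel)
  finally show "fract_deriv d q (x + y) = fract_deriv d q x + fract_deriv d q y" ..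
  have "fract_deriv d q x * y + x * fract_deriv d q y = Fract (((d a * b - a * d b) * a') * (b * (b' * b' * q)) + (a * (d a' * b' - a' * d b')) * ((b * b * q) * b')) (((b * b * q) * b') * (b * (b' * b' * q)))"
    using x y q by (simp add: F)
  also have "\<dots> = Fract ((b * b' * q) * (d (a * a') * (b * b') - (a * a') * d (b * b'))) ((b * b' * q) * ((b * b') * (b * b') * q))"
    by (simp add: D algebra_simps)
  also have "\<dots> = fract_deriv d q (x * y)" using x y bb unfolding s by (simp add: F mult_fract_cancel)
  finally show "fract_deriv d q (x * y) = fract_deriv d q x * y + x * fract_deriv d q y" ..
qed

lemma is_hom_Fract_1: "is_hom (\<lambda>a. Fract a 1)"
  by (intro is_homI) (simp_all add: One_fract_def)

definition var_index :: "nat \<Rightarrow> dvar \<Rightarrow> nat" where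
  "var_index n w = (case fst w of DX j \<Rightarrow> j | DU k \<Rightarrow> n + k)"

lemma dring_eq_polys_in: "dring n m = polys_in (dvars n m)"
  by (simp add: dring_def polys_in_def)

lemma dderiv_in_dring: "p \<in> dring n m \<Longrightarrow> dderiv p \<in> dring n m"
  unfolding dring_eq_polys_in
  by (rule deriv_in_subring[OF _ is_deriv_dderiv is_subring_polys_in])
    (auto simp: dderiv_eq_dext polys_in_simps intro!: Var_in_polys_in, auto simp: dvars_def shift_var_def)

text \<open>\<open>\<alpha>\<close> is a vector field tangent to \<open>P\<close>, and dividing by
  \<open>q\<close> gives \<open>x' = f\<close>. Instead of forming the residue field of
  \<open>P\<close>, the proof works in the local ring at \<open>P\<close> inside the fraction field;
  this ring and its maximal ideal are stable under the derivation because \<open>q\<close> is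
  outside \<open>P\<close>.\<close>

lemma proper_diff_ideal:
  fixes P :: "nat mpoly set"
  assumes P: "is_prime P" and N: "N = n + m" and q: "q \<in> polys_in {..<N}" "q \<notin> P"
    and \<alpha>: "\<And>l. \<alpha> l \<in> polys_in {..<N}" and closed: "\<And>a. a \<in> polys_in {..<N} \<Longrightarrow> a \<in> P \<Longrightarrow> dext \<alpha> a \<in> P"
    and fs: "\<And>j. j < n \<Longrightarrow> fs ! j \<in> polys_in (base_vars n m) \<and> \<alpha> j = q * sb (\<lambda>w. Var (var_index n w)) (fs ! j)"
    and gs: "\<And>g. g \<in> set gs \<Longrightarrow> g \<in> polys_in (base_vars n m) \<and> sb (\<lambda>w. Var (var_index n w)) g \<in> P"
  shows "1 \<notin> diff_ideal_gen n m (ode_gens n fs gs)"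
proof -
  define A where "A = (polys_in {..<N} :: nat mpoly set)"
  define \<delta> where "\<delta> = dext \<alpha>"
  have d: "is_deriv \<delta>" by (simp add: \<delta>_def is_deriv_dext)
  have \<delta>A: "\<delta> a \<in> A" if "a \<in> A" for a
    using that unfolding A_def \<delta>_def
    by (rule deriv_in_subring[OF _ is_deriv_dext is_subring_polys_in]) (auto simp: \<alpha> polys_in_simps)
  note Pi = is_ideal_simps[OF is_prime_simps(1)[OF P]] and Pm = is_prime_simps(3)[OF P]
  have Am: "is_subring A" by (simp add: A_def is_subring_polys_in)
  note As = is_subring_simps[OF Am]
  have q0: "q \<noteq> 0" using q Pi(1) by auto
  have nz: "b \<notin> P \<Longrightarrow> b \<noteq> 0" for b using Pi(1) by auto
  note F = fract_deriv_Fract[OF d q0]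
  \<comment> \<open>The local ring of \<open>A\<close> at \<open>P\<close>; \<open>\<mm>\<close>
    below is its maximal ideal.\<close>
  define \<O> where "\<O> = {Fract a b | a b. a \<in> A \<and> b \<in> A \<and> b \<notin> P}"
  define \<mm> where "\<mm> = {Fract a b | a b. a \<in> A \<and> b \<in> A \<and> a \<in> P \<and> b \<notin> P}"
  have OI: "Fract a b \<in> \<O>" if "a \<in> A" "b \<in> A" "b \<notin> P" for a b using that by (auto simp: \<O>_def)
  have mI: "Fract a b \<in> \<mm>" if "a \<in> A" "b \<in> A" "a \<in> P" "b \<notin> P" for a b using that by (auto simp: \<mm>_def)
  have o1: "1 \<in> A" "1 \<notin> P" using As(1) is_prime_simps(2)[OF P] by auto
  have O: "is_subring \<O>"
    unfolding is_subring_def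
  proof (intro conjI ballI)
    show "1 \<in> \<O>" unfolding One_fract_def using OI[OF o1(1) o1] .
    fix x y assume "x \<in> \<O>" "y \<in> \<O>"
    then obtain a b a' b' where xy: "x = Fract a b" "y = Fract a' b'" "a \<in> A" "b \<in> A" "b \<notin> P" "a' \<in> A" "b' \<in> A" "b' \<notin> P"
      by (auto simp: \<O>_def)
    have "x + y = Fract (a * b' + a' * b) (b * b')" "x * y = Fract (a * a') (b * b')" using xy nz by simp_all
    then show "x + y \<in> \<O>" "x * y \<in> \<O>" using xy by (auto simp: Pm intro!: OI As(3) As(4))
  next
    fix x assume "x \<in> \<O>"
    then show "- x \<in> \<O>" by (auto simp: \<O>_def) (metis As(5))
  qed
  note Os = is_subring_simps[OF O]
  have madd: "x + y \<in> \<mm>" if xy: "x \<in> \<mm>" "y \<in> \<mm>" for x y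
  proof -
    obtain a b a' b' where *: "x = Fract a b" "y = Fract a' b'" "a \<in> A" "b \<in> A" "b \<notin> P" "a' \<in> A" "b' \<in> A" "b' \<notin> P" "a \<in> P" "a' \<in> P"
      using xy by (auto simp: \<mm>_def)
    have "x + y = Fract (a * b' + a' * b) (b * b')" using * nz by simp
    then show ?thesis using * by (auto simp: Pm intro!: mI As(3) As(4) Pi(2) Pi(4))
  qed
  have mmult: "x * y \<in> \<mm>" if xy: "x \<in> \<O>" "y \<in> \<mm>" for x y
  proof -
    obtain a b a' b' where *: "x = Fract a b" "y = Fract a' b'" "a \<in> A" "b \<in> A" "b \<notin> P" "a' \<in> A" "b' \<in> A" "b' \<notin> P" "a' \<in> P"
      using xy by (auto simp: \<mm>_def \<O>_def)
    have "x * y = Fract (a * a') (b * b')" using * nz by simp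
    then show ?thesis using * by (auto simp: Pm intro!: mI As(4))
  qed
  have m1: "1 \<notin> \<mm>"
  proof
    assume "1 \<in> \<mm>"
    then obtain a b where *: "Fract 1 1 = Fract a b" "a \<in> P" "b \<notin> P" by (auto simp: \<mm>_def One_fract_def)
    then have "a = b" using nz[of b] by (simp add: eq_fract)
    then show False using * by simp
  qed
  define dF where "dF = fract_deriv \<delta> q"
  have dF: "is_deriv dF" unfolding dF_def by (rule is_deriv_fract_deriv[OF d q0])
  have qA: "q \<in> A" using q by (simp add: A_def)
  have dO: "dF x \<in> \<O>" if x: "x \<in> \<O>" for x
  proof -
    obtain a b where *: "x = Fract a b" "a \<in> A" "b \<in> A" "b \<notin> P" using x by (auto simp: \<O>_def)
    then have "dF x = Fract (\<delta> a * b - a * \<delta> b) (b * b * q)" unfolding dF_def using F nz by simp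
    then show ?thesis using * q qA by (auto simp: Pm intro!: OI As(6) As(4) \<delta>A)
  qed
  have dm: "dF x \<in> \<mm>" if x: "x \<in> \<mm>" for x
  proof -
    obtain a b where *: "x = Fract a b" "a \<in> A" "b \<in> A" "a \<in> P" "b \<notin> P" using x by (auto simp: \<mm>_def)
    then have "dF x = Fract (\<delta> a * b - a * \<delta> b) (b * b * q)" unfolding dF_def using F nz by simp
    moreover have "\<delta> a \<in> P" using closed * by (simp add: A_def \<delta>_def)
    ultimately show ?thesis using * q qA by (auto simp: Pm intro!: mI As(6) As(4) \<delta>A Pi(6) Pi(4))
  qed
  define \<iota> where "\<iota> = (\<lambda>a :: nat mpoly. Fract a 1)"
  have hi: "is_hom \<iota>" unfolding \<iota>_def by (rule is_hom_Fract_1)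
  have di: "dF (\<iota> a) = Fract (\<delta> a) q" for a
    unfolding \<iota>_def dF_def by (subst F) (auto simp: is_deriv_simps[OF d])
  have hc: "is_hom (\<lambda>c. \<iota> (Const c))" by (rule is_hom_comp[OF hi is_hom_Const])
  \<comment> \<open>A derivative of order p of an indeterminate goes to the p-th derivative of its
    coordinate function, so \<open>\<Psi>\<close> commutes with the derivations.\<close>
  define \<Psi> where "\<Psi> = mhom (\<lambda>c. \<iota> (Const c)) (\<lambda>w. (dF ^^ snd w) (\<iota> (Var (var_index n w))))"
  have h\<Psi>: "is_hom \<Psi>" unfolding \<Psi>_def by (rule is_hom_mhom[OF hc])
  note \<Psi>s = is_hom_simps[OF h\<Psi>]
  have \<Psi>C: "\<Psi> (Const c) = \<iota> (Const c)" for c by (simp add: \<Psi>_def mhom_Const[OF hc])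
  have \<Psi>V: "\<Psi> (Var w) = (dF ^^ snd w) (\<iota> (Var (var_index n w)))" for w by (simp add: \<Psi>_def mhom_Var[OF hc])
  have \<Psi>d: "\<Psi> (dderiv p) = dF (\<Psi> p)" for p
    using subset_UNIV[of "mvars p"]
  proof (induction p rule: mpoly_induct)
    case (Const c)
    show ?case by (simp add: dderiv_eq_dext \<Psi>s \<Psi>C di \<delta>_def fract_collapse q0)
  next
    case (Var w)
    show ?case by (simp add: dderiv_eq_dext \<Psi>V shift_var_def var_index_def)
  qed (simp_all add: is_deriv_simps[OF is_deriv_dderiv] is_deriv_simps[OF dF] \<Psi>s)
  have \<Psi>O: "\<Psi> p \<in> \<O>" if "p \<in> dring n m" for p
    unfolding \<Psi>_def
  proof (rule mhom_in_subring[OF that[unfolded dring_eq_polys_in] hc O])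
    have iO: "\<iota> a \<in> \<O>" if "a \<in> A" for a unfolding \<iota>_def using OI[OF that o1] .
    show "\<iota> (Const c) \<in> \<O>" for c by (intro iO) (simp add: A_def Const_in_polys_in)
    fix w assume "w \<in> dvars n m"
    then have "Var (var_index n w) \<in> A" unfolding A_def
      by (intro Var_in_polys_in) (auto simp: dvars_def var_index_def N)
    then have "\<iota> (Var (var_index n w)) \<in> \<O>" by (rule iO)
    then have "(dF ^^ k) (\<iota> (Var (var_index n w))) \<in> \<O>" for k by (induction k) (auto intro: dO)
    then show "(dF ^^ snd w) (\<iota> (Var (var_index n w))) \<in> \<O>" .
  qed
  have \<Psi>base: "\<Psi> p = \<iota> (sb (\<lambda>w. Var (var_index n w)) p)" if p: "p \<in> polys_in (base_vars n m)" for p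
  proof (rule hom_eq_on_polys_in[where g=\<Psi> and h="\<lambda>p. \<iota> (sb (\<lambda>w. Var (var_index n w)) p)" and X="base_vars n m"])
    show "\<Psi> (Var w) = \<iota> (sb (\<lambda>w. Var (var_index n w)) (Var w))" if "w \<in> base_vars n m" for w
      using that by (auto simp: \<Psi>V sb_simps base_vars_def)
  qed (simp_all only: p h\<Psi> is_hom_comp[OF hi is_hom_sb] \<Psi>C sb_simps)
  have base_d: "p \<in> dring n m" if "p \<in> polys_in (base_vars n m)" for p
    using that by (auto simp: dring_def polys_in_def base_vars_def dvars_def)
  \<comment> \<open>The kernel of the composite into the residue field, expressed without that
    field.\<close>
  define I where "I = {p \<in> dring n m. \<Psi> p \<in> \<mm>}"
  have m0: "0 \<in> \<mm>" unfolding Zero_fract_def using mI[OF As(2) o1(1) Pi(1) o1(2)] .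
  note ds = polys_in_simps[where X="dvars n m", folded dring_eq_polys_in]
  have "is_diff_ideal n m I"
    unfolding is_diff_ideal_def I_def
    by (auto simp: \<Psi>s \<Psi>d m0 madd mmult \<Psi>O dm dderiv_in_dring ds)
  moreover have "ode_gens n fs gs \<subseteq> I"
  proof
    fix p assume "p \<in> ode_gens n fs gs"
    then consider j where "j < n" "p = Var (DX j, 1) - fs ! j" | "p \<in> set gs" by (auto simp: ode_gens_def)
    then show "p \<in> I"
    proof cases
      case 1
      have "Var (DX j, 1) \<in> dring n m" unfolding dring_eq_polys_in using 1 by (intro Var_in_polys_in) (auto simp: dvars_def)
      then have "p \<in> dring n m" unfolding 1(2) using base_d fs[OF 1(1)] by (intro ds(6)) auto
      moreover have "\<Psi> p = 0"
      proof -
        have "\<Psi> (Var (DX j, 1)) = dF (\<iota> (Var j))" by (simp add: \<Psi>V var_index_def)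
        also have "\<dots> = Fract (q * sb (\<lambda>w. Var (var_index n w)) (fs ! j)) q" using fs[OF 1(1)] by (simp add: di \<delta>_def)
        also have "\<dots> = \<iota> (sb (\<lambda>w. Var (var_index n w)) (fs ! j))" using q0 by (simp add: \<iota>_def eq_fract)
        also have "\<dots> = \<Psi> (fs ! j)" using \<Psi>base fs[OF 1(1)] by simp
        finally show ?thesis by (simp add: 1(2) \<Psi>s)
      qed
      ultimately show ?thesis using m0 by (simp add: I_def)
    next
      case 2
      have "sb (\<lambda>w. Var (var_index n w)) p \<in> A" unfolding A_def using gs[OF 2]
        by (intro sb_in[of _ "base_vars n m"]) (auto simp: base_vars_def var_index_def N intro!: Var_in_polys_in)
      then have "\<Psi> p \<in> \<mm>" using gs[OF 2] \<Psi>base[of p] mI[OF _ o1(1) _ o1(2)] by (simp add: \<iota>_def)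
      then show ?thesis using gs[OF 2] base_d by (simp add: I_def)
    qed
  qed
  moreover have "1 \<notin> I" using m1 by (simp add: I_def \<Psi>s)
  ultimately show ?thesis unfolding diff_ideal_gen_def by blast
qed

section \<open>Truncated differential ideals\<close>

lemma in_poly_ideal_gen:
  assumes "q \<in> polys_in A" "s \<in> S"
  shows "in_poly_ideal A S (q * s)"
  unfolding in_poly_ideal_def using assms
  by (intro exI[of _ "{s}"] exI[of _ "\<lambda>_. q"]) (auto simp: polys_in_def)

lemma in_poly_ideal_add:
  assumes "in_poly_ideal A S a" "in_poly_ideal A S b"
  shows "in_poly_ideal A S (a + b)"
proof -
  obtain F q where F: "finite F" "F \<subseteq> S" "\<forall>s\<in>F. mvars (q s) \<subseteq> A" "a = (\<Sum>s\<in>F. q s * s)"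
    using assms(1) by (auto simp: in_poly_ideal_def)
  obtain G r where G: "finite G" "G \<subseteq> S" "\<forall>s\<in>G. mvars (r s) \<subseteq> A" "b = (\<Sum>s\<in>G. r s * s)"
    using assms(2) by (auto simp: in_poly_ideal_def)
  define t where "t = (\<lambda>s. (if s \<in> F then q s else 0) + (if s \<in> G then r s else 0))"
  have "(\<Sum>s\<in>F \<union> G. t s * s) = (\<Sum>s\<in>F \<union> G. if s \<in> F then q s * s else 0) + (\<Sum>s\<in>F \<union> G. if s \<in> G then r s * s else 0)"
    unfolding sum.distrib[symmetric] by (intro sum.cong) (auto simp: t_def distrib_right)
  also have "\<dots> = a + b" using F G by (simp add: sum.If_cases Int_absorb1)
  finally have "a + b = (\<Sum>s\<in>F \<union> G. t s * s)" ..
  moreover have "t s \<in> polys_in A" if "s \<in> F \<union> G" for s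
    unfolding t_def using F(3) G(3) by (intro polys_in_simps(3)) (auto simp: polys_in_simps, auto simp: polys_in_def)
  ultimately show ?thesis unfolding in_poly_ideal_def using F G
    by (intro exI[of _ "F \<union> G"] exI[of _ t]) (auto simp: polys_in_def)
qed

lemma in_poly_ideal_mult:
  assumes "in_poly_ideal A S a" "r \<in> polys_in A"
  shows "in_poly_ideal A S (r * a)"
proof -
  obtain F q where F: "finite F" "F \<subseteq> S" "\<forall>s\<in>F. mvars (q s) \<subseteq> A" "a = (\<Sum>s\<in>F. q s * s)"
    using assms(1) by (auto simp: in_poly_ideal_def)
  have "mvars (r * q s) \<subseteq> A" if "s \<in> F" for s
    using F(3) that assms(2) mvars_mult[of r "q s"] by (auto simp: polys_in_def)
  then show ?thesis unfolding in_poly_ideal_def using F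
    by (intro exI[of _ F] exI[of _ "\<lambda>s. r * q s"]) (auto simp: sum_distrib_left mult.assoc)
qed

lemma in_poly_ideal_0: "in_poly_ideal A S 0"
  unfolding in_poly_ideal_def by (intro exI[of _ "{}"]) auto

lemma is_ideal_in_poly_ideal: "is_ideal {p. in_poly_ideal UNIV S p}"
  by (auto simp: is_ideal_def in_poly_ideal_0 in_poly_ideal_add in_poly_ideal_mult polys_in_UNIV)

text \<open>Setting all variables outside \<open>A\<close> to zero fixes \<open>p\<close> and the
  generators and moves the multipliers into the ring over \<open>A\<close>. Hence the prime can be
  sought in the ring with all variables.\<close>

lemma in_poly_ideal_restrict:
  assumes "in_poly_ideal UNIV S p" "S \<subseteq> polys_in A" "p \<in> polys_in A"
  shows "in_poly_ideal A S p"
proof -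
  obtain F q where F: "finite F" "F \<subseteq> S" "p = (\<Sum>s\<in>F. q s * s)" using assms(1) by (auto simp: in_poly_ideal_def)
  define \<zeta> where "\<zeta> = sb (\<lambda>v. if v \<in> A then Var v else 0 :: 'a mpoly)"
  have h: "is_hom \<zeta>" by (simp add: \<zeta>_def is_hom_sb)
  have id: "\<zeta> a = a" if "a \<in> polys_in A" for a
    by (rule hom_eq_on_polys_in[OF that h is_hom_id]) (auto simp: \<zeta>_def sb_simps)
  have z: "\<zeta> a \<in> polys_in A" for a
    unfolding \<zeta>_def by (rule sb_in[OF polys_in_UNIV]) (auto simp: Var_in_polys_in polys_in_simps)
  have "p = \<zeta> p" using id assms(3) by simp
  also have "\<dots> = (\<Sum>s\<in>F. \<zeta> (q s) * \<zeta> s)" unfolding F(3) by (simp only: is_hom_simps[OF h])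
  also have "\<dots> = (\<Sum>s\<in>F. \<zeta> (q s) * s)" using F(2) assms(2) by (intro sum.cong) (auto simp: id subset_iff)
  finally show ?thesis unfolding in_poly_ideal_def using F z
    by (intro exI[of _ F] exI[of _ "\<lambda>s. \<zeta> (q s)"]) (auto simp: polys_in_def)
qed

lemma funpow_dderiv_in_trunc_vars:
  "p \<in> polys_in (trunc_vars n m 0) \<Longrightarrow> (dderiv ^^ k) p \<in> polys_in (trunc_vars n m k)"
proof (induction k)
  case (Suc k)
  then have "(dderiv ^^ k) p \<in> polys_in (trunc_vars n m k)" by simp
  then have "dderiv ((dderiv ^^ k) p) \<in> polys_in (trunc_vars n m (Suc k))"
  proof (rule deriv_in_subring[OF _ is_deriv_dderiv is_subring_polys_in])
    show "polys_in (trunc_vars n m k) \<subseteq> polys_in (trunc_vars n m (Suc k))"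
      by (force simp: polys_in_def trunc_vars_def)
    show "dderiv (Const c) \<in> polys_in (trunc_vars n m (Suc k))" for c by (simp add: dderiv_eq_dext polys_in_simps)
    show "dderiv (Var v) \<in> polys_in (trunc_vars n m (Suc k))" if "v \<in> trunc_vars n m k" for v
      unfolding dderiv_eq_dext dext_Var using that
      by (intro Var_in_polys_in) (auto simp: trunc_vars_def shift_var_def)
  qed
  then show ?case by simp
qed simp

lemma polys_in_mono: "X \<subseteq> Y \<Longrightarrow> p \<in> polys_in X \<Longrightarrow> p \<in> polys_in Y"
  by (auto simp: polys_in_def)

lemma ode_gens_trunc_in:
  assumes "length fs = n" "\<forall>p\<in>set fs \<union> set gs. mvars p \<subseteq> base_vars n m"
  shows "ode_gens_trunc n fs gs L \<subseteq> polys_in (trunc_vars n m L)"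
proof
  fix s assume "s \<in> ode_gens_trunc n fs gs L"
  then obtain k p where s: "s = (dderiv ^^ k) p" "k \<le> L" and p: "p \<in> set gs \<or> (\<exists>j<n. p = Var (DX j, 1) - fs ! j)"
    by (auto simp: ode_gens_trunc_def)
  have b: "base_vars n m \<subseteq> trunc_vars n m 0" by (auto simp: base_vars_def trunc_vars_def)
  have "p \<in> polys_in (trunc_vars n m 0)"
    using p
  proof (elim disjE exE conjE)
    assume "p \<in> set gs"
    then show ?thesis using assms(2) b by (auto simp: polys_in_def)
  next
    fix j assume j: "j < n" "p = Var (DX j, 1) - fs ! j"
    then have "fs ! j \<in> set fs" using assms(1) by simp
    then have "fs ! j \<in> polys_in (trunc_vars n m 0)" using assms(2) b by (auto simp: polys_in_def)
    moreover have "Var (DX j, 1) \<in> polys_in (trunc_vars n m 0)" using j by (intro Var_in_polys_in) (auto simp: trunc_vars_def)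
    ultimately show ?thesis unfolding j(2) by (intro polys_in_simps(6))
  qed
  then have "s \<in> polys_in (trunc_vars n m k)" unfolding s(1) by (rule funpow_dderiv_in_trunc_vars)
  moreover have "trunc_vars n m k \<subseteq> trunc_vars n m L" using s(2) by (auto simp: trunc_vars_def)
  ultimately show "s \<in> polys_in (trunc_vars n m L)" using polys_in_mono by blast
qed

lemma trunc_imp_diff_ideal:
  assumes "in_poly_ideal (trunc_vars n m L) (ode_gens_trunc n fs gs L) 1"
  shows "1 \<in> diff_ideal_gen n m (ode_gens n fs gs)"
  unfolding diff_ideal_gen_def
proof (intro InterI, clarify)
  fix I assume I: "is_diff_ideal n m I" "ode_gens n fs gs \<subseteq> I"
  obtain F q where F: "finite F" "F \<subseteq> ode_gens_trunc n fs gs L" "\<forall>s\<in>F. mvars (q s) \<subseteq> trunc_vars n m L" "1 = (\<Sum>s\<in>F. q s * s)"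
    using assms by (auto simp: in_poly_ideal_def)
  have pw: "(dderiv ^^ k) p \<in> I" if "p \<in> I" for k p
    using that I(1) by (induction k) (auto simp: is_diff_ideal_def)
  have gen: "s \<in> I" if "s \<in> F" for s
  proof -
    obtain k p where "s = (dderiv ^^ k) p" "p \<in> ode_gens n fs gs"
      using subsetD[OF F(2) \<open>s \<in> F\<close>] unfolding ode_gens_trunc_def ode_gens_def by blast
    then show ?thesis using pw I(2) by blast
  qed
  have "trunc_vars n m L \<subseteq> dvars n m" by (auto simp: trunc_vars_def dvars_def)
  then have "q s \<in> dring n m" if "s \<in> F" for s using F(3) that by (auto simp: dring_def)
  then have qs: "q s * s \<in> I" if "s \<in> F" for s using that gen I(1) by (simp add: is_diff_ideal_def)
  have "(\<Sum>s\<in>G. q s * s) \<in> I" if "G \<subseteq> F" for G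
    using finite_subset[OF that F(1)] that
    by (induction G rule: finite_induct) (use I(1) qs in \<open>auto simp: is_diff_ideal_def\<close>)
  from this[OF subset_refl] show "1 \<in> I" by (simp only: F(4)[symmetric])
qed

lemma is_filtration_tot_le: "is_filtration (\<lambda>t. {a \<in> polys_in X. tot_le a t})"
  unfolding is_filtration_def
  by (auto simp: polys_in_simps tot_le_1 tot_le_diff tot_le_mult intro: tot_le_weaken)

text \<open>By contraposition: a prime above the truncated system gives an approximate trajectory,
  \<open>prime_from_order\<close> an exact variety, and a tangent field on it a proper differential
  ideal.\<close>

lemma truncated_differential_nullstellensatz:
  fixes n m D :: nat
  assumes fs: "length fs = n" and vars: "\<forall>p\<in>set fs \<union> set gs. mvars p \<subseteq> base_vars n m"
    and deg: "\<forall>p\<in>set fs \<union> set gs. total_degree p \<le> D" and D: "1 \<le> D"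
    and one: "1 \<in> diff_ideal_gen n m (ode_gens n fs gs)"
  defines "L \<equiv> order_bound (degree_bound (2 ^ (3 * (n + m) + 2)) D (n + m)) (n + m)"
  shows "in_poly_ideal (trunc_vars n m L) (ode_gens_trunc n fs gs L) 1"
proof (rule ccontr)
  assume not: "\<not> ?thesis"
  define N where "N = n + m"
  have "\<not> in_poly_ideal UNIV (ode_gens_trunc n fs gs L) 1"
    using in_poly_ideal_restrict[OF _ ode_gens_trunc_in[OF fs vars] polys_in_simps(1)] not by blast
  then obtain Q where Q: "is_prime Q" "{p. in_poly_ideal UNIV (ode_gens_trunc n fs gs L) p} \<subseteq> Q"
    using prime_avoiding[OF is_ideal_in_poly_ideal[of "ode_gens_trunc n fs gs L"], of "{1}"] by auto
  note Qi = is_ideal_simps[OF is_prime_simps(1)[OF Q(1)]]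
  have gQ: "s \<in> Q" if "s \<in> ode_gens_trunc n fs gs L" for s
    using in_poly_ideal_gen[OF polys_in_UNIV that, of 1] Q(2) by auto
  have char0: "of_nat k \<notin> Q" if k: "k > 0" for k
  proof
    assume "of_nat k \<in> Q"
    then have "Const (1 / of_nat k) * Const (of_nat k) \<in> Q" by (intro Qi(3)) (simp add: of_nat_eq_Const)
    moreover have "Const (1 / of_nat k) * Const (of_nat k) = (1 :: dvar mpoly)"
      using k by (simp add: Const_simps flip: Const_simps(4))
    ultimately show False using is_prime_simps(2)[OF Q(1)] by simp
  qed
  define W where "W = vge dderiv Q"
  have W: "is_val W" unfolding W_def by (rule is_val_vge[OF is_deriv_dderiv Q(1) char0])
  note Ws = is_val_simps[OF W]
  \<comment> \<open>Order at least \<open>L\<close> concerns the derivatives below \<open>L\<close>;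
    the truncation contains those up to \<open>L\<close>.\<close>
  have Wx: "W (Var (DX j, 1) - fs ! j) L" if "j < n" for j
    unfolding W_def vge_def
  proof (intro allI impI gQ)
    show "(dderiv ^^ i) (Var (DX j, 1) - fs ! j) \<in> ode_gens_trunc n fs gs L" if "i < L" for i
      unfolding ode_gens_trunc_def using \<open>j < n\<close> less_imp_le[OF that] by blast
  qed
  have Wg: "W g L" if "g \<in> set gs" for g
    unfolding W_def vge_def
  proof (intro allI impI gQ)
    show "(dderiv ^^ i) g \<in> ode_gens_trunc n fs gs L" if "i < L" for i
      unfolding ode_gens_trunc_def using \<open>g \<in> set gs\<close> less_imp_le[OF that] by blast
  qed
  \<comment> \<open>\<open>\<eta>\<close> numbers the indeterminates of order zero by
    \<open>0, ..., N - 1\<close>, and \<open>\<theta>\<close> is its inverse. The order function for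
    the coordinates is \<open>W\<close> after \<open>\<theta>\<close>.\<close>
  define \<eta> where "\<eta> = (sb (\<lambda>w. Var (var_index n w)) :: dvar mpoly \<Rightarrow> nat mpoly)"
  define bv where "bv = (\<lambda>l. if l < n then (DX l, 0) else (DU (l - n), 0) :: dvar)"
  define \<theta> where "\<theta> = sb (\<lambda>l. Var (bv l))"
  have h\<theta>: "is_hom \<theta>" by (simp add: \<theta>_def is_hom_sb)
  note \<theta>s = is_hom_simps[OF h\<theta>]
  have \<theta>V: "\<theta> (Var l) = Var (bv l)" and \<theta>C: "\<theta> (Const c) = Const c" for l c by (simp_all add: \<theta>_def sb_simps)
  have \<theta>\<eta>: "\<theta> (\<eta> f) = f" if "f \<in> polys_in (base_vars n m)" for f
  proof (rule hom_eq_on_polys_in[where g="\<lambda>f. \<theta> (\<eta> f)" and h="\<lambda>f. f" and X="base_vars n m"])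
    show "\<theta> (\<eta> (Var w)) = Var w" if "w \<in> base_vars n m" for w
      using that by (auto simp: \<eta>_def sb_simps \<theta>V bv_def base_vars_def var_index_def)
  qed (simp_all only: that is_hom_id \<eta>_def sb_simps \<theta>C is_hom_comp[OF h\<theta> is_hom_sb])
  have \<eta>in: "\<eta> f \<in> polys_in {..<N}" if "f \<in> polys_in (base_vars n m)" for f
    unfolding \<eta>_def using that
    by (rule sb_in) (auto simp: base_vars_def var_index_def N_def intro!: Var_in_polys_in)
  have \<eta>tot: "tot_le (\<eta> f) t" if "tot_le f t" for f t
    unfolding \<eta>_def using that by (rule tot_le_mhom) (simp add: tot_le_Var)
  have fin: "fs ! j \<in> polys_in (base_vars n m)" "tot_le (fs ! j) D" if "j < n" for j
    using vars deg nth_mem[of j fs] fs that by (auto simp: polys_in_def tot_le_total_degree[symmetric])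
  have gin: "g \<in> polys_in (base_vars n m)" "tot_le g D" if "g \<in> set gs" for g
    using vars deg that by (auto simp: polys_in_def tot_le_total_degree[symmetric])
  have "is_val (\<lambda>a. W (\<theta> a))" by (rule is_val_hom[OF W h\<theta>])
  from prime_from_order[OF this D, of N]
  obtain P J \<mu> \<tau> M where P: "is_prime P" and J: "finite (J :: nat set)" and DM: "D \<le> M" and \<tau>: "\<tau> \<le> order_bound (degree_bound (2 ^ (3 * N + 2)) D N) N"
    and PV': "\<forall>a\<in>polys_in {..<N}. a \<in> P \<longrightarrow> W (\<theta> a) (\<tau> + 1)"
    and VP': "\<forall>a\<in>polys_in {..<N}. tot_le a (2 ^ (N + 1) * M) \<longrightarrow> W (\<theta> a) \<tau> \<longrightarrow> a \<in> P"
    and \<mu>': "\<forall>j\<in>J. \<mu> j \<in> polys_in {..<N} \<and> \<mu> j \<in> P \<and> tot_le (\<mu> j) M"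
    and closed: "\<forall>d. is_deriv d \<longrightarrow> (\<forall>j\<in>J. d (\<mu> j) \<in> P) \<longrightarrow> (\<forall>a\<in>polys_in {..<N}. a \<in> P \<longrightarrow> d a \<in> P)"
    by blast
  note PV = PV'[rule_format] and VP = VP'[rule_format] and \<mu> = \<mu>'[rule_format]
  have \<tau>L: "\<tau> \<le> L" using \<tau> by (simp add: L_def N_def)
  define F where "F = (\<lambda>l. \<eta> (fs ! l))"
  \<comment> \<open>\<open>c\<close> is the Jacobian of the separable equations, \<open>b\<close>
    its product with the prescribed x-components. The u-columns carry the unknowns of the linear
    system that expresses tangency.\<close>
  define c where "c = (\<lambda>j l. pdv l (\<mu> j))"
  define b where "b = (\<lambda>j. \<Sum>l<n. c j l * F l)"
  define G where "G = (\<lambda>t. {a \<in> polys_in {..<N}. tot_le a t} :: nat mpoly set)"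
  have G: "is_filtration G" unfolding G_def by (rule is_filtration_tot_le)
  note Gs = is_filtration_simps[OF G]
  have UG: "a \<in> polys_in {..<N}" if "a \<in> (\<Union>t. G t)" for a using that by (auto simp: G_def)
  have cG: "c j l \<in> G M" if "j \<in> J" for j l
    using \<mu>[OF that] by (auto simp: c_def G_def intro: pdv_in_polys_in tot_le_pdv)
  have FG: "F l \<in> G D" if "l < n" for l using fin[OF that] \<eta>in \<eta>tot by (simp add: F_def G_def)
  have bG: "b j \<in> G (2 * M)" if "j \<in> J" for j
    unfolding b_def using cG[OF that] FG DM
    by (intro Gs(7) Gs(3)[OF _ Gs(6), of M D]) auto
  have cG2: "c j l \<in> G (2 * M)" if "j \<in> J" for j l using Gs(3)[OF _ cG[OF that]] by simp
  have split: "{..<N} = {..<n} \<union> {n..<N}" "{..<n} \<inter> {n..<N} = {}" by (auto simp: N_def)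
  have noalt: "\<not> (\<exists>y. (\<forall>j\<in>J. y j \<in> G ((2 ^ card {n..<N} - 1) * (2 * M))) \<and> (\<forall>u\<in>{n..<N}. (\<Sum>j\<in>J. y j * c j u) \<in> P) \<and>
            (\<Sum>j\<in>J. y j * b j) \<notin> P)"
  proof
    assume "\<exists>y. (\<forall>j\<in>J. y j \<in> G ((2 ^ card {n..<N} - 1) * (2 * M))) \<and> (\<forall>u\<in>{n..<N}. (\<Sum>j\<in>J. y j * c j u) \<in> P) \<and>
            (\<Sum>j\<in>J. y j * b j) \<notin> P"
    then obtain y where y: "\<And>j. j \<in> J \<Longrightarrow> y j \<in> G ((2 ^ card {n..<N} - 1) * (2 * M))"
      "\<And>u. u \<in> {n..<N} \<Longrightarrow> (\<Sum>j\<in>J. y j * c j u) \<in> P" "(\<Sum>j\<in>J. y j * b j) \<notin> P" by blast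
    \<comment> \<open>The degree of a certificate applied to \<open>b\<close>; it is the origin of
      the factor \<open>2 ^ (N + 1)\<close> in \<open>prime_from_order\<close>.\<close>
    have le: "(2 ^ card {n..<N} - 1) * (2 * M) + 2 * M \<le> 2 ^ (N + 1) * M"
    proof -
      have "(2 ^ card {n..<N} - 1) * (2 * M) + 2 * M = 2 ^ m * (2 * M)"
        by (simp add: N_def diff_mult_distrib)
      also have "\<dots> \<le> 2 ^ N * (2 * M)" by (intro mult_le_mono) (auto simp: N_def)
      finally show ?thesis by simp
    qed
    have "y j * b j \<in> G (2 ^ (N + 1) * M)" if "j \<in> J" for j
      using Gs(3)[OF le Gs(6)[OF y(1) bG]] that by blast
    then have yb: "(\<Sum>j\<in>J. y j * b j) \<in> G (2 ^ (N + 1) * M)" by (intro Gs(7))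
    let ?x = "\<lambda>l. dderiv (\<theta> (Var l))"
    have dmu: "dderiv (\<theta> (\<mu> j)) = (\<Sum>l<N. \<theta> (c j l) * ?x l)" if "j \<in> J" for j
      unfolding c_def using \<mu>[OF that]
      by (intro deriv_chain h\<theta> is_deriv_dderiv) (auto simp: \<theta>C dderiv_eq_dext)
    have \<theta>F: "\<theta> (F l) = fs ! l" if "l < n" for l using \<theta>\<eta> fin[OF that] by (simp add: F_def)
    have "(\<Sum>j\<in>J. \<theta> (y j) * dderiv (\<theta> (\<mu> j))) =
       (\<Sum>j\<in>J. \<Sum>l<n. \<theta> (y j) * (\<theta> (c j l) * ?x l)) + (\<Sum>j\<in>J. \<Sum>l\<in>{n..<N}. \<theta> (y j) * (\<theta> (c j l) * ?x l))"
      unfolding sum.distrib[symmetric]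
    proof (rule sum.cong)
      fix j assume j: "j \<in> J"
      show "\<theta> (y j) * dderiv (\<theta> (\<mu> j)) = (\<Sum>l<n. \<theta> (y j) * (\<theta> (c j l) * ?x l)) + (\<Sum>l\<in>{n..<N}. \<theta> (y j) * (\<theta> (c j l) * ?x l))"
        unfolding dmu[OF j] split(1) by (subst sum.union_disjoint) (auto simp: distrib_left sum_distrib_left)
    qed simp
    moreover have "(\<Sum>j\<in>J. \<Sum>l\<in>{n..<N}. \<theta> (y j) * (\<theta> (c j l) * ?x l)) = (\<Sum>l\<in>{n..<N}. \<theta> (\<Sum>j\<in>J. y j * c j l) * ?x l)"
      by (subst sum.swap) (simp add: \<theta>s sum_distrib_right mult.assoc)
    moreover have "\<theta> (\<Sum>j\<in>J. y j * b j) = (\<Sum>j\<in>J. \<Sum>l<n. \<theta> (y j) * (\<theta> (c j l) * fs ! l))"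
      by (simp add: \<theta>s b_def sum_distrib_left \<theta>F)
    moreover have "(\<Sum>j\<in>J. \<Sum>l<n. \<theta> (y j) * (\<theta> (c j l) * ?x l)) =
      (\<Sum>j\<in>J. \<Sum>l<n. \<theta> (y j) * (\<theta> (c j l) * fs ! l)) + (\<Sum>j\<in>J. \<Sum>l<n. (\<theta> (y j) * \<theta> (c j l)) * (?x l - fs ! l))"
      unfolding sum.distrib[symmetric] by (intro sum.cong refl) (simp add: algebra_simps)
    \<comment> \<open>Three groups of high order remain: derivatives of elements of
      \<open>P\<close>, u-columns killed modulo \<open>P\<close> by the certificate, and multiples
      of the equations \<open>x' - f\<close>.\<close>
    ultimately have eq: "\<theta> (\<Sum>j\<in>J. y j * b j) = (\<Sum>j\<in>J. \<theta> (y j) * dderiv (\<theta> (\<mu> j))) -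
        (\<Sum>l\<in>{n..<N}. \<theta> (\<Sum>j\<in>J. y j * c j l) * ?x l) - (\<Sum>j\<in>J. \<Sum>l<n. (\<theta> (y j) * \<theta> (c j l)) * (?x l - fs ! l))"
      by simp
    have "W (\<theta> (\<Sum>j\<in>J. y j * b j)) \<tau>"
      unfolding eq
    proof (intro Ws(8) Ws(9))
      show "W (\<theta> (y j) * dderiv (\<theta> (\<mu> j))) \<tau>" if "j \<in> J" for j
        using vge_deriv[of dderiv Q "\<theta> (\<mu> j)" \<tau>] PV[of "\<mu> j"] \<mu>[OF that] by (intro Ws(2)) (simp add: W_def)
      show "W (\<theta> (\<Sum>j\<in>J. y j * c j l) * ?x l) \<tau>" if l: "l \<in> {n..<N}" for l
      proof (intro Ws(3))
        have "(\<Sum>j\<in>J. y j * c j l) \<in> polys_in {..<N}"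
          using y(1) cG by (intro polys_in_simps(8) polys_in_simps(4)) (auto simp: G_def)
        then show "W (\<theta> (\<Sum>j\<in>J. y j * c j l)) \<tau>" using Ws(5)[OF PV[OF _ y(2)[OF l]], of \<tau>] by simp
      qed
      show "W ((\<theta> (y j) * \<theta> (c j l)) * (?x l - fs ! l)) \<tau>" if "l \<in> {..<n}" for j l
      proof (intro Ws(2))
        have "?x l = Var (DX l, 1)" using that by (simp add: \<theta>V bv_def dderiv_eq_dext shift_var_def)
        then show "W (?x l - fs ! l) \<tau>" using Ws(5)[OF Wx \<tau>L] that by simp
      qed
    qed
    then have "(\<Sum>j\<in>J. y j * b j) \<in> P" using VP yb by (simp add: G_def)
    then show False using y(3) by simp
  qed
  have "(\<exists>q a. q \<notin> P \<and> q \<in> (\<Union>t. G t) \<and> (\<forall>u\<in>{n..<N}. a u \<in> (\<Union>t. G t)) \<and>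
      (\<forall>j\<in>J. (\<Sum>u\<in>{n..<N}. c j u * a u) + q * b j \<in> P)) \<or>
    (\<exists>y. (\<forall>j\<in>J. y j \<in> G ((2 ^ card {n..<N} - 1) * (2 * M))) \<and> (\<forall>u\<in>{n..<N}. (\<Sum>j\<in>J. y j * c j u) \<in> P) \<and>
      (\<Sum>j\<in>J. y j * b j) \<notin> P)"
    by (rule fredholm_alternative[OF finite_atLeastLessThan J G P]) (rule bG cG2, assumption)+
  then obtain q a where "q \<notin> P \<and> q \<in> (\<Union>t. G t) \<and> (\<forall>u\<in>{n..<N}. a u \<in> (\<Union>t. G t)) \<and>
      (\<forall>j\<in>J. (\<Sum>u\<in>{n..<N}. c j u * a u) + q * b j \<in> P)"
    using noalt by blast
  then have q: "q \<notin> P" "q \<in> (\<Union>t. G t)" "\<And>u. u \<in> {n..<N} \<Longrightarrow> a u \<in> (\<Union>t. G t)"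
    "\<And>j. j \<in> J \<Longrightarrow> (\<Sum>u\<in>{n..<N}. c j u * a u) + q * b j \<in> P"
    by blast+
  \<comment> \<open>The tangent field, with denominator \<open>q\<close> cleared: prescribed in the
    x-directions, solved for in the u-directions.\<close>
  define \<alpha> where "\<alpha> = (\<lambda>l. if l < n then q * F l else if l < N then a l else 0)"
  have qin: "q \<in> polys_in {..<N}" using UG q(2) by blast
  have \<alpha>in: "\<alpha> l \<in> polys_in {..<N}" for l
  proof -
    have "F l \<in> polys_in {..<N}" if "l < n" using FG[OF that] by (simp add: G_def)
    moreover have "a l \<in> polys_in {..<N}" if "n \<le> l" "l < N" using UG q(3) that by auto
    ultimately show ?thesis using qin by (auto simp: \<alpha>_def polys_in_simps)
  qed
  have "dext \<alpha> (\<mu> j) \<in> P" if j: "j \<in> J" for j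
  proof -
    have "dext \<alpha> (\<mu> j) = (\<Sum>l<N. c j l * \<alpha> l)"
      using deriv_chain[of "\<mu> j" "{..<N}" "\<lambda>x. x" "dext \<alpha>"] \<mu>[OF j] by (simp add: is_hom_id is_deriv_dext c_def)
    also have "\<dots> = (\<Sum>l<n. c j l * \<alpha> l) + (\<Sum>l\<in>{n..<N}. c j l * \<alpha> l)"
      unfolding split(1) by (rule sum.union_disjoint) auto
    also have "(\<Sum>l<n. c j l * \<alpha> l) = q * b j"
      unfolding b_def sum_distrib_left by (intro sum.cong) (auto simp: \<alpha>_def algebra_simps)
    also have "(\<Sum>l\<in>{n..<N}. c j l * \<alpha> l) = (\<Sum>l\<in>{n..<N}. c j l * a l)"
      by (intro sum.cong) (auto simp: \<alpha>_def)
    finally show ?thesis using q(4)[OF j] by (simp add: add.commute)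
  qed
  then have cl: "dext \<alpha> x \<in> P" if "x \<in> polys_in {..<N}" "x \<in> P" for x
    using closed[rule_format, OF is_deriv_dext _ that] by blast
  have "1 \<notin> diff_ideal_gen n m (ode_gens n fs gs)"
  proof (rule proper_diff_ideal[OF P N_def qin q(1) \<alpha>in cl])
    show "fs ! j \<in> polys_in (base_vars n m) \<and> \<alpha> j = q * sb (\<lambda>w. Var (var_index n w)) (fs ! j)" if "j < n" for j
      using fin[OF that] that by (simp add: \<alpha>_def F_def \<eta>_def)
    show "g \<in> polys_in (base_vars n m) \<and> sb (\<lambda>w. Var (var_index n w)) g \<in> P" if g: "g \<in> set gs" for g
    proof -
      have "M \<le> 2 ^ (N + 1) * M" by simp
      then have "tot_le (\<eta> g) (2 ^ (N + 1) * M)" using tot_le_weaken[OF \<eta>tot[OF gin(2)[OF g]]] DM by (meson order_trans)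
      moreover have "W (\<theta> (\<eta> g)) \<tau>" using Ws(5)[OF Wg[OF g] \<tau>L] \<theta>\<eta>[OF gin(1)[OF g]] by simp
      ultimately have "\<eta> g \<in> P" using VP \<eta>in[OF gin(1)[OF g]] by blast
      then show ?thesis using gin(1)[OF g] by (simp add: \<eta>_def)
    qed
  qed
  then show False using one by simp
qed

section \<open>Bounds and degenerate cases\<close>

text \<open>With the extra factor \<open>K\<close> the recursion is at most a fourth power, since
  \<open>K ^ 2 \<le> K ^ 4\<close>.\<close>

lemma degree_bound_le: "1 \<le> K \<Longrightarrow> K * degree_bound K D i \<le> (K * D) ^ (4 ^ i)"
proof (induction i)
  case (Suc i)
  have "K * degree_bound K D (Suc i) = K ^ 2 * degree_bound K D i ^ 4" by (simp add: power2_eq_square)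
  also have "\<dots> \<le> K ^ 4 * degree_bound K D i ^ 4" using Suc.prems by (intro mult_le_mono1 power_increasing) auto
  also have "\<dots> = (K * degree_bound K D i) ^ 4" by (simp add: power_mult_distrib)
  also have "\<dots> \<le> ((K * D) ^ (4 ^ i)) ^ 4" using Suc by (intro power_mono) auto
  also have "\<dots> = (K * D) ^ (4 ^ Suc i)" by (simp flip: power_mult add: mult.commute)
  finally show ?case .
qed simp

text \<open>The factor \<open>3\<close> absorbs both additive terms of the recursion, since
  \<open>X\<close> and \<open>order_bound X i\<close> are at least \<open>1\<close>.\<close>

lemma order_bound_le: "1 \<le> X \<Longrightarrow> order_bound X i \<le> (3 * X) ^ i"
proof (induction i)
  case (Suc i)
  have "X * 1 \<le> X * order_bound X i" "1 * 1 \<le> X * order_bound X i" using order_bound_ge_1[of X i] Suc.prems by (intro mult_le_mono; simp)+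
  moreover have "order_bound X (Suc i) = X * order_bound X i + X * 1 + 1 * 1" "3 * X * order_bound X i = X * order_bound X i + X * order_bound X i + X * order_bound X i"
    by (simp_all add: algebra_simps)
  ultimately have "order_bound X (Suc i) \<le> 3 * X * order_bound X i" by linarith
  also have "\<dots> \<le> 3 * X * (3 * X) ^ i" using Suc by (intro mult_le_mono) auto
  finally show ?case by simp
qed simp

text \<open>A base \<open>N * D\<close> of at least \<open>2\<close> absorbs the numerical
  constants, through \<open>2 \<le> b\<close> and \<open>3 \<le> b ^ 2\<close>.\<close>

lemma truncation_order_le:
  fixes N D :: nat
  assumes "2 \<le> N * D"
  shows "order_bound (degree_bound (2 ^ (3 * N + 2)) D N) N \<le> (N * D) ^ (2 ^ (7 * N))"
proof -
  define b where "b = N * D"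
  define K where "K = (2 :: nat) ^ (3 * N + 2)"
  define X where "X = degree_bound K D N"
  have b2: "2 \<le> b" using assms by (simp add: b_def)
  have N: "1 \<le> N" using assms by (cases N) auto
  have D: "1 \<le> D" using assms by (cases D) auto
  have K1: "1 \<le> K" by (simp add: K_def)
  have X1: "1 \<le> X" using degree_bound_mono[OF K1 D, of N N] by (simp add: X_def)
  have "D \<le> b" using N by (simp add: b_def)
  then have "K * D \<le> b ^ (3 * N + 2) * b" unfolding K_def using b2 by (intro mult_le_mono power_mono) auto
  also have "\<dots> = b ^ (3 * N + 3)" by (simp add: power_add power3_eq_cube power2_eq_square)
  finally have KD: "K * D \<le> b ^ (3 * N + 3)" .
  have "X \<le> K * X" using K1 by simp
  also have "\<dots> \<le> (K * D) ^ (4 ^ N)" unfolding X_def by (rule degree_bound_le[OF K1])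
  also have "\<dots> \<le> (b ^ (3 * N + 3)) ^ (4 ^ N)" using KD by (intro power_mono) auto
  finally have X: "X \<le> b ^ ((3 * N + 3) * 4 ^ N)" by (simp only: power_mult)
  have "3 \<le> b ^ 2" using power_mono[OF b2, of 2] by simp
  then have "3 * X \<le> b ^ (2 + (3 * N + 3) * 4 ^ N)" using X unfolding power_add by (intro mult_le_mono)
  then have "(3 * X) ^ N \<le> (b ^ (2 + (3 * N + 3) * 4 ^ N)) ^ N" by (intro power_mono) auto
  then have "order_bound X N \<le> b ^ ((2 + (3 * N + 3) * 4 ^ N) * N)"
    using order_bound_le[OF X1, of N] by (simp only: power_mult[symmetric])
  also have "\<dots> \<le> b ^ (2 ^ (7 * N))"
  proof (rule power_increasing)
    \<comment> \<open>Replacing linear factors in \<open>N\<close> by \<open>2 ^ N\<close> bounds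
      the exponent by \<open>2 ^ (4 * N + 3)\<close>, and \<open>4 * N + 3 \<le> 7 * N\<close>
      because \<open>N\<close> is positive.\<close>
    have n1: "N + 1 \<le> 2 ^ N" using less_exp[of N] by (simp add: Suc_le_eq)
    have "2 + (3 * N + 3) * 4 ^ N \<le> 2 * 2 ^ N * 4 ^ N + 4 * 2 ^ N * (4 ^ N :: nat)"
    proof (rule add_mono)
      have "(1::nat) * 1 \<le> 2 ^ N * 4 ^ N" by (intro mult_le_mono) auto
      then show "2 \<le> 2 * 2 ^ N * (4 ^ N :: nat)" by simp
      show "(3 * N + 3) * 4 ^ N \<le> 4 * 2 ^ N * (4 ^ N :: nat)" using n1 by (intro mult_le_mono) auto
    qed
    also have "\<dots> \<le> 8 * 2 ^ N * 4 ^ N" by simp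
    finally have "(2 + (3 * N + 3) * 4 ^ N) * N \<le> 8 * 2 ^ N * 4 ^ N * 2 ^ N"
      using n1 by (intro mult_le_mono) auto
    also have "\<dots> = 2 ^ (4 * N + 3)"
    proof -
      have "(4::nat) ^ N = 2 ^ N * 2 ^ N" by (simp flip: power_mult_distrib)
      moreover have "(2::nat) ^ (4 * N + 3) = 2 ^ (N + N + N + N + 3)" by (simp add: algebra_simps)
      ultimately show ?thesis by (simp only: power_add) simp
    qed
    also have "\<dots> \<le> 2 ^ (7 * N)" using N by (intro power_increasing) auto
    finally show "(2 + (3 * N + 3) * 4 ^ N) * N \<le> 2 ^ (7 * N)" .
  qed (use b2 in simp)
  finally show ?thesis by (simp add: X_def K_def b_def)
qed

text \<open>\<open>e\<close> is a jet that solves the system to every order; by Leibniz the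
  polynomials all of whose derivatives vanish at \<open>e\<close> form a differential ideal.\<close>

lemma diff_ideal_proper_of_point:
  fixes e :: "dvar \<Rightarrow> complex"
  assumes "\<forall>s\<in>ode_gens n fs gs. s \<in> dring n m \<and> (\<forall>k. mhom (\<lambda>c. c) e ((dderiv ^^ k) s) = 0)"
  shows "1 \<notin> diff_ideal_gen n m (ode_gens n fs gs)"
proof -
  define I where "I = {p \<in> dring n m. \<forall>k. mhom (\<lambda>c. c) e ((dderiv ^^ k) p) = 0}"
  note ds = polys_in_simps[where X="dvars n m", folded dring_eq_polys_in]
  note es = is_hom_simps[OF is_hom_mhom[OF is_hom_id], of e]
  have z: "(dderiv ^^ k) 0 = 0" for k by (induction k) (auto simp: is_deriv_simps[OF is_deriv_dderiv])
  have "is_diff_ideal n m I"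
    unfolding is_diff_ideal_def
  proof (intro conjI ballI)
    show "I \<subseteq> dring n m" by (auto simp: I_def)
    show "0 \<in> I" by (simp add: I_def z es ds)
    show "a + b \<in> I" if "a \<in> I" "b \<in> I" for a b
      using that by (simp add: I_def is_deriv_funpow_add[OF is_deriv_dderiv] es ds)
    show "r * a \<in> I" if "r \<in> dring n m" "a \<in> I" for r a
      using that by (simp add: I_def is_deriv_Leibniz[OF is_deriv_dderiv] es ds)
    show "dderiv a \<in> I" if "a \<in> I" for a
    proof -
      have "mhom (\<lambda>c. c) e ((dderiv ^^ k) (dderiv a)) = 0" for k
        using that funpow_swap1[of dderiv k a] by (simp add: I_def) (metis funpow.simps(2) o_apply)
      then show ?thesis using that by (simp add: I_def dderiv_in_dring)
    qed
  qed
  moreover have "ode_gens n fs gs \<subseteq> I" using assms by (auto simp: I_def)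
  moreover have "1 \<notin> I" unfolding I_def by (auto simp: es intro: exI[of _ 0])
  ultimately show ?thesis unfolding diff_ideal_gen_def by blast
qed

lemma funpow_dderiv_Var: "(dderiv ^^ k) (Var (x, i)) = Var (x, i + k)"
  by (induction k) (auto simp: dderiv_eq_dext shift_var_def)

lemma funpow_dderiv_Const: "(dderiv ^^ k) (Const c) = (if k = 0 then Const c else 0)"
proof (induction k)
  case (Suc k)
  then show ?case by (cases k) (auto simp: dderiv_eq_dext is_deriv_simps[OF is_deriv_dext])
qed simp

lemma funpow_dderiv_affine:
  "(dderiv ^^ k) (Const a + Const b * Var (x, i)) = (if k = 0 then Const a else 0) + Const b * Var (x, i + k)"
proof -
  have "(dderiv ^^ k) (Const b * p) = Const b * (dderiv ^^ k) p" for p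
    by (induction k) (auto simp: dderiv_eq_dext is_deriv_simps[OF is_deriv_dext])
  then show ?thesis by (simp add: is_deriv_funpow_add[OF is_deriv_dderiv] funpow_dderiv_Const funpow_dderiv_Var)
qed

lemma funpow_dderiv_diff: "(dderiv ^^ k) (p - q) = (dderiv ^^ k) p - (dderiv ^^ k) q"
  by (induction k) (auto simp: is_deriv_simps[OF is_deriv_dderiv])

lemma tot_le_0_Const: "tot_le p 0 \<Longrightarrow> \<exists>c. p = Const c"
proof -
  assume "tot_le p 0"
  then have "p \<in> polys_in {}"
    by (intro polys_inI) (metis lookup_le_tdeg le_zero_eq tot_le_def)
  then show ?thesis by (rule polys_in_empty)
qed

lemma tot_le_1_affine:
  assumes "p \<in> polys_in {v}" "tot_le p 1"
  shows "\<exists>a b. p = Const a + Const b * Var v"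
proof -
  have "\<alpha> = single v (lookup \<alpha> v) \<and> lookup \<alpha> v \<le> 1"
    if "\<alpha> \<in> keys p" for \<alpha>
  proof
    show "\<alpha> = single v (lookup \<alpha> v)"
      using lookup_eq_0_polys_in[OF assms(1) that]
      by (intro poly_mapping_eqI) (auto simp: lookup_single when_def)
    show "lookup \<alpha> v \<le> 1"
      using assms(2) that lookup_le_tdeg[of \<alpha> v] by (auto simp: tot_le_def intro: order_trans)
  qed
  then have sub: "keys p \<subseteq> {0, single v 1}"
    by (metis (no_types, lifting) insertCI le_SucE le_zero_eq One_nat_def single_zero subsetI)
  have ne: "(0 :: 'a \<Rightarrow>\<^sub>0 nat) \<noteq> single v 1"
    by (metis lookup_single_eq lookup_zero zero_neq_one)
  have "p = (\<Sum>\<alpha>\<in>keys p. Const (lookup p \<alpha>) * pmon \<alpha>)" by (simp add: sum_keys_pmon)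
  also have "\<dots> = (\<Sum>\<alpha>\<in>{0, single v 1}. Const (lookup p \<alpha>) * pmon \<alpha>)"
    using sub by (intro sum.mono_neutral_left) (auto simp: in_keys_iff Const_simps)
  also have "\<dots> = Const (lookup p 0) + Const (lookup p (single v 1)) * Var v"
    using ne by (simp add: pmon_0 pmon_single[of v 1, simplified])
  finally show ?thesis by blast
qed

text \<open>For \<open>D = 0\<close> the bound on \<open>L\<close> is \<open>0\<close>, too small
  for the general estimate. But then \<open>f\<close> is constant, \<open>g\<close> is zero on
  account of the common zero, and the system has a solution.\<close>

lemma degree_zero_case:
  assumes "length fs = n" "variety n m gs \<noteq> {}" "\<forall>p\<in>set fs \<union> set gs. total_degree p \<le> 0"
  shows "1 \<notin> diff_ideal_gen n m (ode_gens n fs gs)"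
proof -
  have c: "\<exists>c. p = Const c" if "p \<in> set fs \<union> set gs" for p
    using assms(3) that tot_le_0_Const[of p] by (simp only: tot_le_total_degree)
  then have "\<exists>c. fs ! j = Const c" if "j < n" for j using that assms(1) by simp
  then obtain \<phi> where \<phi>: "\<And>j. j < n \<Longrightarrow> fs ! j = Const (\<phi> j)" by metis
  obtain z where z: "z \<in> variety n m gs" using assms(2) by blast
  have g0: "g = 0" if "g \<in> set gs" for g
  proof -
    obtain x where "g = Const x" using c \<open>g \<in> set gs\<close> by blast
    then show ?thesis using z \<open>g \<in> set gs\<close>
      by (auto simp: variety_def eval_mpoly_eq_mhom mhom_Const[OF is_hom_id] Const_simps)
  qed
  \<comment> \<open>The jet of the solution with \<open>x_j = \<phi> j * t\<close> and
    \<open>u = 0\<close>.\<close>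
  define e :: "dvar \<Rightarrow> complex" where "e = (\<lambda>w. case w of (DX j, i) \<Rightarrow> if i = 1 then \<phi> j else 0 | _ \<Rightarrow> 0)"
  have e: "e (DX j, i) = (if i = 1 then \<phi> j else 0)" for j i by (simp add: e_def)
  note es = is_hom_simps[OF is_hom_mhom[OF is_hom_id], of e]
  note ds = polys_in_simps[where X="dvars n m", folded dring_eq_polys_in]
  have z: "(dderiv ^^ k) 0 = 0" for k by (induction k) (auto simp: is_deriv_simps[OF is_deriv_dderiv])
  show ?thesis
  proof (rule diff_ideal_proper_of_point[where e=e], intro ballI)
    fix s assume "s \<in> ode_gens n fs gs"
    then consider j where "j < n" "s = Var (DX j, 1) - Const (\<phi> j)" | "s = 0"
      using \<phi> g0 by (auto simp: ode_gens_def)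
    then show "s \<in> dring n m \<and> (\<forall>k. mhom (\<lambda>c. c) e ((dderiv ^^ k) s) = 0)"
    proof cases
      case 1
      have "Var (DX j, 1) \<in> dring n m" unfolding dring_eq_polys_in using 1
        by (intro Var_in_polys_in) (auto simp: dvars_def)
      moreover have "Const (\<phi> j) \<in> dring n m" unfolding dring_eq_polys_in by (rule Const_in_polys_in)
      moreover have "mhom (\<lambda>c. c) e ((dderiv ^^ k) s) = 0" for k
        unfolding 1 by (simp add: funpow_dderiv_diff funpow_dderiv_Var funpow_dderiv_Const es
            mhom_Var[OF is_hom_id] mhom_Const[OF is_hom_id] e)
      ultimately show "s \<in> dring n m \<and> (\<forall>k. mhom (\<lambda>c. c) e ((dderiv ^^ k) s) = 0)" using 1 by (simp add: ds)
    qed (simp add: z es ds)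
  qed
qed

text \<open>When \<open>(n + m) * D = 1\<close> the bound is \<open>1\<close>, whatever the
  exponent, so one differentiation must suffice. With one variable and affine equations this is
  checked by hand; \<open>\<sigma>\<close> below is the velocity at the common zero
  \<open>x0\<close>.\<close>

lemma one_variable_affine_case:
  assumes fs: "length fs = 1" and vars: "\<forall>p\<in>set fs \<union> set gs. mvars p \<subseteq> base_vars 1 0"
    and ne: "variety 1 0 gs \<noteq> {}" and deg: "\<forall>p\<in>set fs \<union> set gs. total_degree p \<le> 1"
    and one: "1 \<in> diff_ideal_gen 1 0 (ode_gens 1 fs gs)"
  shows "in_poly_ideal (trunc_vars 1 0 1) (ode_gens_trunc 1 fs gs 1) 1"
proof -
  define v where "v = (DX 0, 0 :: nat)"
  have bv: "base_vars 1 0 = {v}" by (auto simp: base_vars_def v_def)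
  have aff: "\<exists>a b. p = Const a + Const b * Var v" if "p \<in> set fs \<union> set gs" for p
    using vars deg that unfolding bv tot_le_total_degree by (intro tot_le_1_affine) (auto simp: polys_in_def)
  have "fs ! 0 \<in> set fs \<union> set gs" using fs by simp
  then obtain \<epsilon> \<gamma> where f: "fs ! 0 = Const \<epsilon> + Const \<gamma> * Var v" using aff by blast
  obtain z where z: "z \<in> variety 1 0 gs" using ne by blast
  define x0 where "x0 = z 0"
  have g: "\<exists>b. g = Const (- b * x0) + Const b * Var v" if "g \<in> set gs" for g
  proof -
    obtain a b where ab: "g = Const a + Const b * Var v" using aff \<open>g \<in> set gs\<close> by blast
    have "eval_mpoly g (coord_assign 1 z) = 0" using z \<open>g \<in> set gs\<close> by (simp add: variety_def)
    then have "a + b * x0 = 0"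
      by (simp add: ab eval_mpoly_eq_mhom is_hom_simps[OF is_hom_mhom[OF is_hom_id]] mhom_Const[OF is_hom_id]
          mhom_Var[OF is_hom_id] v_def coord_assign_def x0_def)
    then have "a = - b * x0" by (simp add: eq_neg_iff_add_eq_0)
    then show ?thesis using ab by blast
  qed
  define \<sigma> where "\<sigma> = \<epsilon> + \<gamma> * x0"
  show ?thesis
  proof (cases "\<sigma> = 0 \<or> set gs \<subseteq> {0}")
    case True
    \<comment> \<open>The jet of the solution of \<open>x' = \<epsilon> + \<gamma> * x\<close>
      starting at \<open>x0\<close>; it stays in the zero set if \<open>x0\<close> is stationary or
      there is no nontrivial constraint.\<close>
    define e where "e = (\<lambda>w :: dvar. if snd w = 0 then x0 else \<sigma> * \<gamma> ^ (snd w - 1))"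
    have e: "e (x, 0) = x0" "e (x, Suc i) = \<sigma> * \<gamma> ^ i" for x i by (simp_all add: e_def)
    note es = is_hom_simps[OF is_hom_mhom[OF is_hom_id], of e] mhom_Const[OF is_hom_id] mhom_Var[OF is_hom_id]
    note ds = polys_in_simps[where X="dvars 1 0", folded dring_eq_polys_in]
    have V: "Var (DX 0, i) \<in> dring 1 0" for i unfolding dring_eq_polys_in by (intro Var_in_polys_in) (auto simp: dvars_def)
    have C: "Const x \<in> dring 1 0" for x unfolding dring_eq_polys_in by (rule Const_in_polys_in)
    have "1 \<notin> diff_ideal_gen 1 0 (ode_gens 1 fs gs)"
    proof (rule diff_ideal_proper_of_point[where e=e], intro ballI)
      fix s assume "s \<in> ode_gens 1 fs gs"
      then consider "s = Var (DX 0, 1) - (Const \<epsilon> + Const \<gamma> * Var (DX 0, 0))"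
        | b where "s \<in> set gs" "s = Const (- b * x0) + Const b * Var (DX 0, 0)"
        using f g by (auto simp: ode_gens_def v_def)
      then show "s \<in> dring 1 0 \<and> (\<forall>k. mhom (\<lambda>c. c) e ((dderiv ^^ k) s) = 0)"
      proof cases
        case 1
        have "mhom (\<lambda>c. c) e ((dderiv ^^ k) s) = 0" for k
        proof (cases k)
          case 0
          then show ?thesis by (simp add: 1 es e) (simp add: \<sigma>_def)
        next
          case (Suc l)
          then show ?thesis unfolding 1 funpow_dderiv_diff funpow_dderiv_affine funpow_dderiv_Var
            by (simp add: es e)
        qed
        then show "s \<in> dring 1 0 \<and> (\<forall>k. mhom (\<lambda>c. c) e ((dderiv ^^ k) s) = 0)"
          unfolding 1 by (intro conjI allI ds(6) ds(3) ds(4) V C)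
      next
        case 2
        have b0: "b = 0 \<or> \<sigma> = 0"
        proof (cases "\<sigma> = 0")
          case False
          then have "s = 0" using True 2(1) by blast
          then have "Const (- b * x0) + Const b * Var (DX 0, 0 :: nat) = 0" using 2(2) by simp
          then have "mhom (\<lambda>c. c) (\<lambda>_. x0 + 1) (Const (- b * x0) + Const b * Var (DX 0, 0 :: nat)) = 0"
            by (simp only: is_hom_simps[OF is_hom_mhom[OF is_hom_id]])
          then show ?thesis
            by (simp add: is_hom_simps[OF is_hom_mhom[OF is_hom_id]] mhom_Const[OF is_hom_id] mhom_Var[OF is_hom_id] algebra_simps)
        qed simp
        have "mhom (\<lambda>c. c) e ((dderiv ^^ k) s) = 0" for k
          unfolding 2(2) funpow_dderiv_affine using b0 by (cases k) (auto simp: es e)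
        then show "s \<in> dring 1 0 \<and> (\<forall>k. mhom (\<lambda>c. c) e ((dderiv ^^ k) s) = 0)"
          unfolding 2(2) by (intro conjI allI ds(3) ds(4) V C)
      qed
    qed
    then show ?thesis using one by simp
  next
    case False
    then obtain g0 where g0: "g0 \<in> set gs" "g0 \<noteq> 0" and \<sigma>: "\<sigma> \<noteq> 0" by blast
    obtain b where b: "g0 = Const (- b * x0) + Const b * Var v" using g[OF g0(1)] by blast
    have b0: "b \<noteq> 0" using g0(2) b by (auto simp: Const_simps)
    let ?A = "trunc_vars 1 0 1" and ?S = "ode_gens_trunc 1 fs gs 1"
    let ?h = "Var (DX 0, 1) - fs ! 0"
    have m1: "g0 \<in> ?S" "dderiv g0 \<in> ?S" "?h \<in> ?S"
    proof -
      have "(dderiv ^^ 0) g0 \<in> ?S" "(dderiv ^^ 1) g0 \<in> ?S" unfolding ode_gens_trunc_def using g0(1) by blast+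
      moreover have "(dderiv ^^ 0) ?h \<in> ?S" unfolding ode_gens_trunc_def by blast
      ultimately show "g0 \<in> ?S" "dderiv g0 \<in> ?S" "?h \<in> ?S" by simp_all
    qed
    have dg: "dderiv g0 = Const b * Var (DX 0, 1)"
      using funpow_dderiv_affine[of 1 "- b * x0" b "DX 0" 0] by (simp add: b v_def)
    have cc: "Const x * Const y = Const (x * y)" for x y by (simp add: Const_simps)
    have 1: "Const (1 / (b * \<sigma>)) * dderiv g0 = Const (1 / \<sigma>) * Var (DX 0, 1)"
      unfolding dg mult.assoc[symmetric] cc using b0 by simp
    have 2: "Const (- (1 / \<sigma>)) * ?h = Const (1 / \<sigma>) * (Const \<epsilon> + Const \<gamma> * Var v) - Const (1 / \<sigma>) * Var (DX 0, 1)"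
      by (simp add: f is_hom_simps(5)[OF is_hom_Const] algebra_simps)
    have 3: "Const (- (\<gamma> / (b * \<sigma>))) * g0 = Const (\<gamma> * x0 / \<sigma>) - Const (\<gamma> / \<sigma>) * Var v"
      unfolding b distrib_left mult.assoc[symmetric] cc using b0 by (simp add: is_hom_simps(5)[OF is_hom_Const])
    \<comment> \<open>With \<open>g0 = b * (x - x0)\<close> the combination eliminates
      \<open>x'\<close> and then \<open>x\<close>; what is left is
      \<open>(\<epsilon> + \<gamma> * x0) / \<sigma> = 1\<close>.\<close>
    have "Const (1 / (b * \<sigma>)) * dderiv g0 + Const (- (1 / \<sigma>)) * ?h + Const (- (\<gamma> / (b * \<sigma>))) * g0 =
        Const (1 / \<sigma>) * Const \<epsilon> + Const (\<gamma> * x0 / \<sigma>) + (Const (1 / \<sigma>) * Const \<gamma> - Const (\<gamma> / \<sigma>)) * Var v"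
      unfolding 1 2 3 by (simp add: algebra_simps)
    also have "\<dots> = Const (1 / \<sigma> * \<epsilon> + \<gamma> * x0 / \<sigma>)" unfolding cc by (simp add: Const_simps)
    also have "1 / \<sigma> * \<epsilon> + \<gamma> * x0 / \<sigma> = 1" using \<sigma> by (simp add: add_divide_distrib[symmetric]) (simp add: \<sigma>_def)
    finally have "1 = Const (1 / (b * \<sigma>)) * dderiv g0 + Const (- (1 / \<sigma>)) * ?h + Const (- (\<gamma> / (b * \<sigma>))) * g0"
      by (simp add: Const_simps)
    moreover have "in_poly_ideal ?A ?S (Const (1 / (b * \<sigma>)) * dderiv g0 + Const (- (1 / \<sigma>)) * ?h + Const (- (\<gamma> / (b * \<sigma>))) * g0)"
      by (intro in_poly_ideal_add in_poly_ideal_gen Const_in_polys_in m1)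
    ultimately show ?thesis by simp
  qed
qed

theorem theorem4p1:
  shows "\<exists>c::real. c > 0 \<and>
    (\<forall>(n::nat) (m::nat) (fs :: dvar mpoly list) (gs :: dvar mpoly list) (D::nat).
      n \<ge> 1 \<and> length fs = n \<and>
      (\<forall>p\<in>set fs \<union> set gs. mvars p \<subseteq> base_vars n m) \<and>
      variety n m gs \<noteq> {} \<and>
      (\<forall>p\<in>set fs \<union> set gs. total_degree p \<le> D) \<and>
      var_degree (n + m) (variety n m gs) \<le> D
      \<longrightarrow>
      (let r = var_dim (n + m) (variety n m gs); \<nu> = max 1 r in
        \<exists>L::nat. real L \<le> real ((n + m) * D) powr (2 powr (c * real \<nu> ^ 2 * real (n + m))) \<and>
          (1 \<in> diff_ideal_gen n m (ode_gens n fs gs) \<longleftrightarrow>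
           in_poly_ideal (trunc_vars n m L) (ode_gens_trunc n fs gs L) 1)))"
\<comment> \<open>The constant is the exponent factor of \<open>truncation_order_le\<close>.\<close>
proof (intro exI[of _ 7] conjI allI impI; (elim conjE)?)
  fix n m D :: nat and fs gs :: "dvar mpoly list"
  assume n: "n \<ge> 1" and fs: "length fs = n" and vars: "\<forall>p\<in>set fs \<union> set gs. mvars p \<subseteq> base_vars n m"
    and ne: "variety n m gs \<noteq> {}" and deg: "\<forall>p\<in>set fs \<union> set gs. total_degree p \<le> D"
  define \<nu> where "\<nu> = max 1 (var_dim (n + m) (variety n m gs))"
  have \<nu>1: "1 \<le> \<nu>" by (simp add: \<nu>_def)
  let ?N = "n + m"
  let ?bound = "real (?N * D) powr (2 powr (7 * real \<nu> ^ 2 * real ?N))"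
  have "\<exists>L. real L \<le> ?bound \<and> (1 \<in> diff_ideal_gen n m (ode_gens n fs gs) \<longrightarrow>
     in_poly_ideal (trunc_vars n m L) (ode_gens_trunc n fs gs L) 1)"
  proof -
    \<comment> \<open>The general estimate needs a base of at least \<open>2\<close>; for base
      \<open>0\<close> or \<open>1\<close> the bound does not grow with its exponent.\<close>
    consider "D = 0" | "?N * D = 1" | "2 \<le> ?N * D" using n by (cases "?N * D") (auto, fastforce)
    then show ?thesis
    proof cases
      case 1
      then show ?thesis using degree_zero_case[OF fs ne] deg by (intro exI[of _ 0]) auto
    next
      case 2
      then have "n = 1" "m = 0" "D = 1" using n by auto
      then show ?thesis using one_variable_affine_case[of fs gs] fs vars ne deg by (intro exI[of _ 1]) auto
    next
      case 3
      define L where "L = order_bound (degree_bound (2 ^ (3 * ?N + 2)) D ?N) ?N"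
      have D: "1 \<le> D" using 3 by (cases D) auto
      have "1 \<le> ?N * D" using 3 by linarith
      then have ND1: "1 \<le> real (?N * D)" by (metis of_nat_1 of_nat_le_iff)
      have ND: "0 < real (?N * D)" using n D by simp
      have "real L \<le> real (?N * D) ^ (2 ^ (7 * ?N))"
        using truncation_order_le[OF 3] unfolding L_def of_nat_power[symmetric] of_nat_le_iff .
      also have "\<dots> = real (?N * D) powr real (2 ^ (7 * ?N))" by (rule powr_realpow[OF ND, symmetric])
      also have "real (2 ^ (7 * ?N)) = 2 powr (7 * real ?N)"
        using powr_realpow[of 2 "7 * ?N"] by simp
      also have "real (?N * D) powr (2 powr (7 * real ?N)) \<le> ?bound"
      \<comment> \<open>The exponent only increases on multiplication by the square of
        \<open>\<nu>\<close>, which is at least \<open>1\<close>.\<close>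
      proof (intro powr_mono)
        have "1 \<le> real \<nu> ^ 2" using \<nu>1 by simp
        then have "7 * real ?N * 1 \<le> 7 * real ?N * real \<nu> ^ 2" by (intro mult_left_mono) auto
        then show "7 * real ?N \<le> 7 * real \<nu> ^ 2 * real ?N" by (simp add: algebra_simps)
      qed (simp, fact ND1)
      finally have "real L \<le> ?bound" .
      moreover have "1 \<in> diff_ideal_gen n m (ode_gens n fs gs) \<Longrightarrow>
          in_poly_ideal (trunc_vars n m L) (ode_gens_trunc n fs gs L) 1"
        unfolding L_def by (rule truncated_differential_nullstellensatz[OF fs vars deg D])
      ultimately show ?thesis by blast
    qed
  qed
  then show "let r = var_dim (n + m) (variety n m gs); \<nu> = max 1 r in
        \<exists>L::nat. real L \<le> real ((n + m) * D) powr (2 powr (7 * real \<nu> ^ 2 * real (n + m))) \<and>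
          (1 \<in> diff_ideal_gen n m (ode_gens n fs gs) \<longleftrightarrow>
           in_poly_ideal (trunc_vars n m L) (ode_gens_trunc n fs gs L) 1)"
    using trunc_imp_diff_ideal unfolding Let_def \<nu>_def by blast
qed simp

end
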